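(* Let $A=(A_{ij})_{i,j=0,\dots,N-1}$ be a matrix with entries in $\{0,1\}$ and $A_{ii}=1$ for all $i$. Let $\{\sigma_i\}_{i=0}^{N-1}$ be a semibranching function system on $(X,\mu)$ with coding map $\sigma$, where $\sigma_i$ is defined on $D_i\subset X$ and, up to sets of measure zero, $\chi_{D_i}=\sum_jA_{ij}\chi_{R_j}$. Then the operators $T_i$ and $T_i^*$ satisfy $$\sum_iT_iT_i^*=1,\qquad T_i^*T_i=\sum_jA_{ij}T_jT_j^*,$$ hence they determine a representation of the Cuntz–Krieger algebra $O_A$ on the Hilbert space $L^2(X,\mu)$.
   Context: A semibranching function system on a measure space $(X,\mu)$ is a finite family of measurable maps $\sigma_i:D_i\to X$, $i=0,\dots,N-1$, defined on measurable subsets $D_i\subset X$, with ranges $R_i=\sigma_i(D_i)$, such that: $\mu(X\smallsetminus\bigcup_iR_i)=0$ and $\mu(R_i\cap R_j)=0$ for $i\ne j$; and there is a Radon–Nikodym derivative $\Phi_{\sigma_i}=d(\mu\circ\sigma_i)/d\mu$ with $\Phi_{\sigma_i}>0$ $\mu$-a.e. on $D_i$ (i.e. $\mu(\sigma_i(B))=\int_B\Phi_{\sigma_i}d\mu$ for measurable $B\subset D_i$). A measurable map $\sigma:X\to X$ is a coding map for $\{\sigma_i\}$ if $\sigma(\sigma_i(x))=x$ for all $x\in D_i$. The operators $T_i$ on $L^2(X,\mu)$ are $(T_i\psi)(x)=\chi_{R_i}(x)\,(\Phi_{\sigma_i}(\sigma(x)))^{-1/2}\,\psi(\sigma(x))$;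 $T_i^*$ is the Hilbert space adjoint. The Cuntz–Krieger algebra $O_A$ is the $C^*$-algebra generated by partial isometries $S_0,\dots,S_{N-1}$ with relations $S_i^*S_i=\sum_jA_{ij}S_jS_j^*$ and $\sum_iS_iS_i^*=1$; operators on a Hilbert space satisfying these relations determine a representation of $O_A$ by $S_i\mapsto T_i$. *)

theory Defs
  imports "HOL-Analysis.Analysis" "HOL-Library.Poly_Mapping" "HOL-Algebra.Ring"
begin

section \<open>Hilbert spaces on a carrier and their bounded operators\<close>

record 'h inner_space = "'h partial_object" +
  vzero :: 'h
  vadd :: "'h \<Rightarrow> 'h \<Rightarrow> 'h"
  vscale :: "complex \<Rightarrow> 'h \<Rightarrow> 'h"
  vinner :: "'h \<Rightarrow> 'h \<Rightarrow> complex"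

definition vnorm :: "('h, 'm) inner_space_scheme \<Rightarrow> 'h \<Rightarrow> real"
  where "vnorm H x = sqrt (Re (vinner H x x))"

text \<open>Operators are extensional functions, so that equality of operators is equality on the
  carrier.\<close>

definition bounded_ops :: "('h, 'm) inner_space_scheme \<Rightarrow> ('h \<Rightarrow> 'h) set"
  where "bounded_ops H = {T \<in> carrier H \<rightarrow>\<^sub>E carrier H.
    (\<forall>x\<in>carrier H. \<forall>y\<in>carrier H. T (vadd H x y) = vadd H (T x) (T y)) \<and>
    (\<forall>c. \<forall>x\<in>carrier H. T (vscale H c x) = vscale H c (T x)) \<and>
    (\<exists>C. \<forall>x\<in>carrier H. vnorm H (T x) \<le> C * vnorm H x)}"

definition adjoint_op :: "('h, 'm) inner_space_scheme \<Rightarrow> ('h \<Rightarrow> 'h) \<Rightarrow> ('h \<Rightarrow> 'h)"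
  where "adjoint_op H T = (THE S. S \<in> bounded_ops H \<and>
    (\<forall>x\<in>carrier H. \<forall>y\<in>carrier H. vinner H (T x) y = vinner H x (S y)))"

text \<open>Unital complex *-algebras. No norm is recorded: the norm of a C*-algebra is determined by its
  *-algebra structure, and *-homomorphisms of C*-algebras are automatically continuous.\<close>

record 'a star_algebra = "'a ring" +
  cscale :: "complex \<Rightarrow> 'a \<Rightarrow> 'a"
  star :: "'a \<Rightarrow> 'a"

definition operator_algebra :: "('h, 'm) inner_space_scheme \<Rightarrow> ('h \<Rightarrow> 'h) star_algebra"
  where "operator_algebra H =
    \<lparr>carrier = bounded_ops H,
     mult = compose (carrier H),
     one = (\<lambda>x\<in>carrier H. x),
     zero = (\<lambda>x\<in>carrier H. vzero H),
     add = (\<lambda>S T. \<lambda>x\<in>carrier H. vadd H (S x) (T x)),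
     cscale = (\<lambda>c T. \<lambda>x\<in>carrier H. vscale H c (T x)),
     star = adjoint_op H\<rparr>"

definition star_hom :: "('a, 'm) star_algebra_scheme \<Rightarrow> ('b, 'n) star_algebra_scheme \<Rightarrow> ('a \<Rightarrow> 'b) set"
  where "star_hom \<AA> \<BB> = {h \<in> ring_hom \<AA> \<BB>.
    (\<forall>c. \<forall>a\<in>carrier \<AA>. h (cscale \<AA> c a) = cscale \<BB> c (h a)) \<and>
    (\<forall>a\<in>carrier \<AA>. h (star \<AA> a) = star \<BB> (h a))}"

text \<open>A representation is cut off to be extensional, so that it is unique as a function when it is
  unique on the carrier.\<close>

definition representations ::
    "('a, 'm) star_algebra_scheme \<Rightarrow> ('h, 'n) inner_space_scheme \<Rightarrow> ('a \<Rightarrow> 'h \<Rightarrow> 'h) set"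
  where "representations \<AA> H = star_hom \<AA> (operator_algebra H) \<inter> extensional (carrier \<AA>)"


section \<open>The Hilbert space of square integrable functions\<close>

definition sq_integrable :: "'a measure \<Rightarrow> ('a \<Rightarrow> complex) set"
  where "sq_integrable M =
    {f \<in> borel_measurable M. integrable M (\<lambda>x. (cmod (f x))\<^sup>2)}"

definition ae_rel :: "'a measure \<Rightarrow> (('a \<Rightarrow> complex) \<times> ('a \<Rightarrow> complex)) set"
  where "ae_rel M =
    {(f, g). f \<in> sq_integrable M \<and> g \<in> sq_integrable M \<and> (AE x in M. f x = g x)}"

abbreviation L2_class :: "'a measure \<Rightarrow> ('a \<Rightarrow> complex) \<Rightarrow> ('a \<Rightarrow> complex) set"
  where "L2_class M f \<equiv> ae_rel M `` {f}"

definition rep :: "'a set \<Rightarrow> 'a"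
  where "rep X = (SOME x. x \<in> X)"

definition L2 :: "'a measure \<Rightarrow> ('a \<Rightarrow> complex) set inner_space"
  where "L2 M =
    \<lparr>carrier = sq_integrable M // ae_rel M,
     vzero = L2_class M (\<lambda>x. 0),
     vadd = (\<lambda>u v. L2_class M (\<lambda>x. rep u x + rep v x)),
     vscale = (\<lambda>c u. L2_class M (\<lambda>x. c * rep u x)),
     vinner = (\<lambda>u v. \<integral>x. rep u x * cnj (rep v x) \<partial>M)\<rparr>"


section \<open>Semibranching function systems\<close>

text \<open>The functions \<open>s i\<close> and \<open>\<Phi> i\<close> are total in HOL, but only their values on \<open>D i\<close> matter. The
  Radon--Nikodym derivatives are part of the data, since without \<open>\<sigma>\<close>-finiteness they need not be
  unique. The assumption \<open>image_sets\<close> is what makes \<open>B \<mapsto> \<mu> (s i ` B)\<close> meaningful; in HOL the measure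
  of a non-measurable set is \<open>0\<close>.\<close>

locale semibranching_function_system =
  fixes M :: "'a measure"
    and D :: "'n::finite \<Rightarrow> 'a set"
    and s :: "'n \<Rightarrow> 'a \<Rightarrow> 'a"
    and \<Phi> :: "'n \<Rightarrow> 'a \<Rightarrow> real"
  assumes domain_sets: "D i \<in> sets M"
    and measurable_branch: "s i \<in> measurable (restrict_space M (D i)) M"
    and image_sets: "B \<in> sets M \<Longrightarrow> B \<subseteq> D i \<Longrightarrow> s i ` B \<in> sets M"
    and ranges_cover: "emeasure M (space M - (\<Union>i. s i ` D i)) = 0"
    and ranges_disjoint: "i \<noteq> j \<Longrightarrow> emeasure M (s i ` D i \<inter> s j ` D j) = 0"
    and measurable_deriv: "\<Phi> i \<in> borel_measurable (restrict_space M (D i))"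
    and deriv_pos: "AE x in M. x \<in> D i \<longrightarrow> \<Phi> i x > 0"
    and deriv: "B \<in> sets M \<Longrightarrow> B \<subseteq> D i \<Longrightarrow>
      emeasure M (s i ` B) = (\<integral>\<^sup>+x\<in>B. ennreal (\<Phi> i x) \<partial>M)"

definition coding_map ::
    "'a measure \<Rightarrow> ('n \<Rightarrow> 'a set) \<Rightarrow> ('n \<Rightarrow> 'a \<Rightarrow> 'a) \<Rightarrow> ('a \<Rightarrow> 'a) \<Rightarrow> bool"
  where "coding_map M D s \<sigma> \<longleftrightarrow>
    \<sigma> \<in> measurable M M \<and> (\<forall>i. \<forall>x\<in>D i. \<sigma> (s i x) = x)"

definition branch_op ::
    "'a measure \<Rightarrow> ('n \<Rightarrow> 'a set) \<Rightarrow> ('n \<Rightarrow> 'a \<Rightarrow> 'a) \<Rightarrow> ('n \<Rightarrow> 'a \<Rightarrow> real) \<Rightarrow> ('a \<Rightarrow> 'a) \<Rightarrow>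
      'n \<Rightarrow> ('a \<Rightarrow> complex) set \<Rightarrow> ('a \<Rightarrow> complex) set"
  where "branch_op M D s \<Phi> \<sigma> i = (\<lambda>\<psi>\<in>carrier (L2 M). L2_class M
    (\<lambda>x. indicator (s i ` D i) x * of_real (\<Phi> i (\<sigma> x) powr (-1/2)) * rep \<psi> (\<sigma> x)))"


section \<open>The Cuntz--Krieger algebra\<close>

text \<open>The universal C*-algebra on generators \<open>S i\<close> with given relations is the completion of the free
  unital *-algebra in the largest C*-seminorm that annihilates the relations. The free unital
  *-algebra is the monoid algebra over the free monoid of words in the letters \<open>(i, False)\<close>, standing
  for \<open>S i\<close>, and \<open>(i, True)\<close>, standing for its adjoint.  As \<open>\<Rightarrow>\<^sub>0\<close> takes its convolution product
  from an additive monoid, concatenation of words is written as addition.\<close>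

instantiation list :: (type) monoid_add
begin

definition zero_list_def: "0 = ([] :: 'a list)"
definition plus_list_def: "xs + ys = (xs @ ys :: 'a list)"

instance
  by standard (simp_all add: zero_list_def plus_list_def)

end

type_synonym 'n star_poly = "('n \<times> bool) list \<Rightarrow>\<^sub>0 complex"

definition poly_gen :: "'n \<Rightarrow> 'n star_poly"
  where "poly_gen i = Poly_Mapping.single [(i, False)] 1"

definition poly_scale :: "complex \<Rightarrow> 'n star_poly \<Rightarrow> 'n star_poly"
  where "poly_scale c p = Poly_Mapping.single 0 c * p"

definition poly_star :: "'n star_poly \<Rightarrow> 'n star_poly"
  where "poly_star p = (\<Sum>w\<in>Poly_Mapping.keys p.
    Poly_Mapping.single (rev (map (\<lambda>(i, b). (i, \<not> b)) w)) (cnj (Poly_Mapping.lookup p w)))"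

definition cstar_seminorm :: "('n star_poly \<Rightarrow> real) \<Rightarrow> bool"
  where "cstar_seminorm q \<longleftrightarrow>
    (\<forall>a b. q (a + b) \<le> q a + q b) \<and>
    (\<forall>c a. q (poly_scale c a) = cmod c * q a) \<and>
    (\<forall>a b. q (a * b) \<le> q a * q b) \<and>
    (\<forall>a. q (poly_star a * a) = (q a)\<^sup>2)"

text \<open>Each relator stands for the relation that it vanishes; the first family says that the
  generators are partial isometries.\<close>

definition ck_relators :: "nat ^ 'n ^ 'n \<Rightarrow> 'n::finite star_poly set"
  where "ck_relators A =
    (let S = poly_gen; S' = (\<lambda>i. poly_star (poly_gen i)) in
     range (\<lambda>i. S i * S' i * S i - S i) \<union>
     range (\<lambda>i. S' i * S i - (\<Sum>j\<in>UNIV. of_nat (A $ i $ j) * (S j * S' j))) \<union>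
     {(\<Sum>i\<in>UNIV. S i * S' i) - 1})"

text \<open>The supremum is finite: on a word every such seminorm is at most \<open>1\<close>.\<close>

definition ck_norm :: "nat ^ 'n ^ 'n \<Rightarrow> 'n::finite star_poly \<Rightarrow> real"
  where "ck_norm A a = (SUP q\<in>{q. cstar_seminorm q \<and> (\<forall>r\<in>ck_relators A. q r = 0)}. q a)"

definition ck_Cauchy :: "nat ^ 'n ^ 'n \<Rightarrow> (nat \<Rightarrow> 'n::finite star_poly) set"
  where "ck_Cauchy A =
    {X. \<forall>e>0. \<exists>K. \<forall>m\<ge>K. \<forall>n\<ge>K. ck_norm A (X m - X n) < e}"

definition ck_rel ::
    "nat ^ 'n ^ 'n \<Rightarrow> ((nat \<Rightarrow> 'n::finite star_poly) \<times> (nat \<Rightarrow> 'n star_poly)) set"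
  where "ck_rel A = {(X, Y). X \<in> ck_Cauchy A \<and> Y \<in> ck_Cauchy A \<and>
    (\<lambda>n. ck_norm A (X n - Y n)) \<longlonglongrightarrow> 0}"

abbreviation ck_class ::
    "nat ^ 'n ^ 'n \<Rightarrow> (nat \<Rightarrow> 'n::finite star_poly) \<Rightarrow> (nat \<Rightarrow> 'n star_poly) set"
  where "ck_class A X \<equiv> ck_rel A `` {X}"

definition cuntz_krieger_algebra ::
    "nat ^ 'n ^ 'n \<Rightarrow> (nat \<Rightarrow> 'n::finite star_poly) set star_algebra"
  where "cuntz_krieger_algebra A =
    \<lparr>carrier = ck_Cauchy A // ck_rel A,
     mult = (\<lambda>a b. ck_class A (\<lambda>n. rep a n * rep b n)),
     one = ck_class A (\<lambda>n. 1),
     zero = ck_class A (\<lambda>n. 0),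
     add = (\<lambda>a b. ck_class A (\<lambda>n. rep a n + rep b n)),
     cscale = (\<lambda>c a. ck_class A (\<lambda>n. poly_scale c (rep a n))),
     star = (\<lambda>a. ck_class A (\<lambda>n. poly_star (rep a n)))\<rparr>"

definition ck_gen :: "nat ^ 'n ^ 'n \<Rightarrow> 'n::finite \<Rightarrow> (nat \<Rightarrow> 'n star_poly) set"
  where "ck_gen A i = ck_class A (\<lambda>n. poly_gen i)"

end

theory Submission
  imports Defs
begin

text \<open>
  Substituting \<open>x = s i y\<close>, under which \<open>d\<mu>(x) = \<Phi> i y d\<mu>(y)\<close>, shows that \<open>T\<^sub>i\<close> is bounded, with the
  adjoint \<open>(T\<^sub>i* \<eta>)(y) = \<chi>(y) (\<Phi> i y)\<^sup>1\<^sup>/\<^sup>2 \<eta>(s i y)\<close>, where \<open>\<chi>\<close> is the indicator of \<open>D i\<close>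
  (\<open>integral_iso_coiso\<close>). Hence \<open>T\<^sub>i T\<^sub>i*\<close> is multiplication by the indicator of the range of \<open>s i\<close> and
  \<open>T\<^sub>i* T\<^sub>i\<close> is multiplication by the indicator of \<open>D i\<close> (\<open>iso_coiso\<close>, \<open>coiso_iso\<close>). As the ranges
  partition the space up to null sets, and the indicator of \<open>D i\<close> is the sum of \<open>A i j\<close> times the
  indicators of the ranges, the two Cuntz--Krieger relations follow. Moreover \<open>T\<^sub>i T\<^sub>i* T\<^sub>i = T\<^sub>i\<close>.

  The rest is the universal property of the Cuntz--Krieger algebra (\<open>ex1_representation\<close>). For
  existence, evaluate noncommutative *-polynomials at the \<open>T\<^sub>i\<close>. The operator norm then pulls back to a
  C*-seminorm that annihilates the relators, so it is bounded by \<open>ck_norm\<close>, and the evaluation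
  extends to the completion because the bounded operators are complete. For uniqueness, two
  representations that agree on the generators agree on polynomials, and they agree everywhere once
  representations are known to be continuous. They are contractive (\<open>op_norm_representation_le\<close>): an
  element \<open>a\<close> with \<open>\<parallel>a\<parallel> < t\<close> has \<open>1 - a* a / t\<^sup>2\<close> invertible by a Neumann series, whereas
  \<open>1 - T* T / t\<^sup>2\<close> is not bounded below if \<open>T\<close> is a nonzero operator of norm \<open>t\<close>.

  Both parts take place in a Hilbert space, so the space of square integrable functions is shown to be
  complete (\<open>Riesz_Fischer\<close>), and adjoints of arbitrary bounded operators are obtained from
  the Riesz representation theorem.
\<close>

section \<open>Hilbert spaces on a carrier\<close>

text \<open>The vector space laws are not assumed: \<open>inner_ext\<close> says that a vector is determined by its inner
  products, so every identity between vectors follows by taking inner products with all \<open>z\<close> and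
  computing in the complex numbers. The last assumption is completeness, \<open>x - y\<close> being written as
  \<open>x + (-1) y\<close>.\<close>

locale hilbert_carrier =
  fixes H :: "('h, 'm) inner_space_scheme"
  assumes zero_closed [simp]: "vzero H \<in> carrier H"
    and add_closed [simp]: "\<lbrakk>x \<in> carrier H; y \<in> carrier H\<rbrakk> \<Longrightarrow> vadd H x y \<in> carrier H"
    and scale_closed [simp]: "x \<in> carrier H \<Longrightarrow> vscale H c x \<in> carrier H"
    and inner_zero_left [simp]: "z \<in> carrier H \<Longrightarrow> vinner H (vzero H) z = 0"
    and inner_add_left [simp]: "\<lbrakk>x \<in> carrier H; y \<in> carrier H; z \<in> carrier H\<rbrakk>
      \<Longrightarrow> vinner H (vadd H x y) z = vinner H x z + vinner H y z"
    and inner_scale_left [simp]: "\<lbrakk>x \<in> carrier H; z \<in> carrier H\<rbrakk>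
      \<Longrightarrow> vinner H (vscale H c x) z = c * vinner H x z"
    and inner_commute: "\<lbrakk>x \<in> carrier H; y \<in> carrier H\<rbrakk> \<Longrightarrow> vinner H y x = cnj (vinner H x y)"
    and inner_self_nonneg: "x \<in> carrier H \<Longrightarrow> 0 \<le> Re (vinner H x x)"
    and inner_ext: "\<lbrakk>x \<in> carrier H; y \<in> carrier H;
      \<And>z. z \<in> carrier H \<Longrightarrow> vinner H x z = vinner H y z\<rbrakk> \<Longrightarrow> x = y"
    and complete: "\<lbrakk>\<And>n. X n \<in> carrier H;
      \<And>e. e > 0 \<Longrightarrow> \<exists>K. \<forall>m\<ge>K. \<forall>n\<ge>K. vnorm H (vadd H (X m) (vscale H (-1) (X n))) < e\<rbrakk>
      \<Longrightarrow> \<exists>x\<in>carrier H. (\<lambda>n. vnorm H (vadd H (X n) (vscale H (-1) x))) \<longlonglongrightarrow> 0"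
begin

abbreviation vsub :: "'h \<Rightarrow> 'h \<Rightarrow> 'h"
  where "vsub x y \<equiv> vadd H x (vscale H (-1) y)"

lemma inner_zero_right [simp]: "x \<in> carrier H \<Longrightarrow> vinner H x (vzero H) = 0"
  using inner_commute[of "vzero H" x] by simp

lemma inner_add_right [simp]:
  "\<lbrakk>x \<in> carrier H; y \<in> carrier H; z \<in> carrier H\<rbrakk>
    \<Longrightarrow> vinner H z (vadd H x y) = vinner H z x + vinner H z y"
  using inner_commute[of "vadd H x y" z] inner_commute[of x z] inner_commute[of y z] by simp

lemma inner_scale_right [simp]:
  "\<lbrakk>x \<in> carrier H; z \<in> carrier H\<rbrakk> \<Longrightarrow> vinner H z (vscale H c x) = cnj c * vinner H z x"
  using inner_commute[of "vscale H c x" z] inner_commute[of x z] by simp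

lemma vnorm_nonneg [simp]: "x \<in> carrier H \<Longrightarrow> 0 \<le> vnorm H x"
  by (simp add: vnorm_def inner_self_nonneg)

lemma vnorm_sq: "x \<in> carrier H \<Longrightarrow> (vnorm H x)\<^sup>2 = Re (vinner H x x)"
  by (simp add: vnorm_def inner_self_nonneg)

lemma inner_self: "x \<in> carrier H \<Longrightarrow> vinner H x x = of_real ((vnorm H x)\<^sup>2)"
proof -
  assume x: "x \<in> carrier H"
  have "Im (vinner H x x) = 0"
    using arg_cong[OF inner_commute[OF x x], of Im] by simp
  then show ?thesis
    by (simp add: complex_eq_iff vnorm_sq x)
qed

lemma vnorm_add_sq:
  assumes "x \<in> carrier H" "y \<in> carrier H"
  shows "(vnorm H (vadd H x y))\<^sup>2 = (vnorm H x)\<^sup>2 + 2 * Re (vinner H x y) + (vnorm H y)\<^sup>2"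
  using assms inner_commute[of x y] by (simp add: vnorm_sq)

lemma vnorm_scale [simp]: "x \<in> carrier H \<Longrightarrow> vnorm H (vscale H c x) = cmod c * vnorm H x"
proof -
  assume x: "x \<in> carrier H"
  have "(vnorm H (vscale H c x))\<^sup>2 = Re (c * cnj c * vinner H x x)"
    using x by (simp add: vnorm_sq mult_ac)
  also have "\<dots> = (cmod c * vnorm H x)\<^sup>2"
    by (simp only: complex_norm_square[symmetric] inner_self[OF x] of_real_mult[symmetric]
        Re_complex_of_real power_mult_distrib)
  finally show ?thesis
    using x by (simp add: power2_eq_iff_nonneg)
qed

text \<open>The usual proof: the squared norm of \<open>x - t \<langle>x, y\<rangle> y\<close> is nonnegative for every real \<open>t\<close>. The case
  \<open>\<parallel>y\<parallel> = 0\<close> is separate, as \<open>y = 0\<close> is not known at this point.\<close>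

lemma Cauchy_Schwarz:
  assumes x: "x \<in> carrier H" and y: "y \<in> carrier H"
  shows "cmod (vinner H x y) \<le> vnorm H x * vnorm H y"
proof -
  define k where "k = (cmod (vinner H x y))\<^sup>2"
  have quad: "0 \<le> (vnorm H x)\<^sup>2 - 2 * t * k + t\<^sup>2 * k * (vnorm H y)\<^sup>2" for t :: real
  proof -
    define c where "c = - of_real t * vinner H x y"
    have "vinner H x y * cnj (vinner H x y) = of_real k"
      by (simp add: k_def complex_norm_square[symmetric])
    then have "cnj c * vinner H x y = of_real (- t * k)"
      by (simp add: c_def mult_ac)
    moreover have "(cmod c)\<^sup>2 = t\<^sup>2 * k"
      by (simp add: c_def k_def norm_mult power_mult_distrib)
    ultimately have "(vnorm H (vadd H x (vscale H c y)))\<^sup>2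
        = (vnorm H x)\<^sup>2 - 2 * t * k + t\<^sup>2 * k * (vnorm H y)\<^sup>2"
      using x y by (simp add: vnorm_add_sq power_mult_distrib)
    then show ?thesis
      by (metis zero_le_power2)
  qed
  have "k \<le> (vnorm H x)\<^sup>2 * (vnorm H y)\<^sup>2"
  proof (cases "vnorm H y = 0")
    case True
    have "k = 0"
    proof (rule ccontr)
      assume "k \<noteq> 0"
      then have "k > 0" by (simp add: k_def)
      then show False
        using quad[of "((vnorm H x)\<^sup>2 + 1) / (2 * k)"] True by simp
    qed
    then show ?thesis by simp
  next
    case False
    then show ?thesis
      using quad[of "1 / (vnorm H y)\<^sup>2"]
      by (simp add: divide_simps power2_eq_square mult_ac split: if_splits)
  qed
  then have "(cmod (vinner H x y))\<^sup>2 \<le> (vnorm H x * vnorm H y)\<^sup>2"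
    by (simp add: k_def power_mult_distrib)
  then show ?thesis
    using x y by (simp add: power2_le_iff_abs_le)
qed

lemma vnorm_triangle:
  assumes "x \<in> carrier H" "y \<in> carrier H"
  shows "vnorm H (vadd H x y) \<le> vnorm H x + vnorm H y"
proof (rule power2_le_imp_le)
  have "Re (vinner H x y) \<le> vnorm H x * vnorm H y"
    using Cauchy_Schwarz[OF assms] complex_Re_le_cmod[of "vinner H x y"] by linarith
  then show "(vnorm H (vadd H x y))\<^sup>2 \<le> (vnorm H x + vnorm H y)\<^sup>2"
    using assms by (simp add: vnorm_add_sq power2_sum)
qed (use assms in simp)

lemma vnorm_le_if_inner_le:
  assumes x: "x \<in> carrier H" and le: "cmod (vinner H x x) \<le> C * vnorm H x" and C: "0 \<le> C"
  shows "vnorm H x \<le> C"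
proof -
  have "vnorm H x * vnorm H x \<le> C * vnorm H x"
    using le x by (simp add: inner_self power2_eq_square norm_mult)
  then show ?thesis
    using C vnorm_nonneg[OF x] by (cases "vnorm H x = 0") auto
qed

lemma vsub_self: "x \<in> carrier H \<Longrightarrow> vsub x x = vzero H"
  by (rule inner_ext) auto

lemma inner_vlim:
  assumes X: "\<And>n. X n \<in> carrier H" and x: "x \<in> carrier H" and z: "z \<in> carrier H"
    and lim: "(\<lambda>n. vnorm H (vsub (X n) x)) \<longlonglongrightarrow> 0"
  shows "(\<lambda>n. vinner H (X n) z) \<longlonglongrightarrow> vinner H x z"
proof (rule Lim_null_comparison[THEN LIM_zero_cancel])
  show "\<forall>\<^sub>F n in sequentially. norm (vinner H (X n) z - vinner H x z)
      \<le> vnorm H (vsub (X n) x) * vnorm H z"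
  proof (rule always_eventually, rule allI)
    fix n
    show "norm (vinner H (X n) z - vinner H x z) \<le> vnorm H (vsub (X n) x) * vnorm H z"
      using Cauchy_Schwarz[of "vsub (X n) x" z] X x z by simp
  qed
  show "(\<lambda>n. vnorm H (vsub (X n) x) * vnorm H z) \<longlonglongrightarrow> 0"
    using tendsto_mult_left_zero[OF lim] by simp
qed

lemma vnorm_le_lim:
  assumes X: "\<And>n. X n \<in> carrier H" and x: "x \<in> carrier H" and C: "0 \<le> C"
    and lim: "(\<lambda>n. vnorm H (vsub (X n) x)) \<longlonglongrightarrow> 0"
    and bd: "\<forall>\<^sub>F n in sequentially. vnorm H (X n) \<le> C"
  shows "vnorm H x \<le> C"
proof (rule vnorm_le_if_inner_le[OF x _ C])
  show "cmod (vinner H x x) \<le> C * vnorm H x"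
  proof (rule tendsto_upperbound[OF tendsto_norm[OF inner_vlim[OF X x x lim]]])
    show "\<forall>\<^sub>F n in sequentially. norm (vinner H (X n) x) \<le> C * vnorm H x"
      using bd
    proof eventually_elim
      case (elim n)
      have "cmod (vinner H (X n) x) \<le> vnorm H (X n) * vnorm H x"
        using X x by (rule Cauchy_Schwarz)
      also have "\<dots> \<le> C * vnorm H x"
        using elim x by (simp add: mult_right_mono)
      finally show ?case .
    qed
  qed simp
qed


section \<open>Riesz representation\<close>

text \<open>The vector \<open>y\<close> of least norm in the affine hyperplane \<open>S = {x. f x = 1}\<close> is orthogonal to the
  kernel of \<open>f\<close>, and \<open>f\<close> is the inner product with \<open>y / \<parallel>y\<parallel>\<^sup>2\<close>.\<close>

lemma Riesz_representation:
  assumes add: "\<And>x y. \<lbrakk>x \<in> carrier H; y \<in> carrier H\<rbrakk> \<Longrightarrow> f (vadd H x y) = f x + f y"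
    and scale: "\<And>c x. x \<in> carrier H \<Longrightarrow> f (vscale H c x) = c * f x"
    and bounded: "\<And>x. x \<in> carrier H \<Longrightarrow> cmod (f x) \<le> C * vnorm H x"
  shows "\<exists>y\<in>carrier H. \<forall>x\<in>carrier H. f x = vinner H x y"
proof (cases "\<forall>x\<in>carrier H. f x = 0")
  case True
  then show ?thesis by (intro bexI[of _ "vzero H"]) auto
next
  case False
  define S where "S = {x \<in> carrier H. f x = 1}"
  define d where "d = Inf ((\<lambda>x. (vnorm H x)\<^sup>2) ` S)"
  obtain w where w: "w \<in> carrier H" "f w \<noteq> 0" using False by auto
  then have "vscale H (1 / f w) w \<in> S"
    by (simp add: S_def scale)
  then have ne: "(\<lambda>x. (vnorm H x)\<^sup>2) ` S \<noteq> {}" by blast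
  have bdd: "bdd_below ((\<lambda>x. (vnorm H x)\<^sup>2) ` S)"
    by (auto intro: bdd_belowI[of _ 0])
  have d_le: "d \<le> (vnorm H x)\<^sup>2" if "x \<in> S" for x
    unfolding d_def using that by (intro cInf_lower bdd) auto
  have "\<exists>x\<in>S. (vnorm H x)\<^sup>2 < d + inverse (real (Suc n))" for n
    using cInf_lessD[OF ne, of "d + inverse (real (Suc n))"] by (auto simp: d_def)
  then obtain X where XS: "\<And>n. X n \<in> S"
    and Xd: "\<And>n. (vnorm H (X n))\<^sup>2 < d + inverse (real (Suc n))"
    by metis
  have X: "X n \<in> carrier H" for n using XS by (simp add: S_def)
  \<comment> \<open>The midpoint of two points of \<open>S\<close> is in \<open>S\<close>, so the parallelogram law makes a minimizing
    sequence Cauchy.\<close>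
  have par: "(vnorm H (vsub (X m) (X n)))\<^sup>2 < 2 * inverse (real (Suc m)) + 2 * inverse (real (Suc n))"
    for m n
  proof -
    let ?c = "vscale H (1/2) (vadd H (X m) (X n))"
    have "?c \<in> S"
      using XS[of m] XS[of n] by (simp add: S_def add scale)
    then have "d \<le> (vnorm H ?c)\<^sup>2" by (rule d_le)
    then have "4 * d \<le> (vnorm H (vadd H (X m) (X n)))\<^sup>2"
      using X by (simp add: power_divide)
    moreover have "(vnorm H (vsub (X m) (X n)))\<^sup>2 + (vnorm H (vadd H (X m) (X n)))\<^sup>2
        = 2 * (vnorm H (X m))\<^sup>2 + 2 * (vnorm H (X n))\<^sup>2"
      using X by (simp add: vnorm_add_sq)
    ultimately show ?thesis
      using Xd[of m] Xd[of n] by linarith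
  qed
  have "\<exists>x\<in>carrier H. (\<lambda>n. vnorm H (vsub (X n) x)) \<longlonglongrightarrow> 0"
  proof (rule complete[OF X])
    fix e :: real assume e: "e > 0"
    obtain K where K: "inverse (real (Suc K)) < e\<^sup>2 / 4"
      using reals_Archimedean[of "e\<^sup>2 / 4"] e by auto
    have "vnorm H (vsub (X m) (X n)) < e" if "m \<ge> K" "n \<ge> K" for m n
    proof (rule power2_less_imp_less)
      have "inverse (real (Suc m)) \<le> inverse (real (Suc K))"
        "inverse (real (Suc n)) \<le> inverse (real (Suc K))"
        using that by auto
      then show "(vnorm H (vsub (X m) (X n)))\<^sup>2 < e\<^sup>2"
        using par[of m n] K by linarith
    qed (use e in simp)
    then show "\<exists>K. \<forall>m\<ge>K. \<forall>n\<ge>K. vnorm H (vsub (X m) (X n)) < e" by blast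
  qed
  then obtain y where y: "y \<in> carrier H" and lim: "(\<lambda>n. vnorm H (vsub (X n) y)) \<longlonglongrightarrow> 0"
    by blast
  have fy: "f y = 1"
  proof -
    have "cmod (1 - f y) \<le> C * vnorm H (vsub (X n) y)" for n
      using bounded[of "vsub (X n) y"] XS[of n] y by (simp add: S_def add scale)
    moreover have "(\<lambda>n. C * vnorm H (vsub (X n) y)) \<longlonglongrightarrow> 0"
      using tendsto_mult_right_zero[OF lim] .
    ultimately have "cmod (1 - f y) \<le> 0"
      by (intro LIMSEQ_le_const) auto
    then show ?thesis by simp
  qed
  have y_le: "(vnorm H y)\<^sup>2 \<le> (vnorm H x)\<^sup>2" if "x \<in> S" for x
  proof -
    have "(vnorm H y)\<^sup>2 \<le> d"
    proof (rule field_le_epsilon)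
      fix e :: real assume e: "e > 0"
      obtain K where K: "inverse (real (Suc K)) < e"
        using reals_Archimedean e by blast
      have "0 \<le> d"
        unfolding d_def by (rule cInf_greatest[OF ne]) auto
      then have nonneg: "0 \<le> d + e" using e by simp
      have "vnorm H y \<le> sqrt (d + e)"
      proof (rule vnorm_le_lim[OF X y _ lim])
        show "\<forall>\<^sub>F n in sequentially. vnorm H (X n) \<le> sqrt (d + e)"
        proof (rule eventually_sequentiallyI[of K])
          fix n assume "K \<le> n"
          then have "inverse (real (Suc n)) \<le> inverse (real (Suc K))" by auto
          then show "vnorm H (X n) \<le> sqrt (d + e)"
            using Xd[of n] K by (intro real_le_rsqrt) linarith
        qed
      qed (use nonneg in simp)
      then have "(vnorm H y)\<^sup>2 \<le> (sqrt (d + e))\<^sup>2"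
        using y by (intro power_mono) auto
      then show "(vnorm H y)\<^sup>2 \<le> d + e" using nonneg by simp
    qed
    then show ?thesis using d_le[OF that] by linarith
  qed
  \<comment> \<open>Otherwise \<open>y - t \<langle>y, z\<rangle> z\<close>, which is in \<open>S\<close> too, is shorter than \<open>y\<close> for small \<open>t > 0\<close>.\<close>
  have orth: "vinner H z y = 0" if z: "z \<in> carrier H" "f z = 0" for z
  proof -
    define k where "k = (cmod (vinner H y z))\<^sup>2"
    have quad: "2 * k \<le> t * k * (vnorm H z)\<^sup>2" if t: "t > 0" for t :: real
    proof -
      define c where "c = - of_real t * vinner H y z"
      have "vinner H y z * cnj (vinner H y z) = of_real k"
        by (simp add: k_def complex_norm_square[symmetric])
      then have "cnj c * vinner H y z = of_real (- t * k)"
        by (simp add: c_def mult_ac)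
      moreover have "(cmod c)\<^sup>2 = t\<^sup>2 * k"
        by (simp add: c_def k_def norm_mult power_mult_distrib)
      moreover have "vadd H y (vscale H c z) \<in> S"
        using z y fy by (simp add: S_def add scale)
      ultimately have "0 \<le> - 2 * t * k + t\<^sup>2 * k * (vnorm H z)\<^sup>2"
        using y_le[of "vadd H y (vscale H c z)"] y z
        by (simp add: vnorm_add_sq power_mult_distrib)
      then have "0 \<le> t * (t * k * (vnorm H z)\<^sup>2 - 2 * k)"
        by (simp add: algebra_simps power2_eq_square)
      then show ?thesis
        using t by (simp add: zero_le_mult_iff)
    qed
    have "k = 0"
    proof (rule ccontr)
      assume "k \<noteq> 0"
      then have k: "k > 0" by (simp add: k_def)
      have "2 * k \<le> inverse ((vnorm H z)\<^sup>2 + 1) * k * (vnorm H z)\<^sup>2"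
        by (rule quad) (simp add: add_nonneg_pos)
      also have "\<dots> = k * ((vnorm H z)\<^sup>2 / ((vnorm H z)\<^sup>2 + 1))"
        by (simp add: divide_inverse mult_ac)
      also have "\<dots> \<le> k * 1"
        using k by (intro mult_left_mono) (auto simp: divide_le_eq add_nonneg_pos)
      finally show False using k by simp
    qed
    then show ?thesis
      using inner_commute[OF y z(1)] by (simp add: k_def)
  qed
  have ny: "vnorm H y \<noteq> 0"
    using bounded[OF y] fy by auto
  show ?thesis
  proof (intro bexI[of _ "vscale H (of_real (1 / (vnorm H y)\<^sup>2)) y"] ballI)
    fix x assume x: "x \<in> carrier H"
    have "vinner H (vadd H x (vscale H (- f x) y)) y = 0"
      using x y fy by (intro orth) (simp_all add: add scale)
    then have "vinner H x y = f x * of_real ((vnorm H y)\<^sup>2)"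
      using x y by (simp add: inner_self)
    then show "f x = vinner H x (vscale H (of_real (1 / (vnorm H y)\<^sup>2)) y)"
      using x y ny by simp
  qed (use y in simp)
qed


section \<open>The algebra of bounded operators\<close>

abbreviation \<BB> where "\<BB> \<equiv> operator_algebra H"

end

text \<open>The operator norm as the least bound, which makes sense on the zero space as well.\<close>

definition op_norm :: "('h, 'm) inner_space_scheme \<Rightarrow> ('h \<Rightarrow> 'h) \<Rightarrow> real"
  where "op_norm H T = Inf {C. 0 \<le> C \<and> (\<forall>x\<in>carrier H. vnorm H (T x) \<le> C * vnorm H x)}"

context hilbert_carrier
begin

lemma operator_algebra_simps:
  "carrier \<BB> = bounded_ops H"
  "S \<otimes>\<^bsub>\<BB>\<^esub> T = compose (carrier H) S T"
  "\<one>\<^bsub>\<BB>\<^esub> = (\<lambda>x\<in>carrier H. x)"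
  "\<zero>\<^bsub>\<BB>\<^esub> = (\<lambda>x\<in>carrier H. vzero H)"
  "S \<oplus>\<^bsub>\<BB>\<^esub> T = (\<lambda>x\<in>carrier H. vadd H (S x) (T x))"
  "cscale \<BB> c T = (\<lambda>x\<in>carrier H. vscale H c (T x))"
  "star \<BB> T = adjoint_op H T"
  by (simp_all add: operator_algebra_def)

lemma op_apply [simp]:
  assumes "x \<in> carrier H"
  shows "(S \<otimes>\<^bsub>\<BB>\<^esub> T) x = S (T x)" "\<one>\<^bsub>\<BB>\<^esub> x = x" "\<zero>\<^bsub>\<BB>\<^esub> x = vzero H"
    "(S \<oplus>\<^bsub>\<BB>\<^esub> T) x = vadd H (S x) (T x)" "cscale \<BB> c T x = vscale H c (T x)"
  using assms by (simp_all add: operator_algebra_simps compose_def)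

lemma op_closed [simp]: "\<lbrakk>T \<in> bounded_ops H; x \<in> carrier H\<rbrakk> \<Longrightarrow> T x \<in> carrier H"
  unfolding bounded_ops_def by blast

lemma op_add: "\<lbrakk>T \<in> bounded_ops H; x \<in> carrier H; y \<in> carrier H\<rbrakk>
    \<Longrightarrow> T (vadd H x y) = vadd H (T x) (T y)"
  unfolding bounded_ops_def by blast

lemma op_scale: "\<lbrakk>T \<in> bounded_ops H; x \<in> carrier H\<rbrakk> \<Longrightarrow> T (vscale H c x) = vscale H c (T x)"
  unfolding bounded_ops_def by blast

lemma op_extensional: "T \<in> bounded_ops H \<Longrightarrow> T \<in> extensional (carrier H)"
  unfolding bounded_ops_def PiE_def by blast

lemma bounded_opsI:
  assumes "T \<in> extensional (carrier H)" "\<And>x. x \<in> carrier H \<Longrightarrow> T x \<in> carrier H"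
    and "\<And>x y. \<lbrakk>x \<in> carrier H; y \<in> carrier H\<rbrakk> \<Longrightarrow> T (vadd H x y) = vadd H (T x) (T y)"
    and "\<And>c x. x \<in> carrier H \<Longrightarrow> T (vscale H c x) = vscale H c (T x)"
    and "\<And>x. x \<in> carrier H \<Longrightarrow> vnorm H (T x) \<le> C * vnorm H x"
  shows "T \<in> bounded_ops H"
  unfolding bounded_ops_def PiE_def using assms by blast

lemma op_eqI:
  assumes S: "S \<in> bounded_ops H" and T: "T \<in> bounded_ops H"
    and eq: "\<And>x z. \<lbrakk>x \<in> carrier H; z \<in> carrier H\<rbrakk> \<Longrightarrow> vinner H (S x) z = vinner H (T x) z"
  shows "S = T"
proof (rule extensionalityI[of _ "carrier H"])
  show "S \<in> extensional (carrier H)" "T \<in> extensional (carrier H)"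
    using S T by (auto intro: op_extensional)
  show "S x = T x" if "x \<in> carrier H" for x
    using that S T eq by (intro inner_ext) auto
qed

lemma op_bound_ex:
  assumes T: "T \<in> bounded_ops H"
  shows "\<exists>C\<ge>0. \<forall>x\<in>carrier H. vnorm H (T x) \<le> C * vnorm H x"
proof -
  obtain C where C: "\<forall>x\<in>carrier H. vnorm H (T x) \<le> C * vnorm H x"
    using T unfolding bounded_ops_def by blast
  have "vnorm H (T x) \<le> \<bar>C\<bar> * vnorm H x" if "x \<in> carrier H" for x
    using C that mult_right_mono[of C "\<bar>C\<bar>" "vnorm H x"] by fastforce
  then show ?thesis by (intro exI[of _ "\<bar>C\<bar>"]) auto
qed

lemma op_norm_nonneg [simp]: "T \<in> bounded_ops H \<Longrightarrow> 0 \<le> op_norm H T"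
  unfolding op_norm_def using op_bound_ex[of T] by (intro cInf_greatest) auto

lemma op_norm_le:
  assumes "0 \<le> C" "\<And>x. x \<in> carrier H \<Longrightarrow> vnorm H (T x) \<le> C * vnorm H x"
  shows "op_norm H T \<le> C"
  unfolding op_norm_def using assms by (intro cInf_lower bdd_belowI[of _ 0]) auto

lemma vnorm_op_le:
  assumes T: "T \<in> bounded_ops H" and x: "x \<in> carrier H"
  shows "vnorm H (T x) \<le> op_norm H T * vnorm H x"
proof (cases "vnorm H x = 0")
  case True
  then show ?thesis using op_bound_ex[OF T] x by fastforce
next
  case False
  then have pos: "vnorm H x > 0" using vnorm_nonneg[OF x] by linarith
  have "vnorm H (T x) / vnorm H x \<le> op_norm H T"
    unfolding op_norm_def using op_bound_ex[OF T] pos x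
    by (intro cInf_greatest) (auto simp: divide_le_eq)
  then show ?thesis using pos by (simp add: divide_le_eq)
qed

lemma mult_op_closed:
  assumes S: "S \<in> bounded_ops H" and T: "T \<in> bounded_ops H"
  shows "S \<otimes>\<^bsub>\<BB>\<^esub> T \<in> bounded_ops H"
proof (rule bounded_opsI[where C = "op_norm H S * op_norm H T"])
  fix x assume x: "x \<in> carrier H"
  have "vnorm H (S (T x)) \<le> op_norm H S * vnorm H (T x)"
    using S T x by (simp add: vnorm_op_le)
  also have "\<dots> \<le> op_norm H S * (op_norm H T * vnorm H x)"
    using S T x by (intro mult_left_mono vnorm_op_le) auto
  finally show "vnorm H ((S \<otimes>\<^bsub>\<BB>\<^esub> T) x) \<le> op_norm H S * op_norm H T * vnorm H x"
    using x by (simp add: mult_ac)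
qed (use S T in \<open>auto simp: operator_algebra_simps op_add op_scale compose_def\<close>)

lemma op_norm_mult_le:
  assumes S: "S \<in> bounded_ops H" and T: "T \<in> bounded_ops H"
  shows "op_norm H (S \<otimes>\<^bsub>\<BB>\<^esub> T) \<le> op_norm H S * op_norm H T"
proof (rule op_norm_le)
  fix x assume x: "x \<in> carrier H"
  have "vnorm H (S (T x)) \<le> op_norm H S * vnorm H (T x)"
    using S T x by (simp add: vnorm_op_le)
  also have "\<dots> \<le> op_norm H S * (op_norm H T * vnorm H x)"
    using S T x by (intro mult_left_mono vnorm_op_le) auto
  finally show "vnorm H ((S \<otimes>\<^bsub>\<BB>\<^esub> T) x) \<le> op_norm H S * op_norm H T * vnorm H x"
    using x by (simp add: mult_ac)
qed (use S T in simp)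

lemma vnorm_add_op_le:
  assumes S: "S \<in> bounded_ops H" and T: "T \<in> bounded_ops H" and x: "x \<in> carrier H"
  shows "vnorm H ((S \<oplus>\<^bsub>\<BB>\<^esub> T) x) \<le> (op_norm H S + op_norm H T) * vnorm H x"
  using vnorm_triangle[of "S x" "T x"] vnorm_op_le[OF S x] vnorm_op_le[OF T x] S T x
  by (simp add: algebra_simps)

lemma add_op_closed:
  assumes S: "S \<in> bounded_ops H" and T: "T \<in> bounded_ops H"
  shows "S \<oplus>\<^bsub>\<BB>\<^esub> T \<in> bounded_ops H"
proof (rule bounded_opsI[where T = "S \<oplus>\<^bsub>\<BB>\<^esub> T", OF _ _ _ _ vnorm_add_op_le[OF S T]])
  fix x y assume xy: "x \<in> carrier H" "y \<in> carrier H"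
  show "(S \<oplus>\<^bsub>\<BB>\<^esub> T) (vadd H x y) = vadd H ((S \<oplus>\<^bsub>\<BB>\<^esub> T) x) ((S \<oplus>\<^bsub>\<BB>\<^esub> T) y)"
    using S T xy by (intro inner_ext) (simp_all add: op_add)
next
  fix c x assume x: "x \<in> carrier H"
  show "(S \<oplus>\<^bsub>\<BB>\<^esub> T) (vscale H c x) = vscale H c ((S \<oplus>\<^bsub>\<BB>\<^esub> T) x)"
    using S T x by (intro inner_ext) (simp_all add: op_scale algebra_simps)
qed (use S T in \<open>auto simp: operator_algebra_simps\<close>)

lemma op_norm_triangle:
  assumes "S \<in> bounded_ops H" "T \<in> bounded_ops H"
  shows "op_norm H (S \<oplus>\<^bsub>\<BB>\<^esub> T) \<le> op_norm H S + op_norm H T"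
  using assms vnorm_add_op_le[OF assms] by (intro op_norm_le) auto

lemma scale_op_closed:
  assumes T: "T \<in> bounded_ops H"
  shows "cscale \<BB> c T \<in> bounded_ops H"
proof (rule bounded_opsI[where C = "cmod c * op_norm H T"])
  fix x y assume xy: "x \<in> carrier H" "y \<in> carrier H"
  show "cscale \<BB> c T (vadd H x y) = vadd H (cscale \<BB> c T x) (cscale \<BB> c T y)"
    using T xy by (intro inner_ext) (simp_all add: op_add algebra_simps)
next
  fix a x assume x: "x \<in> carrier H"
  show "cscale \<BB> c T (vscale H a x) = vscale H a (cscale \<BB> c T x)"
    using T x by (intro inner_ext) (simp_all add: op_scale algebra_simps)
next
  fix x assume x: "x \<in> carrier H"
  show "vnorm H (cscale \<BB> c T x) \<le> cmod c * op_norm H T * vnorm H x"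
    using T x vnorm_op_le[OF T x] by (simp add: mult_left_mono mult.assoc)
qed (use T in \<open>auto simp: operator_algebra_simps\<close>)

lemma op_norm_scale:
  assumes T: "T \<in> bounded_ops H"
  shows "op_norm H (cscale \<BB> c T) = cmod c * op_norm H T"
proof (rule antisym)
  have le: "op_norm H (cscale \<BB> c S) \<le> cmod c * op_norm H S" if S: "S \<in> bounded_ops H" for c S
  proof (rule op_norm_le)
    fix x assume x: "x \<in> carrier H"
    show "vnorm H (cscale \<BB> c S x) \<le> cmod c * op_norm H S * vnorm H x"
      using S x vnorm_op_le[OF S x] by (simp add: mult_left_mono mult.assoc)
  qed (use S in simp)
  show "op_norm H (cscale \<BB> c T) \<le> cmod c * op_norm H T"
    by (rule le[OF T])
  show "cmod c * op_norm H T \<le> op_norm H (cscale \<BB> c T)"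
  proof (cases "c = 0")
    case False
    have "cscale \<BB> (1 / c) (cscale \<BB> c T) = T"
      using T False by (intro op_eqI scale_op_closed T) auto
    then show ?thesis
      using le[OF scale_op_closed[OF T, of c], of "1 / c"] False
      by (simp add: norm_divide field_simps)
  qed (use scale_op_closed[OF T] in simp)
qed

lemma one_op_closed: "\<one>\<^bsub>\<BB>\<^esub> \<in> bounded_ops H"
  by (rule bounded_opsI[where C = 1]) (auto simp: operator_algebra_simps)

lemma zero_op_closed: "\<zero>\<^bsub>\<BB>\<^esub> \<in> bounded_ops H"
proof (rule bounded_opsI[where C = 0])
  fix x y assume xy: "x \<in> carrier H" "y \<in> carrier H"
  show "\<zero>\<^bsub>\<BB>\<^esub> (vadd H x y) = vadd H (\<zero>\<^bsub>\<BB>\<^esub> x) (\<zero>\<^bsub>\<BB>\<^esub> y)"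
    using xy by (intro inner_ext) simp_all
next
  fix a x assume x: "x \<in> carrier H"
  show "\<zero>\<^bsub>\<BB>\<^esub> (vscale H a x) = vscale H a (\<zero>\<^bsub>\<BB>\<^esub> x)"
    using x by (intro inner_ext) simp_all
qed (auto simp: operator_algebra_simps vnorm_def)

lemmas op_alg_closed [simp] =
  mult_op_closed add_op_closed scale_op_closed one_op_closed zero_op_closed

lemma ring_operator_algebra: "ring \<BB>"
proof (rule ringI)
  show "abelian_group \<BB>"
  proof (rule abelian_groupI)
    fix T assume "T \<in> carrier \<BB>"
    then show "\<exists>S\<in>carrier \<BB>. S \<oplus>\<^bsub>\<BB>\<^esub> T = \<zero>\<^bsub>\<BB>\<^esub>"
      by (intro bexI[of _ "cscale \<BB> (-1) T"] op_eqI) (auto simp: operator_algebra_simps(1))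
  qed (auto simp: operator_algebra_simps(1) intro!: op_eqI)
  show "monoid \<BB>"
    by (rule monoidI) (auto simp: operator_algebra_simps(1) intro!: op_eqI)
qed (auto simp: operator_algebra_simps(1) op_add intro!: op_eqI)

sublocale ops: ring "\<BB>" by (rule ring_operator_algebra)

lemma finsum_op_apply:
  assumes fin: "finite I" and F: "\<And>i. i \<in> I \<Longrightarrow> F i \<in> bounded_ops H"
    and x: "x \<in> carrier H" and z: "z \<in> carrier H"
  shows "vinner H ((\<Oplus>\<^bsub>\<BB>\<^esub>i\<in>I. F i) x) z = (\<Sum>i\<in>I. vinner H (F i x) z)"
  using fin F
proof (induction I)
  case (insert i I)
  then have FI: "F \<in> I \<rightarrow> carrier \<BB>" and Fi: "F i \<in> carrier \<BB>"
    by (auto simp: operator_algebra_simps(1))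
  then have "(\<Oplus>\<^bsub>\<BB>\<^esub>i\<in>I. F i) \<in> bounded_ops H"
    using ops.finsum_closed operator_algebra_simps(1) by blast
  then show ?case
    using insert FI Fi x z by (simp add: ops.finsum_insert)
qed (use x z in simp)


section \<open>Adjoints and the C*-identity\<close>

lemma adjoint_unique:
  assumes S: "S \<in> bounded_ops H" and T: "T \<in> bounded_ops H"
    and adj: "\<And>x y. \<lbrakk>x \<in> carrier H; y \<in> carrier H\<rbrakk> \<Longrightarrow> vinner H (T x) y = vinner H x (S y)"
  shows "star \<BB> T = S"
  unfolding operator_algebra_simps adjoint_op_def
proof (rule the_equality)
  fix S' assume S': "S' \<in> bounded_ops H \<and>
    (\<forall>x\<in>carrier H. \<forall>y\<in>carrier H. vinner H (T x) y = vinner H x (S' y))"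
  show "S' = S"
  proof (rule op_eqI)
    fix x z assume xz: "x \<in> carrier H" "z \<in> carrier H"
    then have "vinner H z (S' x) = vinner H z (S x)"
      using S' adj by metis
    then show "vinner H (S' x) z = vinner H (S x) z"
      using inner_commute[of z] xz S S' by simp
  qed (use S S' in auto)
qed (use S adj in auto)

lemma adjoint_ex:
  assumes T: "T \<in> bounded_ops H"
  shows "\<exists>S\<in>bounded_ops H. \<forall>x\<in>carrier H. \<forall>y\<in>carrier H. vinner H (T x) y = vinner H x (S y)"
proof -
  have "\<exists>w\<in>carrier H. \<forall>x\<in>carrier H. vinner H (T x) y = vinner H x w" if y: "y \<in> carrier H" for y
  proof (rule Riesz_representation)
    show "cmod (vinner H (T x) y) \<le> op_norm H T * vnorm H y * vnorm H x" if x: "x \<in> carrier H" for x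
    proof -
      have "cmod (vinner H (T x) y) \<le> vnorm H (T x) * vnorm H y"
        using T x y by (intro Cauchy_Schwarz) auto
      also have "\<dots> \<le> op_norm H T * vnorm H x * vnorm H y"
        using T x y by (intro mult_right_mono vnorm_op_le) auto
      finally show ?thesis by (simp add: mult_ac)
    qed
  qed (use T y in \<open>auto simp: op_add op_scale\<close>)
  then obtain G where G: "\<And>y. y \<in> carrier H \<Longrightarrow> G y \<in> carrier H"
    and adj: "\<And>x y. \<lbrakk>x \<in> carrier H; y \<in> carrier H\<rbrakk> \<Longrightarrow> vinner H (T x) y = vinner H x (G y)"
    by metis
  define S where "S = restrict G (carrier H)"
  have S: "S y \<in> carrier H" if "y \<in> carrier H" for y using that G by (simp add: S_def)
  have adj': "vinner H (S y) x = vinner H y (T x)" if "x \<in> carrier H" "y \<in> carrier H" for x y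
    using adj[of x y] inner_commute[of "T x" y] inner_commute[of x "G y"] that G T
    by (simp add: S_def)
  have "S \<in> bounded_ops H"
  proof (rule bounded_opsI[where C = "op_norm H T"])
    fix x y assume xy: "x \<in> carrier H" "y \<in> carrier H"
    show "S (vadd H x y) = vadd H (S x) (S y)"
      using xy S T by (intro inner_ext) (simp_all add: adj')
  next
    fix c x assume x: "x \<in> carrier H"
    show "S (vscale H c x) = vscale H c (S x)"
      using x S T by (intro inner_ext) (simp_all add: adj')
  next
    fix x assume x: "x \<in> carrier H"
    show "vnorm H (S x) \<le> op_norm H T * vnorm H x"
    proof (rule vnorm_le_if_inner_le)
      have "cmod (vinner H (S x) (S x)) = cmod (vinner H x (T (S x)))"
        using x S by (simp add: adj')
      also have "\<dots> \<le> vnorm H x * vnorm H (T (S x))"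
        using x S T by (intro Cauchy_Schwarz) auto
      also have "\<dots> \<le> vnorm H x * (op_norm H T * vnorm H (S x))"
        using x S T by (intro mult_left_mono vnorm_op_le) auto
      finally show "cmod (vinner H (S x) (S x)) \<le> op_norm H T * vnorm H x * vnorm H (S x)"
        by (simp add: mult_ac)
    qed (use x S T in auto)
  qed (use S in \<open>auto simp: S_def\<close>)
  then show ?thesis
    using adj by (intro bexI[of _ S]) (auto simp: S_def)
qed

lemma
  assumes T: "T \<in> bounded_ops H"
  shows star_op_closed [simp]: "star \<BB> T \<in> bounded_ops H"
    and inner_star_right: "\<lbrakk>x \<in> carrier H; y \<in> carrier H\<rbrakk>
      \<Longrightarrow> vinner H x (star \<BB> T y) = vinner H (T x) y"
proof -
  obtain S where S: "S \<in> bounded_ops H"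
    "\<forall>x\<in>carrier H. \<forall>y\<in>carrier H. vinner H (T x) y = vinner H x (S y)"
    using adjoint_ex[OF T] by blast
  then have "star \<BB> T = S" using adjoint_unique[OF S(1) T] by blast
  with S show "star \<BB> T \<in> bounded_ops H"
    and "\<lbrakk>x \<in> carrier H; y \<in> carrier H\<rbrakk> \<Longrightarrow> vinner H x (star \<BB> T y) = vinner H (T x) y"
    by auto
qed

lemma inner_star_left:
  assumes T: "T \<in> bounded_ops H" and x: "x \<in> carrier H" and y: "y \<in> carrier H"
  shows "vinner H (star \<BB> T x) y = vinner H x (T y)"
  using inner_star_right[OF T y x] inner_commute[of y "star \<BB> T x"] inner_commute[of "T y" x] T x y
  by simp

lemma star_op_mult:
  assumes "S \<in> bounded_ops H" "T \<in> bounded_ops H"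
  shows "star \<BB> (S \<otimes>\<^bsub>\<BB>\<^esub> T) = star \<BB> T \<otimes>\<^bsub>\<BB>\<^esub> star \<BB> S"
  using assms by (intro adjoint_unique) (auto simp: inner_star_right)

lemma star_op_add:
  assumes "S \<in> bounded_ops H" "T \<in> bounded_ops H"
  shows "star \<BB> (S \<oplus>\<^bsub>\<BB>\<^esub> T) = star \<BB> S \<oplus>\<^bsub>\<BB>\<^esub> star \<BB> T"
  using assms by (intro adjoint_unique) (auto simp: inner_star_right)

lemma star_op_scale:
  assumes "T \<in> bounded_ops H"
  shows "star \<BB> (cscale \<BB> c T) = cscale \<BB> (cnj c) (star \<BB> T)"
  using assms by (intro adjoint_unique) (auto simp: inner_star_right)

lemma star_op_star:
  assumes "T \<in> bounded_ops H"
  shows "star \<BB> (star \<BB> T) = T"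
  using assms by (intro adjoint_unique) (auto simp: inner_star_left)

lemma star_op_one: "star \<BB> \<one>\<^bsub>\<BB>\<^esub> = \<one>\<^bsub>\<BB>\<^esub>"
  by (intro adjoint_unique) auto

lemma op_norm_le_star:
  assumes T: "T \<in> bounded_ops H"
  shows "(op_norm H T)\<^sup>2 \<le> op_norm H (star \<BB> T \<otimes>\<^bsub>\<BB>\<^esub> T)"
proof -
  let ?q = "op_norm H (star \<BB> T \<otimes>\<^bsub>\<BB>\<^esub> T)"
  have q: "0 \<le> ?q" using T by simp
  have "op_norm H T \<le> sqrt ?q"
  proof (rule op_norm_le)
    fix x assume x: "x \<in> carrier H"
    have "(vnorm H (T x))\<^sup>2 = Re (vinner H ((star \<BB> T \<otimes>\<^bsub>\<BB>\<^esub> T) x) x)"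
      using T x by (simp add: vnorm_sq inner_star_left)
    also have "\<dots> \<le> vnorm H ((star \<BB> T \<otimes>\<^bsub>\<BB>\<^esub> T) x) * vnorm H x"
      using T x by (intro order.trans[OF complex_Re_le_cmod] Cauchy_Schwarz) auto
    also have "\<dots> \<le> ?q * vnorm H x * vnorm H x"
      using T x by (intro mult_right_mono vnorm_op_le) auto
    also have "\<dots> = (sqrt ?q * vnorm H x)\<^sup>2"
      using q by (simp add: power2_eq_square)
    finally show "vnorm H (T x) \<le> sqrt ?q * vnorm H x"
      using q x by (intro power2_le_imp_le[of "vnorm H (T x)"]) auto
  qed (use q in simp)
  then have "(op_norm H T)\<^sup>2 \<le> (sqrt ?q)\<^sup>2"
    using T by (intro power_mono) auto
  then show ?thesis using q by simp
qed

lemma op_norm_star: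
  assumes T: "T \<in> bounded_ops H"
  shows "op_norm H (star \<BB> T) = op_norm H T"
proof -
  have le: "op_norm H S \<le> op_norm H (star \<BB> S)" if S: "S \<in> bounded_ops H" for S
  proof -
    have "op_norm H S * op_norm H S \<le> op_norm H (star \<BB> S) * op_norm H S"
      using op_norm_le_star[OF S] op_norm_mult_le[of "star \<BB> S" S] S
      by (simp add: power2_eq_square)
    then show ?thesis
      using S op_norm_nonneg[OF S] by (cases "op_norm H S = 0") auto
  qed
  show ?thesis
    using le[OF T] le[of "star \<BB> T"] T by (simp add: star_op_star)
qed

lemma op_norm_C_star:
  assumes T: "T \<in> bounded_ops H"
  shows "op_norm H (star \<BB> T \<otimes>\<^bsub>\<BB>\<^esub> T) = (op_norm H T)\<^sup>2"
  using op_norm_le_star[OF T] op_norm_mult_le[of "star \<BB> T" T] T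
  by (simp add: op_norm_star power2_eq_square)


section \<open>Convergence in operator norm\<close>

abbreviation opsub :: "('h \<Rightarrow> 'h) \<Rightarrow> ('h \<Rightarrow> 'h) \<Rightarrow> 'h \<Rightarrow> 'h"
  where "opsub S T \<equiv> S \<oplus>\<^bsub>\<BB>\<^esub> cscale \<BB> (-1) T"

text \<open>Convergence of a sequence of bounded operators in operator norm.\<close>

definition op_lim :: "(nat \<Rightarrow> 'h \<Rightarrow> 'h) \<Rightarrow> ('h \<Rightarrow> 'h) \<Rightarrow> bool"
  where "op_lim F T \<longleftrightarrow> (\<forall>n. F n \<in> bounded_ops H) \<and> T \<in> bounded_ops H \<and>
    (\<lambda>n. op_norm H (opsub (F n) T)) \<longlonglongrightarrow> 0"

lemma op_eq_if_op_norm_opsub_eq_0: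
  assumes S: "S \<in> bounded_ops H" and T: "T \<in> bounded_ops H" and 0: "op_norm H (opsub S T) \<le> 0"
  shows "S = T"
proof (rule op_eqI[OF S T])
  fix x z assume xz: "x \<in> carrier H" "z \<in> carrier H"
  have "vnorm H (opsub S T x) \<le> 0"
    using vnorm_op_le[of "opsub S T" x] S T xz 0 mult_right_mono[OF 0, of "vnorm H x"] by simp
  then have "vnorm H (opsub S T x) * vnorm H z \<le> 0"
    using mult_right_mono[of "vnorm H (opsub S T x)" 0 "vnorm H z"] xz by simp
  then have "cmod (vinner H (opsub S T x) z) \<le> 0"
    using Cauchy_Schwarz[of "opsub S T x" z] S T xz
    by (meson add_op_closed op_closed order.trans scale_op_closed)
  then show "vinner H (S x) z = vinner H (T x) z" using S T xz by simp
qed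

lemma op_norm_opsub_commute:
  assumes "S \<in> bounded_ops H" "T \<in> bounded_ops H"
  shows "op_norm H (opsub S T) = op_norm H (opsub T S)"
proof -
  have "opsub S T = cscale \<BB> (-1) (opsub T S)"
    using assms by (intro op_eqI) auto
  then show ?thesis using assms op_norm_scale[of "opsub T S" "-1"] by simp
qed

lemma op_norm_opsub_triangle:
  assumes "S \<in> bounded_ops H" "T \<in> bounded_ops H" "U \<in> bounded_ops H"
  shows "op_norm H (opsub S T) \<le> op_norm H (opsub S U) + op_norm H (opsub U T)"
proof -
  have "opsub S T = opsub S U \<oplus>\<^bsub>\<BB>\<^esub> opsub U T"
    using assms by (intro op_eqI) auto
  then show ?thesis using assms op_norm_triangle[of "opsub S U" "opsub U T"] by simp
qed

lemma op_limI:
  assumes "\<And>n. F n \<in> bounded_ops H" "T \<in> bounded_ops H" "g \<longlonglongrightarrow> 0"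
    and "\<And>n. op_norm H (opsub (F n) T) \<le> g n"
  shows "op_lim F T"
  unfolding op_lim_def using assms
  by (auto intro!: tendsto_sandwich[OF _ _ tendsto_const \<open>g \<longlonglongrightarrow> 0\<close>] always_eventually)

lemma op_lim_unique:
  assumes "op_lim F S" "op_lim F T"
  shows "S = T"
proof (rule op_eq_if_op_norm_opsub_eq_0)
  show ST: "S \<in> bounded_ops H" "T \<in> bounded_ops H" using assms by (auto simp: op_lim_def)
  have "(\<lambda>n. op_norm H (opsub (F n) S) + op_norm H (opsub (F n) T)) \<longlonglongrightarrow> 0 + 0"
    using assms by (intro tendsto_add) (auto simp: op_lim_def)
  moreover have "op_norm H (opsub S T) \<le> op_norm H (opsub (F n) S) + op_norm H (opsub (F n) T)" for n
    using op_norm_opsub_triangle[OF ST, of "F n"] op_norm_opsub_commute[of S "F n"] assms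
    by (auto simp: op_lim_def)
  ultimately show "op_norm H (opsub S T) \<le> 0"
    by (intro LIMSEQ_le_const) auto
qed

lemma op_lim_const: "T \<in> bounded_ops H \<Longrightarrow> op_lim (\<lambda>n. T) T"
  by (rule op_limI[where g = "\<lambda>n. 0"]) (auto intro!: op_norm_le simp: vsub_self vnorm_def)

lemma op_lim_add:
  assumes "op_lim F S" "op_lim G T"
  shows "op_lim (\<lambda>n. F n \<oplus>\<^bsub>\<BB>\<^esub> G n) (S \<oplus>\<^bsub>\<BB>\<^esub> T)"
proof (rule op_limI)
  show "(\<lambda>n. op_norm H (opsub (F n) S) + op_norm H (opsub (G n) T)) \<longlonglongrightarrow> 0"
    using assms tendsto_add[of "\<lambda>n. op_norm H (opsub (F n) S)" 0 _ "\<lambda>n. op_norm H (opsub (G n) T)" 0]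
    by (simp add: op_lim_def)
  fix n
  have "opsub (F n \<oplus>\<^bsub>\<BB>\<^esub> G n) (S \<oplus>\<^bsub>\<BB>\<^esub> T) = opsub (F n) S \<oplus>\<^bsub>\<BB>\<^esub> opsub (G n) T"
    using assms by (intro op_eqI) (auto simp: op_lim_def)
  then show "op_norm H (opsub (F n \<oplus>\<^bsub>\<BB>\<^esub> G n) (S \<oplus>\<^bsub>\<BB>\<^esub> T))
      \<le> op_norm H (opsub (F n) S) + op_norm H (opsub (G n) T)"
    using assms by (auto simp: op_lim_def intro!: op_norm_triangle)
qed (use assms in \<open>auto simp: op_lim_def\<close>)

lemma op_lim_scale:
  assumes "op_lim F S"
  shows "op_lim (\<lambda>n. cscale \<BB> c (F n)) (cscale \<BB> c S)"
proof (rule op_limI)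
  show "(\<lambda>n. cmod c * op_norm H (opsub (F n) S)) \<longlonglongrightarrow> 0"
    using assms by (intro tendsto_mult_right_zero) (auto simp: op_lim_def)
  fix n
  have "opsub (cscale \<BB> c (F n)) (cscale \<BB> c S) = cscale \<BB> c (opsub (F n) S)"
    using assms by (intro op_eqI) (auto simp: op_lim_def algebra_simps)
  then show "op_norm H (opsub (cscale \<BB> c (F n)) (cscale \<BB> c S)) \<le> cmod c * op_norm H (opsub (F n) S)"
    using assms by (auto simp: op_lim_def op_norm_scale)
qed (use assms in \<open>auto simp: op_lim_def\<close>)

lemma op_lim_star:
  assumes "op_lim F S"
  shows "op_lim (\<lambda>n. star \<BB> (F n)) (star \<BB> S)"
proof (rule op_limI)
  show "(\<lambda>n. op_norm H (opsub (F n) S)) \<longlonglongrightarrow> 0"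
    using assms by (auto simp: op_lim_def)
  fix n
  have "opsub (star \<BB> (F n)) (star \<BB> S) = star \<BB> (opsub (F n) S)"
    using assms by (simp add: op_lim_def star_op_add star_op_scale)
  then show "op_norm H (opsub (star \<BB> (F n)) (star \<BB> S)) \<le> op_norm H (opsub (F n) S)"
    using assms by (auto simp: op_lim_def op_norm_star)
qed (use assms in \<open>auto simp: op_lim_def\<close>)

lemma op_norm_le_opsub:
  assumes "S \<in> bounded_ops H" "T \<in> bounded_ops H"
  shows "op_norm H S \<le> op_norm H (opsub S T) + op_norm H T"
proof -
  have "S = opsub S T \<oplus>\<^bsub>\<BB>\<^esub> T"
    using assms by (intro op_eqI) auto
  then show ?thesis using assms op_norm_triangle[of "opsub S T" T] by simp
qed

lemma op_lim_mult:
  assumes "op_lim F S" "op_lim G T"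
  shows "op_lim (\<lambda>n. F n \<otimes>\<^bsub>\<BB>\<^esub> G n) (S \<otimes>\<^bsub>\<BB>\<^esub> T)"
proof (rule op_limI)
  let ?f = "\<lambda>n. op_norm H (opsub (F n) S)" and ?g = "\<lambda>n. op_norm H (opsub (G n) T)"
  have "?f \<longlonglongrightarrow> 0" "?g \<longlonglongrightarrow> 0" using assms by (auto simp: op_lim_def)
  then have "(\<lambda>n. ?f n * (?g n + op_norm H T) + op_norm H S * ?g n)
      \<longlonglongrightarrow> 0 * (0 + op_norm H T) + op_norm H S * 0"
    by (intro tendsto_intros)
  then show "(\<lambda>n. ?f n * (?g n + op_norm H T) + op_norm H S * ?g n) \<longlonglongrightarrow> 0" by simp
  fix n
  have cl: "F n \<in> bounded_ops H" "G n \<in> bounded_ops H" "S \<in> bounded_ops H" "T \<in> bounded_ops H"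
    using assms by (auto simp: op_lim_def)
  have "opsub (F n \<otimes>\<^bsub>\<BB>\<^esub> G n) (S \<otimes>\<^bsub>\<BB>\<^esub> T)
      = (opsub (F n) S \<otimes>\<^bsub>\<BB>\<^esub> G n) \<oplus>\<^bsub>\<BB>\<^esub> (S \<otimes>\<^bsub>\<BB>\<^esub> opsub (G n) T)"
    using cl by (intro op_eqI) (auto simp: op_add op_scale)
  then have "op_norm H (opsub (F n \<otimes>\<^bsub>\<BB>\<^esub> G n) (S \<otimes>\<^bsub>\<BB>\<^esub> T))
      \<le> op_norm H (opsub (F n) S \<otimes>\<^bsub>\<BB>\<^esub> G n) + op_norm H (S \<otimes>\<^bsub>\<BB>\<^esub> opsub (G n) T)"
    using cl by (simp add: op_norm_triangle)
  also have "\<dots> \<le> ?f n * op_norm H (G n) + op_norm H S * ?g n"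
    using cl by (intro add_mono op_norm_mult_le) auto
  also have "\<dots> \<le> ?f n * (?g n + op_norm H T) + op_norm H S * ?g n"
    using cl by (intro add_right_mono mult_left_mono op_norm_le_opsub) auto
  finally show "op_norm H (opsub (F n \<otimes>\<^bsub>\<BB>\<^esub> G n) (S \<otimes>\<^bsub>\<BB>\<^esub> T))
      \<le> ?f n * (?g n + op_norm H T) + op_norm H S * ?g n" .
qed (use assms in \<open>auto simp: op_lim_def\<close>)

text \<open>The limit is the pointwise limit \<open>G\<close>. Its linearity and the norm estimates pass to the limit
  through inner products.\<close>

lemma op_complete:
  assumes F: "\<And>n. F n \<in> bounded_ops H"
    and Cauchy: "\<And>e. e > 0 \<Longrightarrow> \<exists>K. \<forall>m\<ge>K. \<forall>n\<ge>K. op_norm H (opsub (F m) (F n)) < e"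
  shows "\<exists>T. op_lim F T"
proof -
  have sub_le: "vnorm H (vsub (F m x) (F n x)) \<le> op_norm H (opsub (F m) (F n)) * vnorm H x"
    if "x \<in> carrier H" for m n x
    using vnorm_op_le[of "opsub (F m) (F n)" x] F that by simp
  have "\<exists>y\<in>carrier H. (\<lambda>n. vnorm H (vsub (F n x) y)) \<longlonglongrightarrow> 0" if x: "x \<in> carrier H" for x
  proof (rule complete)
    fix e :: real assume e: "e > 0"
    have pos: "vnorm H x + 1 > 0" using vnorm_nonneg[OF x] by linarith
    obtain K where K: "\<forall>m\<ge>K. \<forall>n\<ge>K. op_norm H (opsub (F m) (F n)) < e / (vnorm H x + 1)"
      using Cauchy[of "e / (vnorm H x + 1)"] e pos by auto
    have "vnorm H (vsub (F m x) (F n x)) < e" if "m \<ge> K" "n \<ge> K" for m n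
    proof -
      have "vnorm H (vsub (F m x) (F n x)) \<le> op_norm H (opsub (F m) (F n)) * vnorm H x"
        by (rule sub_le[OF x])
      also have "\<dots> \<le> op_norm H (opsub (F m) (F n)) * (vnorm H x + 1)"
        using F by (intro mult_left_mono) auto
      also have "\<dots> < e"
        using K that pos by (simp add: less_divide_eq)
      finally show ?thesis .
    qed
    then show "\<exists>K. \<forall>m\<ge>K. \<forall>n\<ge>K. vnorm H (vsub (F m x) (F n x)) < e" by blast
  qed (use F x in simp)
  then obtain G where G: "\<And>x. x \<in> carrier H \<Longrightarrow> G x \<in> carrier H"
    and lim: "\<And>x. x \<in> carrier H \<Longrightarrow> (\<lambda>n. vnorm H (vsub (F n x) (G x))) \<longlonglongrightarrow> 0"
    by metis
  have ilim: "(\<lambda>n. vinner H (F n x) z) \<longlonglongrightarrow> vinner H (G x) z" if "x \<in> carrier H" "z \<in> carrier H" for x z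
    using that F G lim by (intro inner_vlim) auto
  define T where "T = restrict G (carrier H)"
  have close: "vnorm H (vsub (F m x) (G x)) \<le> e * vnorm H x"
    if K: "\<forall>m\<ge>K. \<forall>n\<ge>K. op_norm H (opsub (F m) (F n)) < e" and m: "m \<ge> K" and x: "x \<in> carrier H"
    for e K m x
  proof (rule vnorm_le_lim[where X = "\<lambda>n. vsub (F m x) (F n x)"])
    have "0 \<le> op_norm H (opsub (F m) (F m))" using F by simp
    also have "\<dots> < e" using K m by blast
    finally show "0 \<le> e * vnorm H x" using x by simp
    show "\<forall>\<^sub>F n in sequentially. vnorm H (vsub (F m x) (F n x)) \<le> e * vnorm H x"
    proof (rule eventually_sequentiallyI[of K])
      fix n assume "K \<le> n"
      then have "op_norm H (opsub (F m) (F n)) \<le> e" using K m by (auto intro: less_imp_le)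
      then show "vnorm H (vsub (F m x) (F n x)) \<le> e * vnorm H x"
        using sub_le[OF x, of m n] mult_right_mono[of _ e "vnorm H x"] x by fastforce
    qed
    have "vsub (vsub (F m x) (F n x)) (vsub (F m x) (G x)) = vscale H (-1) (vsub (F n x) (G x))" for n
      using F G x by (intro inner_ext) auto
    then show "(\<lambda>n. vnorm H (vsub (vsub (F m x) (F n x)) (vsub (F m x) (G x)))) \<longlonglongrightarrow> 0"
      using lim[OF x] F G x by simp
  qed (use F G x in auto)
  obtain K1 where K1: "\<forall>m\<ge>K1. \<forall>n\<ge>K1. op_norm H (opsub (F m) (F n)) < 1"
    using Cauchy[of 1] by auto
  have T: "T \<in> bounded_ops H"
  proof (rule bounded_opsI[where C = "op_norm H (F K1) + 1"])
    fix x y assume xy: "x \<in> carrier H" "y \<in> carrier H"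
    show "T (vadd H x y) = vadd H (T x) (T y)"
    proof (rule inner_ext)
      fix z assume z: "z \<in> carrier H"
      have "(\<lambda>n. vinner H (F n (vadd H x y)) z) \<longlonglongrightarrow> vinner H (G x) z + vinner H (G y) z"
        using xy z F by (simp add: op_add tendsto_add ilim)
      then show "vinner H (T (vadd H x y)) z = vinner H (vadd H (T x) (T y)) z"
        using LIMSEQ_unique[OF ilim[of "vadd H x y" z]] xy z G by (simp add: T_def)
    qed (use xy G in \<open>auto simp: T_def\<close>)
  next
    fix c x assume x: "x \<in> carrier H"
    show "T (vscale H c x) = vscale H c (T x)"
    proof (rule inner_ext)
      fix z assume z: "z \<in> carrier H"
      have "(\<lambda>n. vinner H (F n (vscale H c x)) z) \<longlonglongrightarrow> c * vinner H (G x) z"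
        using x z F by (simp add: op_scale tendsto_mult_left ilim)
      then show "vinner H (T (vscale H c x)) z = vinner H (vscale H c (T x)) z"
        using LIMSEQ_unique[OF ilim[of "vscale H c x" z]] x z G by (simp add: T_def)
    qed (use x G in \<open>auto simp: T_def\<close>)
  next
    fix x assume x: "x \<in> carrier H"
    have "G x = vadd H (F K1 x) (vscale H (-1) (vsub (F K1 x) (G x)))"
      using F G x by (intro inner_ext) auto
    then have "vnorm H (G x) \<le> vnorm H (F K1 x) + vnorm H (vsub (F K1 x) (G x))"
      using vnorm_triangle[of "F K1 x" "vscale H (-1) (vsub (F K1 x) (G x))"] F G x by simp
    then show "vnorm H (T x) \<le> (op_norm H (F K1) + 1) * vnorm H x"
      using close[OF K1 order_refl x] vnorm_op_le[OF F x, of K1] x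
      by (simp add: T_def algebra_simps)
  qed (use G in \<open>auto simp: T_def\<close>)
  have "(\<lambda>n. op_norm H (opsub (F n) T)) \<longlonglongrightarrow> 0"
  proof (rule LIMSEQ_I)
    fix e :: real assume e: "e > 0"
    obtain K where K: "\<forall>m\<ge>K. \<forall>n\<ge>K. op_norm H (opsub (F m) (F n)) < e / 2"
      using Cauchy[of "e / 2"] e by auto
    have "op_norm H (opsub (F n) T) \<le> e / 2" if n: "n \<ge> K" for n
      using close[OF K n] e by (intro op_norm_le) (auto simp: T_def)
    then show "\<exists>K. \<forall>n\<ge>K. norm (op_norm H (opsub (F n) T) - 0) < e"
      using e F T by (intro exI[of _ K]) fastforce
  qed
  then show ?thesis using F T by (auto simp: op_lim_def)
qed

end


section \<open>The free unital *-algebra\<close>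

lemma poly_sum_single: "p = (\<Sum>w\<in>Poly_Mapping.keys p. Poly_Mapping.single w (Poly_Mapping.lookup p w))"
  by (rule poly_mapping_eqI) (auto simp: lookup_sum lookup_single when_def in_keys_iff)

lemma star_poly_induct [case_names zero add]:
  fixes p :: "'n star_poly"
  assumes zero: "P 0" and add: "\<And>w c p. P p \<Longrightarrow> P (Poly_Mapping.single w c + p)"
  shows "P p"
proof -
  have "P (\<Sum>w\<in>S. Poly_Mapping.single w (Poly_Mapping.lookup p w))" if "finite S" for S
    using that by induction (use zero add in auto)
  then have "P (\<Sum>w\<in>Poly_Mapping.keys p. Poly_Mapping.single w (Poly_Mapping.lookup p w))"
    by simp
  then show ?thesis using poly_sum_single[of p] by simp
qed

text \<open>The adjoint of a word: the reversed word of the adjoint letters.\<close>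

definition word_star :: "('n \<times> bool) list \<Rightarrow> ('n \<times> bool) list"
  where "word_star w = rev (map (\<lambda>(i, b). (i, \<not> b)) w)"

lemma word_star_word_star [simp]: "word_star (word_star w) = w"
  by (induction w) (auto simp: word_star_def)

lemma word_star_eq_iff: "word_star v = w \<longleftrightarrow> v = word_star w"
  by (metis word_star_word_star)

lemma word_star_add: "word_star (v + w) = word_star w + word_star v"
  by (simp add: word_star_def plus_list_def)

lemma word_star_zero [simp]: "word_star 0 = 0"
  by (simp add: word_star_def zero_list_def)

lemma lookup_poly_star:
  "Poly_Mapping.lookup (poly_star p) w = cnj (Poly_Mapping.lookup p (word_star w))"
proof -
  have "Poly_Mapping.lookup (poly_star p) w
      = (\<Sum>v\<in>Poly_Mapping.keys p. if v = word_star w then cnj (Poly_Mapping.lookup p v) else 0)"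
    unfolding poly_star_def word_star_def[symmetric]
    by (simp add: lookup_sum lookup_single when_def word_star_eq_iff)
  then show ?thesis by (simp add: in_keys_iff)
qed

lemma poly_star_single: "poly_star (Poly_Mapping.single w c) = Poly_Mapping.single (word_star w) (cnj c)"
  by (rule poly_mapping_eqI)
    (auto simp: lookup_poly_star lookup_single when_def word_star_eq_iff)

lemma poly_star_zero [simp]: "poly_star 0 = 0"
  by (rule poly_mapping_eqI) (simp add: lookup_poly_star)

lemma poly_star_add: "poly_star (p + q) = poly_star p + poly_star q"
  by (rule poly_mapping_eqI) (simp add: lookup_poly_star lookup_add)

lemma poly_star_diff: "poly_star (p - q) = poly_star p - poly_star q"
  by (rule poly_mapping_eqI) (simp add: lookup_poly_star lookup_minus)

lemma poly_star_star [simp]: "poly_star (poly_star p) = p"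
  by (rule poly_mapping_eqI) (simp add: lookup_poly_star)

lemma poly_star_one [simp]: "poly_star 1 = 1"
  using poly_star_single[of 0 1] by simp

lemma poly_star_mult: "poly_star (p * q) = poly_star q * poly_star p"
proof (induction p rule: star_poly_induct)
  case (add w c p)
  have "poly_star (Poly_Mapping.single w c * q) = poly_star q * poly_star (Poly_Mapping.single w c)"
  proof (induction q rule: star_poly_induct)
    case (add v d q)
    then show ?case
      by (simp add: poly_star_add poly_star_single distrib_left distrib_right mult_single
          word_star_add mult.commute)
  qed simp
  with add show ?case by (simp add: poly_star_add distrib_left distrib_right)
qed simp

lemma poly_scale_add: "poly_scale c (p + q) = poly_scale c p + poly_scale c q"
  by (simp add: poly_scale_def distrib_left)

lemma poly_scale_single: "poly_scale c (Poly_Mapping.single w d) = Poly_Mapping.single w (c * d)"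
  by (simp add: poly_scale_def mult_single)

lemma poly_scale_minus_one: "poly_scale (-1) p = - p"
  by (simp add: poly_scale_def single_uminus)

lemma poly_scale_zero [simp]: "poly_scale 0 p = 0"
  by (simp add: poly_scale_def)

lemma poly_scale_diff: "poly_scale c (p - q) = poly_scale c p - poly_scale c q"
  by (simp add: poly_scale_def right_diff_distrib)

lemma poly_star_gen: "poly_star (poly_gen i) = Poly_Mapping.single [(i, True)] 1"
  by (simp add: poly_gen_def poly_star_single word_star_def)

lemma single_Cons:
  "Poly_Mapping.single ((i, b) # w) c
    = (if b then poly_star (poly_gen i) else poly_gen i) * Poly_Mapping.single w c"
  by (cases b) (simp_all add: poly_star_gen, simp_all add: poly_gen_def mult_single plus_list_def)


section \<open>C*-seminorms annihilating the Cuntz--Krieger relations\<close>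

lemma cstar_seminormD:
  assumes "cstar_seminorm q"
  shows "q (a + b) \<le> q a + q b" "q (poly_scale c a) = cmod c * q a" "q (a * b) \<le> q a * q b"
    "q (poly_star a * a) = (q a)\<^sup>2"
  using assms by (auto simp: cstar_seminorm_def)

lemma cstar_seminorm_zero [simp]: "cstar_seminorm q \<Longrightarrow> q 0 = 0"
  using cstar_seminormD(2)[of q 0 0] by simp

lemma cstar_seminorm_uminus: "cstar_seminorm q \<Longrightarrow> q (- a) = q a"
  using cstar_seminormD(2)[of q "-1" a] by (simp add: poly_scale_minus_one)

lemma cstar_seminorm_nonneg:
  assumes "cstar_seminorm q"
  shows "0 \<le> q a"
  using cstar_seminormD(1)[OF assms, of a "- a"] assms by (simp add: cstar_seminorm_uminus)

lemma cstar_seminorm_diff: "cstar_seminorm q \<Longrightarrow> q (a - b) \<le> q a + q b"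
  using cstar_seminormD(1)[of q a "- b"] by (simp add: cstar_seminorm_uminus)

lemma cstar_seminorm_eq:
  assumes q: "cstar_seminorm q" and ab: "q (a - b) = 0"
  shows "q a = q b"
  using cstar_seminormD(1)[OF q, of "a - b" b] cstar_seminorm_diff[OF q, of a "a - b"] ab by simp

lemma cstar_seminorm_star:
  assumes q: "cstar_seminorm q"
  shows "q (poly_star a) = q a"
proof -
  have le: "q b \<le> q (poly_star b)" for b
  proof -
    have "q b * q b \<le> q (poly_star b) * q b"
      using cstar_seminormD(3)[OF q, of "poly_star b" b] cstar_seminormD(4)[OF q, of b]
      by (simp add: power2_eq_square)
    then show ?thesis
      using cstar_seminorm_nonneg[OF q, of b] cstar_seminorm_nonneg[OF q, of "poly_star b"]
      by (cases "q b = 0") auto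
  qed
  show ?thesis using le[of a] le[of "poly_star a"] by simp
qed

lemma cstar_seminorm_one: "cstar_seminorm q \<Longrightarrow> q 1 \<le> 1"
  using cstar_seminormD(4)[of q 1] by (auto simp: power2_eq_square)

lemma cstar_seminorm_sum:
  assumes q: "cstar_seminorm q"
  shows "q (\<Sum>i\<in>I. f i) \<le> (\<Sum>i\<in>I. q (f i))"
proof (induction I rule: infinite_finite_induct)
  case (insert i I)
  then show ?case using cstar_seminormD(1)[OF q, of "f i" "sum f I"] by simp
qed (use q in auto)

abbreviation ck_seminorms :: "nat ^ 'n ^ 'n \<Rightarrow> ('n::finite star_poly \<Rightarrow> real) set"
  where "ck_seminorms A \<equiv> {q. cstar_seminorm q \<and> (\<forall>r\<in>ck_relators A. q r = 0)}"

lemma zero_ck_seminorm: "(\<lambda>a. 0) \<in> ck_seminorms A"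
  by (simp add: cstar_seminorm_def)

text \<open>As \<open>S\<close> is a partial isometry for \<open>q\<close>, the element \<open>p = S* S\<close> is a projection for \<open>q\<close>, so
  \<open>q p = q (p* p) = (q p)\<^sup>2\<close> and \<open>(q S)\<^sup>2 = q p\<close> is \<open>0\<close> or \<open>1\<close>.\<close>

lemma ck_seminorm_gen:
  assumes q: "q \<in> ck_seminorms A"
  shows "q (poly_gen i) \<le> 1"
proof -
  have c: "cstar_seminorm q" using q by simp
  let ?S = "poly_gen i" and ?S' = "poly_star (poly_gen i)"
  have "?S * ?S' * ?S - ?S \<in> ck_relators A" by (auto simp: ck_relators_def Let_def)
  then have 0: "q (?S * ?S' * ?S - ?S) = 0" using q by blast
  have "?S' * ?S * (?S' * ?S) - ?S' * ?S = ?S' * (?S * ?S' * ?S - ?S)"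
    by (simp add: algebra_simps)
  then have "q (?S' * ?S * (?S' * ?S) - ?S' * ?S) \<le> q ?S' * 0"
    using cstar_seminormD(3)[OF c, of ?S' "?S * ?S' * ?S - ?S"] 0 by simp
  then have "q (?S' * ?S * (?S' * ?S)) = q (?S' * ?S)"
    using cstar_seminorm_nonneg[OF c] by (intro cstar_seminorm_eq[OF c]) (auto intro: antisym)
  then have "(q (?S' * ?S))\<^sup>2 = q (?S' * ?S)"
    using cstar_seminormD(4)[OF c, of "?S' * ?S"] by (simp add: poly_star_mult)
  then have "q (?S' * ?S) \<le> 1"
    by (auto simp: power2_eq_square)
  then have "(q ?S)\<^sup>2 \<le> 1\<^sup>2" using cstar_seminormD(4)[OF c, of ?S] by simp
  then show ?thesis by (rule power2_le_imp_le) simp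
qed

lemma ck_seminorm_word:
  assumes q: "q \<in> ck_seminorms A"
  shows "q (Poly_Mapping.single w 1) \<le> 1"
proof (induction w)
  case Nil
  then show ?case using q cstar_seminorm_one[of q] by (simp flip: zero_list_def)
next
  case (Cons x w)
  obtain i b where x: "x = (i, b)" by fastforce
  have c: "cstar_seminorm q" using q by simp
  let ?g = "if b then poly_star (poly_gen i) else poly_gen i"
  have "q ?g \<le> 1" using ck_seminorm_gen[OF q] by (simp add: cstar_seminorm_star[OF c])
  then have "q ?g * q (Poly_Mapping.single w 1) \<le> 1 * 1"
    using Cons by (intro mult_mono) (auto intro: cstar_seminorm_nonneg[OF c])
  then show ?case
    unfolding x single_Cons using cstar_seminormD(3)[OF c, of ?g "Poly_Mapping.single w 1"] by linarith
qed

text \<open>This bound does not depend on \<open>q\<close>, so the supremum that defines \<open>ck_norm\<close> is a genuine one.\<close>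

lemma ck_seminorm_bound:
  assumes q: "q \<in> ck_seminorms A"
  shows "q a \<le> (\<Sum>w\<in>Poly_Mapping.keys a. cmod (Poly_Mapping.lookup a w))"
proof -
  have c: "cstar_seminorm q" using q by simp
  have "q (Poly_Mapping.single w d) \<le> cmod d" for w d
    using cstar_seminormD(2)[OF c, of d "Poly_Mapping.single w 1"] ck_seminorm_word[OF q, of w]
    by (simp add: poly_scale_single mult_left_le)
  then have "(\<Sum>w\<in>Poly_Mapping.keys a. q (Poly_Mapping.single w (Poly_Mapping.lookup a w)))
      \<le> (\<Sum>w\<in>Poly_Mapping.keys a. cmod (Poly_Mapping.lookup a w))"
    by (intro sum_mono)
  moreover have "q a \<le> (\<Sum>w\<in>Poly_Mapping.keys a. q (Poly_Mapping.single w (Poly_Mapping.lookup a w)))"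
    by (subst poly_sum_single[of a]) (rule cstar_seminorm_sum[OF c])
  ultimately show ?thesis by linarith
qed

lemma ck_seminorm_le_ck_norm: "q \<in> ck_seminorms A \<Longrightarrow> q a \<le> ck_norm A a"
  unfolding ck_norm_def by (rule cSUP_upper) (auto intro!: bdd_aboveI2 ck_seminorm_bound)

lemma ck_norm_le: "(\<And>q. q \<in> ck_seminorms A \<Longrightarrow> q a \<le> C) \<Longrightarrow> ck_norm A a \<le> C"
  unfolding ck_norm_def using zero_ck_seminorm by (intro cSUP_least) blast+

lemma ck_norm_nonneg [simp]: "0 \<le> ck_norm A a"
  using ck_seminorm_le_ck_norm[OF zero_ck_seminorm] .

lemma ck_norm_triangle: "ck_norm A (a + b) \<le> ck_norm A a + ck_norm A b"
proof (rule ck_norm_le)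
  fix q assume q: "q \<in> ck_seminorms A"
  then have "q (a + b) \<le> q a + q b" by (simp add: cstar_seminormD)
  also have "\<dots> \<le> ck_norm A a + ck_norm A b"
    by (intro add_mono ck_seminorm_le_ck_norm q)
  finally show "q (a + b) \<le> ck_norm A a + ck_norm A b" .
qed

lemma ck_norm_mult: "ck_norm A (a * b) \<le> ck_norm A a * ck_norm A b"
proof (rule ck_norm_le)
  fix q assume q: "q \<in> ck_seminorms A"
  then have "q (a * b) \<le> q a * q b" by (simp add: cstar_seminormD)
  also have "\<dots> \<le> ck_norm A a * ck_norm A b"
    using q by (intro mult_mono[OF ck_seminorm_le_ck_norm[OF q] ck_seminorm_le_ck_norm[OF q]])
      (simp_all add: cstar_seminorm_nonneg)
  finally show "q (a * b) \<le> ck_norm A a * ck_norm A b" .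
qed

lemma ck_norm_scale_le: "ck_norm A (poly_scale c a) \<le> cmod c * ck_norm A a"
proof (rule ck_norm_le)
  fix q assume q: "q \<in> ck_seminorms A"
  then have "q (poly_scale c a) = cmod c * q a" by (simp add: cstar_seminormD)
  also have "\<dots> \<le> cmod c * ck_norm A a"
    using q by (intro mult_left_mono ck_seminorm_le_ck_norm) auto
  finally show "q (poly_scale c a) \<le> cmod c * ck_norm A a" .
qed

lemma ck_norm_uminus: "ck_norm A (- a) = ck_norm A a"
  unfolding ck_norm_def by (intro SUP_cong) (auto simp: cstar_seminorm_uminus)

lemma ck_norm_star: "ck_norm A (poly_star a) = ck_norm A a"
  unfolding ck_norm_def by (intro SUP_cong) (auto simp: cstar_seminorm_star)

lemma ck_norm_minus_commute: "ck_norm A (a - b) = ck_norm A (b - a)"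
  using ck_norm_uminus[of A "a - b"] by simp

lemma ck_norm_zero [simp]: "ck_norm A 0 = 0"
  by (intro antisym ck_norm_le) auto

lemma ck_norm_one: "ck_norm A 1 \<le> 1"
  by (intro ck_norm_le) (auto simp: cstar_seminorm_one)

lemma ck_norm_diff_triangle: "ck_norm A (a - c) \<le> ck_norm A (a - b) + ck_norm A (b - c)"
  using ck_norm_triangle[of A "a - b" "b - c"] by simp

lemma ck_norm_mult_diff:
  "ck_norm A (a * b - c * d) \<le> ck_norm A (a - c) * ck_norm A b + ck_norm A c * ck_norm A (b - d)"
proof -
  have "a * b - c * d = (a - c) * b + c * (b - d)" by (simp add: algebra_simps)
  then show ?thesis
    using ck_norm_triangle[of A "(a - c) * b" "c * (b - d)"] ck_norm_mult[of A "a - c" b]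
      ck_norm_mult[of A c "b - d"] by simp
qed

lemma ck_norm_power: "ck_norm A a \<le> r \<Longrightarrow> ck_norm A (a ^ k) \<le> r ^ k"
proof (induction k)
  case (Suc k)
  have "ck_norm A (a ^ Suc k) \<le> ck_norm A a * ck_norm A (a ^ k)"
    using ck_norm_mult[of A a "a ^ k"] by simp
  also have "\<dots> \<le> r * r ^ k"
    using Suc order.trans[OF ck_norm_nonneg Suc.prems] by (intro mult_mono) auto
  finally show ?case by simp
qed (simp add: ck_norm_one)


section \<open>The Cuntz--Krieger algebra as a completion\<close>

lemma ck_CauchyI:
  assumes "\<And>e. e > 0 \<Longrightarrow> \<exists>K. \<forall>m\<ge>K. \<forall>n\<ge>K. ck_norm A (X m - X n) < e"
  shows "X \<in> ck_Cauchy A"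
  using assms by (simp add: ck_Cauchy_def)

lemma ck_CauchyD:
  assumes "X \<in> ck_Cauchy A" "e > 0"
  shows "\<exists>K. \<forall>m\<ge>K. \<forall>n\<ge>K. ck_norm A (X m - X n) < e"
  using assms by (simp add: ck_Cauchy_def)

lemma ck_Cauchy_dominated:
  assumes X: "X \<in> ck_Cauchy A" and Y: "Y \<in> ck_Cauchy A"
    and C: "0 \<le> C"
    and le: "\<And>m n. ck_norm A (Z m - Z n) \<le> C * (ck_norm A (X m - X n) + ck_norm A (Y m - Y n))"
  shows "Z \<in> ck_Cauchy A"
proof (rule ck_CauchyI)
  fix e :: real assume e: "e > 0"
  define d where "d = e / (2 * (C + 1))"
  have d: "d > 0" using e C by (simp add: d_def)
  obtain K where K: "\<forall>m\<ge>K. \<forall>n\<ge>K. ck_norm A (X m - X n) < d" using ck_CauchyD[OF X d] by blast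
  obtain L where L: "\<forall>m\<ge>L. \<forall>n\<ge>L. ck_norm A (Y m - Y n) < d" using ck_CauchyD[OF Y d] by blast
  have "ck_norm A (Z m - Z n) < e" if "m \<ge> max K L" "n \<ge> max K L" for m n
  proof -
    have "ck_norm A (Z m - Z n) \<le> C * (ck_norm A (X m - X n) + ck_norm A (Y m - Y n))" by (rule le)
    also have "\<dots> \<le> C * (d + d)"
      using K L that C by (intro mult_left_mono add_mono) (auto intro: less_imp_le)
    also have "\<dots> < (C + 1) * (d + d)" using d by (intro mult_strict_right_mono) auto
    also have "\<dots> = 2 * (C + 1) * d" by simp
    also have "\<dots> = e"
    proof -
      have "2 * (C + 1) \<noteq> 0" using C by simp
      then show ?thesis unfolding d_def times_divide_eq_right by (rule nonzero_mult_div_cancel_left)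
    qed
    finally show ?thesis .
  qed
  then show "\<exists>K. \<forall>m\<ge>K. \<forall>n\<ge>K. ck_norm A (Z m - Z n) < e" by blast
qed

lemma ck_Cauchy_const [simp]: "(\<lambda>n. a) \<in> ck_Cauchy A"
  by (intro ck_CauchyI) auto

lemma ck_Cauchy_add:
  assumes "X \<in> ck_Cauchy A" "Y \<in> ck_Cauchy A"
  shows "(\<lambda>n. X n + Y n) \<in> ck_Cauchy A"
proof (rule ck_Cauchy_dominated[OF assms, of 1])
  show "ck_norm A (X m + Y m - (X n + Y n)) \<le> 1 * (ck_norm A (X m - X n) + ck_norm A (Y m - Y n))" for m n
    using ck_norm_triangle[of A "X m - X n" "Y m - Y n"] by (simp add: algebra_simps)
qed simp

lemma ck_Cauchy_scale:
  assumes "X \<in> ck_Cauchy A"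
  shows "(\<lambda>n. poly_scale c (X n)) \<in> ck_Cauchy A"
proof (rule ck_Cauchy_dominated[OF assms ck_Cauchy_const, of "cmod c" _ 0])
  show "ck_norm A (poly_scale c (X m) - poly_scale c (X n))
      \<le> cmod c * (ck_norm A (X m - X n) + ck_norm A (0 - 0))" for m n
    using ck_norm_scale_le[of A c "X m - X n"] by (simp add: poly_scale_diff)
qed simp

lemma ck_Cauchy_star:
  assumes "X \<in> ck_Cauchy A"
  shows "(\<lambda>n. poly_star (X n)) \<in> ck_Cauchy A"
proof (rule ck_Cauchy_dominated[OF assms ck_Cauchy_const, of 1 _ 0])
  show "ck_norm A (poly_star (X m) - poly_star (X n))
      \<le> 1 * (ck_norm A (X m - X n) + ck_norm A (0 - 0))" for m n
    by (simp add: ck_norm_star flip: poly_star_diff)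
qed simp

lemma ck_Cauchy_bounded:
  assumes X: "X \<in> ck_Cauchy A"
  obtains C where "0 \<le> C" "\<And>n. ck_norm A (X n) \<le> C"
proof -
  obtain K where K: "\<forall>m\<ge>K. \<forall>n\<ge>K. ck_norm A (X m - X n) < 1" using ck_CauchyD[OF X, of 1] by auto
  have "ck_norm A (X n) \<le> 1 + (\<Sum>k\<le>K. ck_norm A (X k))" for n
  proof (cases "n \<le> K")
    case True
    then have "ck_norm A (X n) \<le> (\<Sum>k\<le>K. ck_norm A (X k))"
      by (intro member_le_sum) auto
    then show ?thesis by simp
  next
    case False
    then have "ck_norm A (X n - X K) < 1" using K by auto
    moreover have "ck_norm A (X n) \<le> ck_norm A (X n - X K) + ck_norm A (X K)"
      using ck_norm_triangle[of A "X n - X K" "X K"] by simp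
    moreover have "ck_norm A (X K) \<le> (\<Sum>k\<le>K. ck_norm A (X k))"
      by (intro member_le_sum) auto
    ultimately show ?thesis by linarith
  qed
  moreover have "0 \<le> 1 + (\<Sum>k\<le>K. ck_norm A (X k))" by (simp add: sum_nonneg)
  ultimately show thesis using that by blast
qed

lemma ck_Cauchy_mult:
  assumes X: "X \<in> ck_Cauchy A" and Y: "Y \<in> ck_Cauchy A"
  shows "(\<lambda>n. X n * Y n) \<in> ck_Cauchy A"
proof -
  obtain C where C: "0 \<le> C" "\<And>n. ck_norm A (X n) \<le> C" using ck_Cauchy_bounded[OF X] by blast
  obtain D where D: "0 \<le> D" "\<And>n. ck_norm A (Y n) \<le> D" using ck_Cauchy_bounded[OF Y] by blast
  show ?thesis
  proof (rule ck_Cauchy_dominated[OF X Y, of "C + D"])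
    fix m n
    have "ck_norm A (X m * Y m - X n * Y n)
        \<le> ck_norm A (X m - X n) * ck_norm A (Y m) + ck_norm A (X n) * ck_norm A (Y m - Y n)"
      by (rule ck_norm_mult_diff)
    also have "\<dots> \<le> ck_norm A (X m - X n) * (C + D) + (C + D) * ck_norm A (Y m - Y n)"
      using C(1) D(1) C(2)[of n] D(2)[of m] by (intro add_mono mult_left_mono mult_right_mono) simp_all
    finally show "ck_norm A (X m * Y m - X n * Y n)
        \<le> (C + D) * (ck_norm A (X m - X n) + ck_norm A (Y m - Y n))"
      by (simp add: algebra_simps)
  qed (use C D in simp)
qed

lemma ck_relI:
  assumes X: "X \<in> ck_Cauchy A" and Y: "Y \<in> ck_Cauchy A" and g: "g \<longlonglongrightarrow> 0"
    and le: "\<And>n. ck_norm A (X n - Y n) \<le> g n"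
  shows "(X, Y) \<in> ck_rel A"
  using X Y tendsto_sandwich[OF _ _ tendsto_const g, of "\<lambda>n. ck_norm A (X n - Y n)"] le
  by (auto simp: ck_rel_def)

lemma ck_relD:
  assumes "(X, Y) \<in> ck_rel A"
  shows "X \<in> ck_Cauchy A" "Y \<in> ck_Cauchy A" "(\<lambda>n. ck_norm A (X n - Y n)) \<longlonglongrightarrow> 0"
  using assms by (auto simp: ck_rel_def)

lemma equiv_ck_rel: "equiv (ck_Cauchy A) (ck_rel A)"
proof (rule equivI)
  show "ck_rel A \<subseteq> ck_Cauchy A \<times> ck_Cauchy A" by (auto simp: ck_rel_def)
  show "refl_on (ck_Cauchy A) (ck_rel A)" by (auto simp: refl_on_def ck_rel_def)
  show "sym (ck_rel A)"
    by (auto simp: sym_def ck_rel_def ck_norm_minus_commute)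
  show "trans (ck_rel A)"
  proof (rule transI)
    fix X Y Z assume XY: "(X, Y) \<in> ck_rel A" and YZ: "(Y, Z) \<in> ck_rel A"
    show "(X, Z) \<in> ck_rel A"
    proof (rule ck_relI[OF ck_relD(1)[OF XY] ck_relD(2)[OF YZ]])
      show "(\<lambda>n. ck_norm A (X n - Y n) + ck_norm A (Y n - Z n)) \<longlonglongrightarrow> 0"
        using tendsto_add[OF ck_relD(3)[OF XY] ck_relD(3)[OF YZ]] by simp
    qed (rule ck_norm_diff_triangle)
  qed
qed

lemma ck_class_eq_iff:
  assumes "X \<in> ck_Cauchy A" "Y \<in> ck_Cauchy A"
  shows "ck_class A X = ck_class A Y \<longleftrightarrow> (X, Y) \<in> ck_rel A"
  using eq_equiv_class_iff[OF equiv_ck_rel assms] .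

lemma ck_classI [simp]: "X \<in> ck_Cauchy A \<Longrightarrow> ck_class A X \<in> carrier (cuntz_krieger_algebra A)"
  by (auto simp: cuntz_krieger_algebra_def intro: quotientI)

lemma ck_carrierE:
  assumes "a \<in> carrier (cuntz_krieger_algebra A)"
  obtains X where "X \<in> ck_Cauchy A" "a = ck_class A X"
  using assms by (auto simp: cuntz_krieger_algebra_def elim: quotientE)

lemma rep_ck_class:
  assumes X: "X \<in> ck_Cauchy A"
  shows "(X, rep (ck_class A X)) \<in> ck_rel A"
proof -
  have "X \<in> ck_class A X" using equiv_class_self[OF equiv_ck_rel X] .
  then have "rep (ck_class A X) \<in> ck_class A X" unfolding rep_def by (rule someI[of "\<lambda>Z. Z \<in> ck_class A X"])
  then show ?thesis by simp
qed

lemma rep_ck_class_Cauchy: "X \<in> ck_Cauchy A \<Longrightarrow> rep (ck_class A X) \<in> ck_Cauchy A"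
  using ck_relD(2)[OF rep_ck_class] .

lemma ck_class_add:
  assumes X: "X \<in> ck_Cauchy A" and Y: "Y \<in> ck_Cauchy A"
  shows "ck_class A X \<oplus>\<^bsub>cuntz_krieger_algebra A\<^esub> ck_class A Y = ck_class A (\<lambda>n. X n + Y n)"
proof -
  let ?X = "rep (ck_class A X)" and ?Y = "rep (ck_class A Y)"
  note rX = rep_ck_class[OF X] and rY = rep_ck_class[OF Y]
  have "((\<lambda>n. X n + Y n), (\<lambda>n. ?X n + ?Y n)) \<in> ck_rel A"
  proof (rule ck_relI)
    show "(\<lambda>n. ck_norm A (X n - ?X n) + ck_norm A (Y n - ?Y n)) \<longlonglongrightarrow> 0"
      using tendsto_add[OF ck_relD(3)[OF rX] ck_relD(3)[OF rY]] by simp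
    show "ck_norm A (X n + Y n - (?X n + ?Y n)) \<le> ck_norm A (X n - ?X n) + ck_norm A (Y n - ?Y n)" for n
      using ck_norm_triangle[of A "X n - ?X n" "Y n - ?Y n"] by (simp add: algebra_simps)
  qed (use X Y in \<open>simp_all add: ck_Cauchy_add rep_ck_class_Cauchy\<close>)
  then show ?thesis
    using equiv_class_eq[OF equiv_ck_rel] by (fastforce simp: cuntz_krieger_algebra_def)
qed

lemma ck_class_mult:
  assumes X: "X \<in> ck_Cauchy A" and Y: "Y \<in> ck_Cauchy A"
  shows "ck_class A X \<otimes>\<^bsub>cuntz_krieger_algebra A\<^esub> ck_class A Y = ck_class A (\<lambda>n. X n * Y n)"
proof -
  let ?X = "rep (ck_class A X)" and ?Y = "rep (ck_class A Y)"
  note rX = rep_ck_class[OF X] and rY = rep_ck_class[OF Y]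
  obtain C where C: "0 \<le> C" "\<And>n. ck_norm A (?X n) \<le> C"
    using ck_Cauchy_bounded[OF rep_ck_class_Cauchy[OF X]] by blast
  obtain D where D: "0 \<le> D" "\<And>n. ck_norm A (Y n) \<le> D"
    using ck_Cauchy_bounded[OF Y] by blast
  have "((\<lambda>n. X n * Y n), (\<lambda>n. ?X n * ?Y n)) \<in> ck_rel A"
  proof (rule ck_relI)
    show "(\<lambda>n. ck_norm A (X n - ?X n) * D + C * ck_norm A (Y n - ?Y n)) \<longlonglongrightarrow> 0"
      using tendsto_add[OF tendsto_mult_left_zero[OF ck_relD(3)[OF rX], of D]
          tendsto_mult_right_zero[OF ck_relD(3)[OF rY], of C]] by simp
    show "ck_norm A (X n * Y n - ?X n * ?Y n)
        \<le> ck_norm A (X n - ?X n) * D + C * ck_norm A (Y n - ?Y n)" for n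
      using C(2)[of n] D(2)[of n]
      by (intro order.trans[OF ck_norm_mult_diff] add_mono mult_left_mono mult_right_mono) auto
  qed (use X Y in \<open>simp_all add: ck_Cauchy_mult rep_ck_class_Cauchy\<close>)
  then show ?thesis
    using equiv_class_eq[OF equiv_ck_rel] by (fastforce simp: cuntz_krieger_algebra_def)
qed

lemma ck_class_scale:
  assumes X: "X \<in> ck_Cauchy A"
  shows "cscale (cuntz_krieger_algebra A) c (ck_class A X) = ck_class A (\<lambda>n. poly_scale c (X n))"
proof -
  let ?X = "rep (ck_class A X)"
  note rX = rep_ck_class[OF X]
  have "((\<lambda>n. poly_scale c (X n)), (\<lambda>n. poly_scale c (?X n))) \<in> ck_rel A"
  proof (rule ck_relI)
    show "(\<lambda>n. cmod c * ck_norm A (X n - ?X n)) \<longlonglongrightarrow> 0"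
      using tendsto_mult_right_zero[OF ck_relD(3)[OF rX]] .
    show "ck_norm A (poly_scale c (X n) - poly_scale c (?X n)) \<le> cmod c * ck_norm A (X n - ?X n)" for n
      using ck_norm_scale_le[of A c "X n - ?X n"] by (simp add: poly_scale_diff)
  qed (use X in \<open>simp_all add: ck_Cauchy_scale rep_ck_class_Cauchy\<close>)
  then show ?thesis
    using equiv_class_eq[OF equiv_ck_rel] by (fastforce simp: cuntz_krieger_algebra_def)
qed

lemma ck_class_star:
  assumes X: "X \<in> ck_Cauchy A"
  shows "star (cuntz_krieger_algebra A) (ck_class A X) = ck_class A (\<lambda>n. poly_star (X n))"
proof -
  let ?X = "rep (ck_class A X)"
  note rX = rep_ck_class[OF X]
  have "((\<lambda>n. poly_star (X n)), (\<lambda>n. poly_star (?X n))) \<in> ck_rel A"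
  proof (rule ck_relI[OF _ _ ck_relD(3)[OF rX]])
    show "ck_norm A (poly_star (X n) - poly_star (?X n)) \<le> ck_norm A (X n - ?X n)" for n
      by (simp add: ck_norm_star flip: poly_star_diff)
  qed (use X in \<open>simp_all add: ck_Cauchy_star rep_ck_class_Cauchy\<close>)
  then show ?thesis
    using equiv_class_eq[OF equiv_ck_rel] by (fastforce simp: cuntz_krieger_algebra_def)
qed

lemma ck_one: "\<one>\<^bsub>cuntz_krieger_algebra A\<^esub> = ck_class A (\<lambda>n. 1)"
  by (simp add: cuntz_krieger_algebra_def)

lemma ck_class_shift:
  assumes X: "X \<in> ck_Cauchy A"
  shows "(\<lambda>n. X (n + K)) \<in> ck_Cauchy A" "ck_class A X = ck_class A (\<lambda>n. X (n + K))"
proof -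
  show X': "(\<lambda>n. X (n + K)) \<in> ck_Cauchy A"
  proof (rule ck_CauchyI)
    fix e :: real assume "e > 0"
    then obtain L where "\<forall>m\<ge>L. \<forall>n\<ge>L. ck_norm A (X m - X n) < e" using ck_CauchyD[OF X] by blast
    then show "\<exists>L. \<forall>m\<ge>L. \<forall>n\<ge>L. ck_norm A (X (m + K) - X (n + K)) < e"
      by (intro exI[of _ L]) auto
  qed
  have "(\<lambda>n. ck_norm A (X n - X (n + K))) \<longlonglongrightarrow> 0"
  proof (rule LIMSEQ_I)
    fix e :: real assume "e > 0"
    then obtain L where "\<forall>m\<ge>L. \<forall>n\<ge>L. ck_norm A (X m - X n) < e" using ck_CauchyD[OF X] by blast
    then show "\<exists>L. \<forall>n\<ge>L. norm (ck_norm A (X n - X (n + K)) - 0) < e"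
      by (intro exI[of _ L]) auto
  qed
  then show "ck_class A X = ck_class A (\<lambda>n. X (n + K))"
    using X X' by (subst ck_class_eq_iff) (auto simp: ck_rel_def)
qed

lemma ck_closed [simp]:
  fixes A :: "nat ^ 'n::finite ^ 'n"
  defines "\<AA> \<equiv> cuntz_krieger_algebra A"
  shows "\<lbrakk>a \<in> carrier \<AA>; b \<in> carrier \<AA>\<rbrakk> \<Longrightarrow> a \<oplus>\<^bsub>\<AA>\<^esub> b \<in> carrier \<AA>"
    and "\<lbrakk>a \<in> carrier \<AA>; b \<in> carrier \<AA>\<rbrakk> \<Longrightarrow> a \<otimes>\<^bsub>\<AA>\<^esub> b \<in> carrier \<AA>"
    and "a \<in> carrier \<AA> \<Longrightarrow> cscale \<AA> c a \<in> carrier \<AA>"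
    and "a \<in> carrier \<AA> \<Longrightarrow> star \<AA> a \<in> carrier \<AA>"
    and "\<one>\<^bsub>\<AA>\<^esub> \<in> carrier \<AA>"
  unfolding \<AA>_def
  by (auto elim!: ck_carrierE simp: ck_class_add ck_class_mult ck_class_scale ck_class_star ck_one
      ck_Cauchy_add ck_Cauchy_mult ck_Cauchy_scale ck_Cauchy_star)

text \<open>In a Banach algebra \<open>1 - a\<close> is invertible when \<open>\<parallel>a\<parallel> < 1\<close>. For the class \<open>a\<close> of \<open>Y\<close>, the diagonal
  partial sums \<open>Z n = \<Sum>k<n. Y n ^ k\<close> of the Neumann series represent an inverse directly, so
  completeness of the completion is not needed.\<close>

lemma ck_left_inverse:
  assumes Y: "Y \<in> ck_Cauchy A" and r: "r < 1" and Yr: "\<And>n. ck_norm A (Y n) \<le> r"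
  shows "\<exists>c\<in>carrier (cuntz_krieger_algebra A).
    c \<otimes>\<^bsub>cuntz_krieger_algebra A\<^esub> ck_class A (\<lambda>n. 1 - Y n) = \<one>\<^bsub>cuntz_krieger_algebra A\<^esub>"
proof -
  define Z where "Z n = (\<Sum>k<n. Y n ^ k)" for n
  have r0: "0 \<le> r" using order.trans[OF ck_norm_nonneg Yr] .
  have inv: "Z n * (1 - Y n) = 1 - Y n ^ n" "(1 - Y n) * Z n = 1 - Y n ^ n" for n
  proof -
    have "(1 - Y n) * (\<Sum>k<m. Y n ^ k) = 1 - Y n ^ m" for m
    proof (induction m)
      case (Suc m)
      have "(1 - Y n) * (\<Sum>k<Suc m. Y n ^ k) = (1 - Y n) * (\<Sum>k<m. Y n ^ k) + (1 - Y n) * Y n ^ m"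
        by (simp add: distrib_left)
      also have "\<dots> = 1 - Y n ^ Suc m"
        unfolding Suc by (simp add: left_diff_distrib)
      finally show ?case .
    qed simp
    then show l: "(1 - Y n) * Z n = 1 - Y n ^ n" by (simp add: Z_def)
    have "Z n * Y n = Y n * Z n"
      unfolding Z_def by (simp add: sum_distrib_left sum_distrib_right power_commutes)
    then show "Z n * (1 - Y n) = 1 - Y n ^ n"
      using l by (simp add: algebra_simps)
  qed
  define C where "C = 1 / (1 - r)"
  have C0: "0 \<le> C" using r by (simp add: C_def)
  have ZC: "ck_norm A (Z n) \<le> C" for n
  proof -
    have "ck_norm A (\<Sum>k<m. Y n ^ k) \<le> (\<Sum>k<m. r ^ k)" for m
    proof (induction m)
      case (Suc m)
      then show ?case
        using ck_norm_triangle[of A "\<Sum>k<m. Y n ^ k" "Y n ^ m"] ck_norm_power[OF Yr, of n m] by simp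
    qed simp
    moreover have "(\<Sum>k<n. r ^ k) \<le> C"
      using r r0 by (simp add: C_def sum_gp_strict divide_right_mono)
    ultimately show ?thesis unfolding Z_def using order.trans by blast
  qed
  have rlim: "(\<lambda>n. r ^ n) \<longlonglongrightarrow> 0" using r r0 by (intro LIMSEQ_realpow_zero)
  have Z: "Z \<in> ck_Cauchy A"
  proof (rule ck_CauchyI)
    fix e :: real assume e: "e > 0"
    define d where "d = e / (3 * (C * C + C + 1))"
    have C1: "C * C + C + 1 > 0" using C0 by (simp add: add_nonneg_pos)
    have d: "d > 0" using e C1 by (simp add: d_def)
    obtain K where K: "\<forall>m\<ge>K. \<forall>n\<ge>K. ck_norm A (Y m - Y n) < d" using ck_CauchyD[OF Y d] by blast
    obtain L where L: "\<forall>n\<ge>L. norm (r ^ n - 0) < d" using LIMSEQ_D[OF rlim d] by blast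
    have "ck_norm A (Z m - Z n) < e" if mn: "m \<ge> max K L" "n \<ge> max K L" for m n
    proof -
      \<comment> \<open>The resolvent identity \<open>u - v = u (v' - u') v\<close> for inverses \<open>u\<close>, \<open>v\<close> of \<open>u'\<close>, \<open>v'\<close>, up to the
        error terms that come from truncating the series.\<close>
      have "Z m * ((1 - Y n) * Z n) = Z m * (1 - Y n ^ n)"
        and "Z m * (1 - Y m) * Z n = (1 - Y m ^ m) * Z n"
        by (simp_all only: inv)
      then have zm: "Z m = Z m * Z n - Z m * Y n * Z n + Z m * Y n ^ n"
        and zn: "Z n = Z m * Z n - Z m * Y m * Z n + Y m ^ m * Z n"
        by (simp_all add: algebra_simps)
      have "Z m - Z n = (Z m * Z n - Z m * Y n * Z n + Z m * Y n ^ n)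
          - (Z m * Z n - Z m * Y m * Z n + Y m ^ m * Z n)"
        using arg_cong2[OF zm zn, of "(-)"] .
      also have "\<dots> = Z m * (Y m - Y n) * Z n + Z m * Y n ^ n - Y m ^ m * Z n"
        by (simp add: algebra_simps)
      finally have "Z m - Z n = Z m * (Y m - Y n) * Z n + Z m * Y n ^ n - Y m ^ m * Z n" .
      then have "ck_norm A (Z m - Z n)
          \<le> ck_norm A (Z m * (Y m - Y n) * Z n) + ck_norm A (Z m * Y n ^ n) + ck_norm A (Y m ^ m * Z n)"
        using ck_norm_triangle[of A "Z m * (Y m - Y n) * Z n + Z m * Y n ^ n" "- (Y m ^ m * Z n)"]
          ck_norm_triangle[of A "Z m * (Y m - Y n) * Z n" "Z m * Y n ^ n"]
        by (simp add: ck_norm_uminus)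
      also have "ck_norm A (Z m * (Y m - Y n) * Z n) \<le> C * d * C"
      proof -
        have "ck_norm A (Z m * (Y m - Y n) * Z n) \<le> ck_norm A (Z m * (Y m - Y n)) * ck_norm A (Z n)"
          by (rule ck_norm_mult)
        also have "\<dots> \<le> (ck_norm A (Z m) * ck_norm A (Y m - Y n)) * ck_norm A (Z n)"
          by (intro mult_right_mono ck_norm_mult) auto
        also have "\<dots> \<le> C * d * C"
          using K mn C0 d ZC by (intro mult_mono) (auto intro: less_imp_le)
        finally show ?thesis .
      qed
      also have "ck_norm A (Z m * Y n ^ n) \<le> C * d"
      proof -
        have "r ^ n \<le> d" using L mn by (auto intro: less_imp_le)
        then have "ck_norm A (Y n ^ n) \<le> d" using ck_norm_power[OF Yr, of n n] by simp
        then show ?thesis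
          using C0 ZC by (intro order.trans[OF ck_norm_mult] mult_mono) auto
      qed
      also have "ck_norm A (Y m ^ m * Z n) \<le> d * C"
      proof -
        have "r ^ m \<le> d" using L mn by (auto intro: less_imp_le)
        then have "ck_norm A (Y m ^ m) \<le> d" using ck_norm_power[OF Yr, of m m] by simp
        then show ?thesis
          using d ZC by (intro order.trans[OF ck_norm_mult] mult_mono) auto
      qed
      also have "C * d * C + C * d + d * C < 3 * (C * C + C + 1) * d"
      proof -
        have "0 \<le> C * d" "0 \<le> C * (C * d)" using d C0 by simp_all
        then show ?thesis using d by (simp add: algebra_simps)
      qed
      also have "\<dots> = e" using C1 by (simp add: d_def)
      finally show ?thesis by simp
    qed
    then show "\<exists>K. \<forall>m\<ge>K. \<forall>n\<ge>K. ck_norm A (Z m - Z n) < e" by blast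
  qed
  have Y1: "(\<lambda>n. 1 - Y n) \<in> ck_Cauchy A"
    using ck_Cauchy_add[OF ck_Cauchy_const[of 1] ck_Cauchy_scale[OF Y, of "-1"]]
    by (simp add: poly_scale_minus_one)
  have "(\<lambda>n. Z n * (1 - Y n), \<lambda>n. 1) \<in> ck_rel A"
  proof (rule ck_relI[OF ck_Cauchy_mult[OF Z Y1] ck_Cauchy_const rlim])
    show "ck_norm A (Z n * (1 - Y n) - 1) \<le> r ^ n" for n
      using ck_norm_power[OF Yr, of n n] by (simp add: inv ck_norm_uminus)
  qed
  then have "ck_class A Z \<otimes>\<^bsub>cuntz_krieger_algebra A\<^esub> ck_class A (\<lambda>n. 1 - Y n)
      = \<one>\<^bsub>cuntz_krieger_algebra A\<^esub>"
    using Z Y1 by (simp add: ck_class_mult ck_one ck_class_eq_iff ck_Cauchy_mult)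
  then show ?thesis using Z by (intro bexI[of _ "ck_class A Z"]) auto
qed


section \<open>Representations of the free unital *-algebra\<close>

text \<open>A unital *-homomorphism \<open>\<phi>\<close> from the free unital *-algebra to the bounded operators on \<open>H\<close>.\<close>

locale star_poly_rep = hilbert_carrier H for H :: "('h, 'm) inner_space_scheme" +
  fixes \<phi> :: "'n::finite star_poly \<Rightarrow> 'h \<Rightarrow> 'h"
  assumes closed [simp]: "\<phi> p \<in> bounded_ops H"
    and add: "\<phi> (p + q) = \<phi> p \<oplus>\<^bsub>\<BB>\<^esub> \<phi> q"
    and mult: "\<phi> (p * q) = \<phi> p \<otimes>\<^bsub>\<BB>\<^esub> \<phi> q"
    and scale: "\<phi> (poly_scale c p) = cscale \<BB> c (\<phi> p)"
    and star: "\<phi> (poly_star p) = star \<BB> (\<phi> p)"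
    and one: "\<phi> 1 = \<one>\<^bsub>\<BB>\<^esub>"
begin

lemma zero: "\<phi> 0 = \<zero>\<^bsub>\<BB>\<^esub>"
proof -
  have "\<phi> 0 = cscale \<BB> 0 (\<phi> 0)" using scale[of 0 0] by simp
  also have "\<dots> = \<zero>\<^bsub>\<BB>\<^esub>" by (intro op_eqI) auto
  finally show ?thesis .
qed

lemma diff: "\<phi> (p - q) = opsub (\<phi> p) (\<phi> q)"
  using add[of p "poly_scale (-1) q"] scale[of "-1" q] by (simp add: poly_scale_minus_one)

lemma sum:
  assumes "finite I"
  shows "\<phi> (\<Sum>i\<in>I. f i) = (\<Oplus>\<^bsub>\<BB>\<^esub>i\<in>I. \<phi> (f i))"
  using assms
proof induction
  case (insert i I)
  have "(\<lambda>i. \<phi> (f i)) \<in> I \<rightarrow> carrier \<BB>" "\<phi> (f i) \<in> carrier \<BB>"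
    by (auto simp: operator_algebra_simps(1))
  then show ?case using insert by (simp add: add ops.finsum_insert)
qed (simp add: zero)

lemma op_norm_zero: "op_norm H \<zero>\<^bsub>\<BB>\<^esub> = 0"
  by (intro antisym op_norm_le op_norm_nonneg) (auto simp: vnorm_def)

lemma op_norm_seminorm: "cstar_seminorm (\<lambda>p. op_norm H (\<phi> p))"
  unfolding cstar_seminorm_def
  by (auto simp: add scale mult star op_norm_triangle op_norm_scale op_norm_mult_le op_norm_C_star)

lemma relators_vanish:
  fixes A :: "nat ^ 'n ^ 'n"
  assumes partial_isometry: "\<And>i. \<phi> (poly_gen i) \<otimes>\<^bsub>\<BB>\<^esub> star \<BB> (\<phi> (poly_gen i)) \<otimes>\<^bsub>\<BB>\<^esub> \<phi> (poly_gen i)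
      = \<phi> (poly_gen i)"
    and source: "\<And>i. star \<BB> (\<phi> (poly_gen i)) \<otimes>\<^bsub>\<BB>\<^esub> \<phi> (poly_gen i)
      = (\<Oplus>\<^bsub>\<BB>\<^esub>j\<in>UNIV. cscale \<BB> (of_nat (A $ i $ j)) (\<phi> (poly_gen j) \<otimes>\<^bsub>\<BB>\<^esub> star \<BB> (\<phi> (poly_gen j))))"
    and range: "(\<Oplus>\<^bsub>\<BB>\<^esub>i\<in>UNIV. \<phi> (poly_gen i) \<otimes>\<^bsub>\<BB>\<^esub> star \<BB> (\<phi> (poly_gen i))) = \<one>\<^bsub>\<BB>\<^esub>"
    and r: "r \<in> ck_relators A"
  shows "\<phi> r = \<zero>\<^bsub>\<BB>\<^esub>"
proof -
  have self: "opsub S S = \<zero>\<^bsub>\<BB>\<^esub>" if "S \<in> bounded_ops H" for S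
    using that by (intro op_eqI) auto
  have nat: "of_nat k * p = poly_scale (of_nat k) p" for k and p :: "'n star_poly"
    by (simp add: poly_scale_def)
  from r consider i where "r = poly_gen i * poly_star (poly_gen i) * poly_gen i - poly_gen i"
    | i where "r = poly_star (poly_gen i) * poly_gen i
        - (\<Sum>j\<in>UNIV. of_nat (A $ i $ j) * (poly_gen j * poly_star (poly_gen j)))"
    | "r = (\<Sum>i\<in>UNIV. poly_gen i * poly_star (poly_gen i)) - 1"
    by (auto simp: ck_relators_def Let_def)
  then show ?thesis
  proof cases
    case 1
    then show ?thesis
      by (simp add: diff mult star partial_isometry self)
  next
    case (2 i)
    have "\<phi> (\<Sum>j\<in>UNIV. of_nat (A $ i $ j) * (poly_gen j * poly_star (poly_gen j)))
        = star \<BB> (\<phi> (poly_gen i)) \<otimes>\<^bsub>\<BB>\<^esub> \<phi> (poly_gen i)"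
      unfolding source by (simp add: sum nat scale mult star)
    then show ?thesis
      unfolding 2 by (simp add: diff mult star self)
  next
    case 3
    have "\<phi> (\<Sum>i\<in>UNIV. poly_gen i * poly_star (poly_gen i)) = \<one>\<^bsub>\<BB>\<^esub>"
      unfolding range[symmetric] by (simp add: sum mult star)
    then show ?thesis
      unfolding 3 by (simp add: diff one self)
  qed
qed

text \<open>A representation that kills the relators pulls the operator norm back to one of the seminorms of
  which \<open>ck_norm\<close> is the supremum.\<close>

lemma op_norm_le_ck_norm:
  fixes A :: "nat ^ 'n ^ 'n"
  assumes "\<And>r. r \<in> ck_relators A \<Longrightarrow> \<phi> r = \<zero>\<^bsub>\<BB>\<^esub>"
  shows "op_norm H (\<phi> p) \<le> ck_norm A p"
  using assms op_norm_seminorm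
  by (intro ck_seminorm_le_ck_norm[of "\<lambda>p. op_norm H (\<phi> p)"]) (auto simp: op_norm_zero)

end

context hilbert_carrier
begin

lemma star_poly_rep_unique:
  assumes \<phi>: "star_poly_rep H \<phi>" and \<psi>: "star_poly_rep H \<psi>"
    and gen: "\<And>i. \<phi> (poly_gen i) = \<psi> (poly_gen i)"
  shows "\<phi> = \<psi>"
proof
  fix p
  interpret \<phi>: star_poly_rep H \<phi> by fact
  interpret \<psi>: star_poly_rep H \<psi> by fact
  have word: "\<phi> (Poly_Mapping.single w 1) = \<psi> (Poly_Mapping.single w 1)" for w
  proof (induction w)
    case Nil
    show ?case using \<phi>.one \<psi>.one by (simp flip: zero_list_def)
  next
    case (Cons x w)
    obtain i b where "x = (i, b)" by fastforce
    then show ?case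
      using Cons by (simp add: single_Cons \<phi>.mult \<psi>.mult \<phi>.star \<psi>.star gen)
  qed
  show "\<phi> p = \<psi> p"
  proof (induction p rule: star_poly_induct)
    case (add w c p)
    have "Poly_Mapping.single w c = poly_scale c (Poly_Mapping.single w 1)"
      by (simp add: poly_scale_single)
    then show ?case using add by (simp add: \<phi>.add \<psi>.add \<phi>.scale \<psi>.scale word)
  qed (simp add: \<phi>.zero \<psi>.zero)
qed

text \<open>Evaluation of a word at given operators \<open>T i\<close>; a letter \<open>(i, True)\<close> stands for the adjoint of
  \<open>T i\<close>.\<close>

primrec word_op :: "('n \<Rightarrow> 'h \<Rightarrow> 'h) \<Rightarrow> ('n \<times> bool) list \<Rightarrow> 'h \<Rightarrow> 'h"
  where "word_op T [] = \<one>\<^bsub>\<BB>\<^esub>"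
  | "word_op T (x # w) = (if snd x then star \<BB> (T (fst x)) else T (fst x)) \<otimes>\<^bsub>\<BB>\<^esub> word_op T w"

text \<open>Evaluation of a noncommutative *-polynomial at the operators \<open>T i\<close>.\<close>

definition poly_op :: "('n \<Rightarrow> 'h \<Rightarrow> 'h) \<Rightarrow> 'n star_poly \<Rightarrow> 'h \<Rightarrow> 'h"
  where "poly_op T p = (\<Oplus>\<^bsub>\<BB>\<^esub>w\<in>Poly_Mapping.keys p. cscale \<BB> (Poly_Mapping.lookup p w) (word_op T w))"

context
  fixes T :: "'n::finite \<Rightarrow> 'h \<Rightarrow> 'h"
  assumes T: "\<And>i. T i \<in> bounded_ops H"
begin

lemma word_op_closed [simp]: "word_op T w \<in> bounded_ops H"
  by (induction w) (auto simp: T)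

lemma word_op_add: "word_op T (v + w) = word_op T v \<otimes>\<^bsub>\<BB>\<^esub> word_op T w"
  by (induction v) (auto simp: plus_list_def T intro!: op_eqI)

lemma word_op_star: "word_op T (word_star w) = star \<BB> (word_op T w)"
proof (induction w)
  case (Cons x w)
  have "word_star (x # w) = word_star w + [(fst x, \<not> snd x)]"
    by (simp add: word_star_def plus_list_def split: prod.splits)
  moreover have "S \<otimes>\<^bsub>\<BB>\<^esub> \<one>\<^bsub>\<BB>\<^esub> = S" if "S \<in> bounded_ops H" for S
    using that by (intro op_eqI) auto
  ultimately show ?case
    using Cons by (simp add: word_op_add star_op_mult star_op_star T)
qed (simp add: word_star_def star_op_one)

lemma poly_op_closed [simp]: "poly_op T p \<in> bounded_ops H"
proof -
  have "poly_op T p \<in> carrier \<BB>"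
    unfolding poly_op_def by (intro ops.finsum_closed) (auto simp: operator_algebra_simps(1))
  then show ?thesis by (simp add: operator_algebra_simps(1))
qed

lemma inner_poly_op:
  assumes x: "x \<in> carrier H" and z: "z \<in> carrier H" and K: "finite K" "Poly_Mapping.keys p \<subseteq> K"
  shows "vinner H (poly_op T p x) z = (\<Sum>w\<in>K. Poly_Mapping.lookup p w * vinner H (word_op T w x) z)"
proof -
  have "vinner H (poly_op T p x) z
      = (\<Sum>w\<in>Poly_Mapping.keys p. Poly_Mapping.lookup p w * vinner H (word_op T w x) z)"
    unfolding poly_op_def by (subst finsum_op_apply) (simp_all add: x z)
  also have "\<dots> = (\<Sum>w\<in>K. Poly_Mapping.lookup p w * vinner H (word_op T w x) z)"
    using K by (intro sum.mono_neutral_left) (auto simp: in_keys_iff)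
  finally show ?thesis .
qed

lemma poly_op_add: "poly_op T (p + q) = poly_op T p \<oplus>\<^bsub>\<BB>\<^esub> poly_op T q"
proof (rule op_eqI)
  fix x z assume xz: "x \<in> carrier H" "z \<in> carrier H"
  let ?K = "Poly_Mapping.keys p \<union> Poly_Mapping.keys q"
  have "vinner H (poly_op T (p + q) x) z
      = (\<Sum>w\<in>?K. Poly_Mapping.lookup (p + q) w * vinner H (word_op T w x) z)"
    using xz Poly_Mapping.keys_add[of p q] by (intro inner_poly_op) auto
  also have "\<dots> = vinner H (poly_op T p x) z + vinner H (poly_op T q x) z"
    using inner_poly_op[OF xz, of ?K p] inner_poly_op[OF xz, of ?K q]
    by (simp add: lookup_add distrib_right sum.distrib)
  finally show "vinner H (poly_op T (p + q) x) z = vinner H ((poly_op T p \<oplus>\<^bsub>\<BB>\<^esub> poly_op T q) x) z"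
    using xz by simp
qed auto

lemma poly_op_single: "poly_op T (Poly_Mapping.single w c) = cscale \<BB> c (word_op T w)"
proof (rule op_eqI)
  fix x z assume xz: "x \<in> carrier H" "z \<in> carrier H"
  show "vinner H (poly_op T (Poly_Mapping.single w c) x) z = vinner H (cscale \<BB> c (word_op T w) x) z"
    using xz inner_poly_op[OF xz, of "{w}" "Poly_Mapping.single w c"] by simp
qed auto

lemma poly_op_zero: "poly_op T 0 = \<zero>\<^bsub>\<BB>\<^esub>"
  by (simp add: poly_op_def)

lemma star_poly_rep_poly_op: "star_poly_rep H (poly_op T)"
proof
  show "poly_op T (p * q) = poly_op T p \<otimes>\<^bsub>\<BB>\<^esub> poly_op T q" for p q
  proof (induction p rule: star_poly_induct)
    case zero
    show ?case by (auto simp: poly_op_zero intro!: op_eqI)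
  next
    case (add v c p)
    have "poly_op T (Poly_Mapping.single v c * q) = cscale \<BB> c (word_op T v) \<otimes>\<^bsub>\<BB>\<^esub> poly_op T q"
    proof (induction q rule: star_poly_induct)
      case zero
      have "cscale \<BB> c (word_op T v) \<otimes>\<^bsub>\<BB>\<^esub> \<zero>\<^bsub>\<BB>\<^esub> = \<zero>\<^bsub>\<BB>\<^esub>"
        by (rule ops.r_null) (simp add: operator_algebra_simps(1))
      then show ?case by (simp add: poly_op_zero)
    next
      case (add w d q)
      have "poly_op T (Poly_Mapping.single v c * Poly_Mapping.single w d)
          = cscale \<BB> c (word_op T v) \<otimes>\<^bsub>\<BB>\<^esub> cscale \<BB> d (word_op T w)"
        by (auto simp: mult_single poly_op_single word_op_add op_scale intro!: op_eqI)
      with add show ?case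
        by (simp add: distrib_left poly_op_add poly_op_single ops.r_distr operator_algebra_simps(1))
    qed
    with add show ?case
      by (simp add: distrib_right poly_op_add poly_op_single ops.l_distr operator_algebra_simps(1))
  qed
  show "poly_op T (poly_scale c p) = cscale \<BB> c (poly_op T p)" for c p
  proof (induction p rule: star_poly_induct)
    case zero
    show ?case by (auto simp: poly_scale_def poly_op_zero intro!: op_eqI)
  next
    case (add w d p)
    then show ?case
      by (auto simp: poly_scale_add poly_op_add poly_scale_single poly_op_single algebra_simps intro!: op_eqI)
  qed
  show "poly_op T (poly_star p) = star \<BB> (poly_op T p)" for p
  proof (induction p rule: star_poly_induct)
    case zero
    have "star \<BB> \<zero>\<^bsub>\<BB>\<^esub> = \<zero>\<^bsub>\<BB>\<^esub>" by (intro adjoint_unique) auto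
    then show ?case by (simp add: poly_op_zero)
  next
    case (add w d p)
    then show ?case
      by (simp add: poly_star_add poly_op_add poly_star_single poly_op_single word_op_star
          star_op_add star_op_scale)
  qed
  show "poly_op T 1 = \<one>\<^bsub>\<BB>\<^esub>"
  proof -
    have "poly_op T 1 = cscale \<BB> 1 (word_op T 0)" using poly_op_single[of 0 1] by simp
    also have "\<dots> = \<one>\<^bsub>\<BB>\<^esub>" by (auto simp: zero_list_def intro!: op_eqI)
    finally show ?thesis .
  qed
qed (simp_all add: poly_op_add)

lemma poly_op_gen: "poly_op T (poly_gen i) = T i"
  by (auto simp: poly_gen_def poly_op_single T intro!: op_eqI)

end

section \<open>Representations of the Cuntz--Krieger algebra are determined by the generators\<close>

lemma representationsD:
  assumes "\<pi> \<in> representations \<AA> H"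
  shows "\<And>a. a \<in> carrier \<AA> \<Longrightarrow> \<pi> a \<in> bounded_ops H"
    and "\<And>a b. \<lbrakk>a \<in> carrier \<AA>; b \<in> carrier \<AA>\<rbrakk> \<Longrightarrow> \<pi> (a \<oplus>\<^bsub>\<AA>\<^esub> b) = \<pi> a \<oplus>\<^bsub>\<BB>\<^esub> \<pi> b"
    and "\<And>a b. \<lbrakk>a \<in> carrier \<AA>; b \<in> carrier \<AA>\<rbrakk> \<Longrightarrow> \<pi> (a \<otimes>\<^bsub>\<AA>\<^esub> b) = \<pi> a \<otimes>\<^bsub>\<BB>\<^esub> \<pi> b"
    and "\<pi> \<one>\<^bsub>\<AA>\<^esub> = \<one>\<^bsub>\<BB>\<^esub>"
    and "\<And>c a. a \<in> carrier \<AA> \<Longrightarrow> \<pi> (cscale \<AA> c a) = cscale \<BB> c (\<pi> a)"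
    and "\<And>a. a \<in> carrier \<AA> \<Longrightarrow> \<pi> (star \<AA> a) = star \<BB> (\<pi> a)"
proof -
  have h: "\<pi> \<in> ring_hom \<AA> \<BB>"
    and sc: "\<forall>c. \<forall>a\<in>carrier \<AA>. \<pi> (cscale \<AA> c a) = cscale \<BB> c (\<pi> a)"
    and st: "\<forall>a\<in>carrier \<AA>. \<pi> (star \<AA> a) = star \<BB> (\<pi> a)"
    using assms unfolding representations_def star_hom_def by blast+
  show "\<pi> a \<in> bounded_ops H" if "a \<in> carrier \<AA>" for a
    using ring_hom_closed[OF h that] unfolding operator_algebra_simps .
  show "\<pi> (a \<oplus>\<^bsub>\<AA>\<^esub> b) = \<pi> a \<oplus>\<^bsub>\<BB>\<^esub> \<pi> b" if "a \<in> carrier \<AA>" "b \<in> carrier \<AA>" for a b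
    using ring_hom_add[OF h that] .
  show "\<pi> (a \<otimes>\<^bsub>\<AA>\<^esub> b) = \<pi> a \<otimes>\<^bsub>\<BB>\<^esub> \<pi> b" if "a \<in> carrier \<AA>" "b \<in> carrier \<AA>" for a b
    using ring_hom_mult[OF h that] .
  show "\<pi> \<one>\<^bsub>\<AA>\<^esub> = \<one>\<^bsub>\<BB>\<^esub>" using ring_hom_one[OF h] .
  show "\<pi> (cscale \<AA> c a) = cscale \<BB> c (\<pi> a)" if "a \<in> carrier \<AA>" for c a
    using sc that by blast
  show "\<pi> (star \<AA> a) = star \<BB> (\<pi> a)" if "a \<in> carrier \<AA>" for a
    using st that by blast
qed

text \<open>Representations are contractive. If \<open>T = \<pi> a\<close> had norm \<open>t > r \<ge> \<parallel>a\<parallel>\<close>, then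
  \<open>1 - a* a / t\<^sup>2\<close> would have a left inverse \<open>c\<close>, hence \<open>W = 1 - T* T / t\<^sup>2\<close> would be bounded below. But
  \<open>\<parallel>W x\<parallel>\<^sup>2 \<le> 2 \<parallel>x\<parallel>\<^sup>2 - 2 \<parallel>T x\<parallel>\<^sup>2 / t\<^sup>2\<close>, so \<open>\<parallel>T x\<parallel>\<close> would stay away from \<open>t \<parallel>x\<parallel>\<close>, contradicting the
  choice of \<open>t\<close>.\<close>

lemma op_norm_representation_le:
  assumes \<pi>: "\<pi> \<in> representations (cuntz_krieger_algebra A) H"
    and Y: "Y \<in> ck_Cauchy A" and Yr: "\<And>n. ck_norm A (Y n) \<le> r"
  shows "op_norm H (\<pi> (ck_class A Y)) \<le> r"
proof (rule ccontr)
  let ?A = "cuntz_krieger_algebra A"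
  define T where "T = \<pi> (ck_class A Y)"
  define t where "t = op_norm H T"
  assume "\<not> op_norm H (\<pi> (ck_class A Y)) \<le> r"
  then have rt: "r < t" by (simp add: t_def T_def)
  have r0: "0 \<le> r" using order.trans[OF ck_norm_nonneg Yr] .
  have t0: "t > 0" using r0 rt by linarith
  have T: "T \<in> bounded_ops H" unfolding T_def using representationsD(1)[OF \<pi>] Y by simp
  define k :: complex where "k = of_real (1 / t\<^sup>2)"
  have k: "cmod k = 1 / t\<^sup>2" unfolding k_def norm_of_real by simp
  define Z where "Z n = poly_scale k (poly_star (Y n) * Y n)" for n
  have YY: "(\<lambda>n. poly_star (Y n) * Y n) \<in> ck_Cauchy A" using Y by (intro ck_Cauchy_mult ck_Cauchy_star)
  have Z: "Z \<in> ck_Cauchy A" unfolding Z_def using YY by (rule ck_Cauchy_scale)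
  have mZ: "(\<lambda>n. poly_scale (-1) (Z n)) \<in> ck_Cauchy A" using Z by (rule ck_Cauchy_scale)
  have "ck_norm A (Z n) \<le> r\<^sup>2 / t\<^sup>2" for n
  proof -
    have "ck_norm A (Z n) \<le> 1 / t\<^sup>2 * ck_norm A (poly_star (Y n) * Y n)"
      using ck_norm_scale_le[of A k "poly_star (Y n) * Y n"] unfolding Z_def k .
    also have "\<dots> \<le> 1 / t\<^sup>2 * (ck_norm A (Y n) * ck_norm A (Y n))"
      using ck_norm_mult[of A "poly_star (Y n)" "Y n"] by (intro mult_left_mono) (auto simp: ck_norm_star)
    also have "\<dots> \<le> 1 / t\<^sup>2 * (r * r)"
      using Yr r0 by (intro mult_left_mono mult_mono) auto
    finally show ?thesis by (simp add: power2_eq_square)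
  qed
  moreover have "r\<^sup>2 / t\<^sup>2 < 1" using rt r0 t0 by (simp add: power_strict_mono)
  ultimately obtain c where c: "c \<in> carrier ?A"
    and inv: "c \<otimes>\<^bsub>?A\<^esub> ck_class A (\<lambda>n. 1 - Z n) = \<one>\<^bsub>?A\<^esub>"
    using ck_left_inverse[OF Z] by blast
  define W where "W = opsub \<one>\<^bsub>\<BB>\<^esub> (cscale \<BB> k (star \<BB> T \<otimes>\<^bsub>\<BB>\<^esub> T))"
  have "ck_class A (\<lambda>n. 1 - Z n)
      = ck_class A (\<lambda>n. 1 + poly_scale (-1) (poly_scale k (poly_star (Y n) * Y n)))"
    by (simp add: Z_def poly_scale_minus_one)
  also have "\<dots> = \<one>\<^bsub>?A\<^esub> \<oplus>\<^bsub>?A\<^esub> cscale ?A (-1) (cscale ?A k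
      (star ?A (ck_class A Y) \<otimes>\<^bsub>?A\<^esub> ck_class A Y))"
    using Y by (simp add: ck_class_star ck_class_mult ck_class_scale ck_class_add ck_one
        ck_Cauchy_star ck_Cauchy_mult ck_Cauchy_scale)
  finally have "ck_class A (\<lambda>n. 1 - Z n) = \<dots>" .
  then have "\<pi> (ck_class A (\<lambda>n. 1 - Z n)) = W"
    using Y unfolding W_def T_def by (simp add: representationsD[OF \<pi>])
  moreover have "ck_class A (\<lambda>n. 1 - Z n) \<in> carrier ?A"
    using ck_Cauchy_add[OF ck_Cauchy_const[of 1] mZ] by (simp add: poly_scale_minus_one)
  ultimately have CW: "\<pi> c \<otimes>\<^bsub>\<BB>\<^esub> W = \<one>\<^bsub>\<BB>\<^esub>"
    using representationsD(3)[OF \<pi> c] inv representationsD(4)[OF \<pi>] by metis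
  have C: "\<pi> c \<in> bounded_ops H" using representationsD(1)[OF \<pi> c] .
  have W: "W \<in> bounded_ops H" unfolding W_def using T by simp
  \<comment> \<open>The summand \<open>1\<close> gives \<open>K \<ge> 1\<close>, which makes \<open>1 - 1 / (2 K\<^sup>2)\<close> nonnegative.\<close>
  define K where "K = op_norm H (\<pi> c) + 1"
  have K1: "K \<ge> 1" using C by (simp add: K_def)
  have le: "(vnorm H (T x))\<^sup>2 \<le> t\<^sup>2 * (1 - 1 / (2 * K\<^sup>2)) * (vnorm H x)\<^sup>2" if x: "x \<in> carrier H" for x
  proof -
    have "x = \<pi> c (W x)" using fun_cong[OF CW, of x] x by simp
    then have "vnorm H x \<le> op_norm H (\<pi> c) * vnorm H (W x)"
      using vnorm_op_le[OF C, of "W x"] W x by simp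
    also have "\<dots> \<le> K * vnorm H (W x)"
      using W x by (intro mult_right_mono) (auto simp: K_def)
    finally have "(vnorm H x)\<^sup>2 \<le> (K * vnorm H (W x))\<^sup>2"
      using x by (intro power_mono) auto
    then have 1: "(vnorm H x)\<^sup>2 \<le> K\<^sup>2 * (vnorm H (W x))\<^sup>2" by (simp add: power_mult_distrib)
    let ?y = "star \<BB> T (T x)"
    have y: "?y \<in> carrier H" using T x by simp
    have "vnorm H ?y \<le> t * vnorm H (T x)"
      using vnorm_op_le[of "star \<BB> T" "T x"] T x by (simp add: t_def op_norm_star)
    also have "\<dots> \<le> t * (t * vnorm H x)"
      using vnorm_op_le[OF T x] t0 by (intro mult_left_mono) (auto simp: t_def)
    finally have "(vnorm H ?y)\<^sup>2 \<le> (t * (t * vnorm H x))\<^sup>2"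
      using y by (intro power_mono) auto
    then have "(vnorm H ?y)\<^sup>2 / (t\<^sup>2 * t\<^sup>2) \<le> (vnorm H x)\<^sup>2"
      using t0 by (simp add: divide_le_eq power_mult_distrib mult_ac)
    moreover have "(vnorm H (W x))\<^sup>2
        = (vnorm H x)\<^sup>2 - 2 / t\<^sup>2 * (vnorm H (T x))\<^sup>2 + (vnorm H ?y)\<^sup>2 / (t\<^sup>2 * t\<^sup>2)"
    proof -
      have Wx: "W x = vadd H x (vscale H (- k) ?y)"
        unfolding W_def using T x by (intro inner_ext) auto
      have "Re (vinner H x ?y) = (vnorm H (T x))\<^sup>2"
        using T x by (simp add: inner_star_right vnorm_sq)
      moreover have "Re (cnj (- k) * vinner H x ?y) = - Re k * Re (vinner H x ?y)"
        by (simp add: k_def Im_divide flip: of_real_power)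
      moreover have "Re k = 1 / t\<^sup>2" unfolding k_def by (rule Re_complex_of_real)
      ultimately have "Re (cnj (- k) * vinner H x ?y) = - (1 / t\<^sup>2) * (vnorm H (T x))\<^sup>2"
        by simp
      then show ?thesis
        unfolding Wx using x y k by (simp add: vnorm_add_sq power_mult_distrib power_divide)
    qed
    ultimately have "(vnorm H (W x))\<^sup>2 \<le> 2 * (vnorm H x)\<^sup>2 - 2 / t\<^sup>2 * (vnorm H (T x))\<^sup>2"
      by linarith
    then have "K\<^sup>2 * (vnorm H (W x))\<^sup>2 \<le> K\<^sup>2 * (2 * (vnorm H x)\<^sup>2 - 2 / t\<^sup>2 * (vnorm H (T x))\<^sup>2)"
      by (intro mult_left_mono) auto
    with 1 have "(vnorm H x)\<^sup>2 \<le> K\<^sup>2 * (2 * (vnorm H x)\<^sup>2 - 2 / t\<^sup>2 * (vnorm H (T x))\<^sup>2)"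
      by linarith
    then show ?thesis using t0 K1 by (simp add: field_simps)
  qed
  have "op_norm H T \<le> t * sqrt (1 - 1 / (2 * K\<^sup>2))"
  proof (rule op_norm_le)
    have "1 \<le> K\<^sup>2" using K1 by simp
    then have s: "0 \<le> 1 - 1 / (2 * K\<^sup>2)" by (simp add: divide_le_eq)
    then show "0 \<le> t * sqrt (1 - 1 / (2 * K\<^sup>2))" using t0 by simp
    fix x assume x: "x \<in> carrier H"
    have "(vnorm H (T x))\<^sup>2 \<le> (t * sqrt (1 - 1 / (2 * K\<^sup>2)) * vnorm H x)\<^sup>2"
      using le[OF x] s by (simp add: power_mult_distrib)
    then show "vnorm H (T x) \<le> t * sqrt (1 - 1 / (2 * K\<^sup>2)) * vnorm H x"
      using s t0 x by (intro power2_le_imp_le[of "vnorm H (T x)"]) auto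
  qed
  also have "\<dots> < t * 1"
    using t0 K1 by (intro mult_strict_left_mono) (auto simp: real_sqrt_lt_1_iff)
  finally show False by (simp add: t_def)
qed

lemma representation_star_poly_rep:
  assumes \<pi>: "\<pi> \<in> representations (cuntz_krieger_algebra A) H"
  shows "star_poly_rep H (\<lambda>p. \<pi> (ck_class A (\<lambda>n. p)))"
proof
  note \<pi>D = representationsD[OF \<pi>]
  fix p q c
  show "\<pi> (ck_class A (\<lambda>n. p)) \<in> bounded_ops H" by (simp add: \<pi>D)
  show "\<pi> (ck_class A (\<lambda>n. p + q)) = \<pi> (ck_class A (\<lambda>n. p)) \<oplus>\<^bsub>\<BB>\<^esub> \<pi> (ck_class A (\<lambda>n. q))"
    by (simp add: ck_class_add flip: \<pi>D)
  show "\<pi> (ck_class A (\<lambda>n. p * q)) = \<pi> (ck_class A (\<lambda>n. p)) \<otimes>\<^bsub>\<BB>\<^esub> \<pi> (ck_class A (\<lambda>n. q))"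
    by (simp add: ck_class_mult flip: \<pi>D)
  show "\<pi> (ck_class A (\<lambda>n. poly_scale c p)) = cscale \<BB> c (\<pi> (ck_class A (\<lambda>n. p)))"
    by (simp add: ck_class_scale flip: \<pi>D)
  show "\<pi> (ck_class A (\<lambda>n. poly_star p)) = star \<BB> (\<pi> (ck_class A (\<lambda>n. p)))"
    by (simp add: ck_class_star flip: \<pi>D)
  show "\<pi> (ck_class A (\<lambda>n. 1)) = \<one>\<^bsub>\<BB>\<^esub>"
    by (simp add: \<pi>D flip: ck_one)
qed

text \<open>Continuity: the image of the class of \<open>X\<close> is the limit of the images of the constant classes
  \<open>X n\<close>.\<close>

lemma representation_op_lim:
  assumes \<pi>: "\<pi> \<in> representations (cuntz_krieger_algebra A) H" and X: "X \<in> ck_Cauchy A"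
  shows "op_lim (\<lambda>n. \<pi> (ck_class A (\<lambda>k. X n))) (\<pi> (ck_class A X))"
  unfolding op_lim_def
proof (intro conjI allI LIMSEQ_I)
  let ?A = "cuntz_krieger_algebra A"
  note \<pi>D = representationsD[OF \<pi>]
  show cl: "\<pi> (ck_class A (\<lambda>k. X n)) \<in> bounded_ops H" "\<pi> (ck_class A X) \<in> bounded_ops H" for n
    using X by (simp_all add: \<pi>D)
  fix e :: real assume e: "e > 0"
  then obtain K where K: "\<forall>m\<ge>K. \<forall>n\<ge>K. ck_norm A (X m - X n) < e / 2"
    using ck_CauchyD[OF X, of "e / 2"] by auto
  have "op_norm H (opsub (\<pi> (ck_class A (\<lambda>k. X m))) (\<pi> (ck_class A X))) \<le> e / 2" if m: "m \<ge> K" for m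
  proof -
    note sh = ck_class_shift[OF X, of K]
    have mX: "(\<lambda>n. poly_scale (-1) (X (n + K))) \<in> ck_Cauchy A"
      using ck_Cauchy_scale[OF sh(1)] .
    have dX: "(\<lambda>n. X m - X (n + K)) \<in> ck_Cauchy A"
      using ck_Cauchy_add[OF ck_Cauchy_const mX] by (simp add: poly_scale_minus_one)
    have "ck_class A (\<lambda>k. X m) \<oplus>\<^bsub>?A\<^esub> cscale ?A (-1) (ck_class A X) = ck_class A (\<lambda>n. X m - X (n + K))"
      unfolding sh(2) using sh(1) mX by (simp add: ck_class_add ck_class_scale poly_scale_minus_one)
    then have "opsub (\<pi> (ck_class A (\<lambda>k. X m))) (\<pi> (ck_class A X)) = \<pi> (ck_class A (\<lambda>n. X m - X (n + K)))"
      using X by (simp flip: \<pi>D)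
    moreover have "op_norm H (\<pi> (ck_class A (\<lambda>n. X m - X (n + K)))) \<le> e / 2"
      using K m by (intro op_norm_representation_le[OF \<pi> dX]) (auto intro: less_imp_le)
    ultimately show ?thesis by simp
  qed
  then show "\<exists>K. \<forall>n\<ge>K. norm (op_norm H (opsub (\<pi> (ck_class A (\<lambda>k. X n))) (\<pi> (ck_class A X))) - 0) < e"
    using cl e by (intro exI[of _ K]) fastforce
qed

lemma representation_unique:
  assumes \<pi>: "\<pi> \<in> representations (cuntz_krieger_algebra A) H"
    and \<rho>: "\<rho> \<in> representations (cuntz_krieger_algebra A) H"
    and gen: "\<And>i. \<pi> (ck_gen A i) = \<rho> (ck_gen A i)"
  shows "\<pi> = \<rho>"
proof (rule extensionalityI[of _ "carrier (cuntz_krieger_algebra A)"])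
  show "\<pi> \<in> extensional (carrier (cuntz_krieger_algebra A))"
    "\<rho> \<in> extensional (carrier (cuntz_krieger_algebra A))"
    using \<pi> \<rho> by (auto simp: representations_def)
  fix a assume "a \<in> carrier (cuntz_krieger_algebra A)"
  then obtain X where X: "X \<in> ck_Cauchy A" "a = ck_class A X" by (rule ck_carrierE)
  have "(\<lambda>p. \<pi> (ck_class A (\<lambda>n. p))) = (\<lambda>p. \<rho> (ck_class A (\<lambda>n. p)))"
    using gen by (intro star_poly_rep_unique representation_star_poly_rep \<pi> \<rho>) (simp add: ck_gen_def)
  then have eq: "\<pi> (ck_class A (\<lambda>n. p)) = \<rho> (ck_class A (\<lambda>n. p))" for p
    by (rule fun_cong)
  have "op_lim (\<lambda>n. \<rho> (ck_class A (\<lambda>k. X n))) (\<pi> (ck_class A X))"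
    using representation_op_lim[OF \<pi> X(1)] unfolding eq .
  then show "\<pi> a = \<rho> a"
    unfolding X(2) using representation_op_lim[OF \<rho> X(1)] by (rule op_lim_unique)
qed

section \<open>Existence of the representation\<close>

text \<open>A representation \<open>\<phi>\<close> of the free *-algebra that kills the relators is contractive for \<open>ck_norm\<close>,
  so it extends to the completion by limits.\<close>

lemma representation_exists:
  fixes A :: "nat ^ 'n::finite ^ 'n"
  assumes \<phi>: "star_poly_rep H \<phi>" and vanish: "\<And>r. r \<in> ck_relators A \<Longrightarrow> \<phi> r = \<zero>\<^bsub>\<BB>\<^esub>"
  shows "\<exists>\<pi>\<in>representations (cuntz_krieger_algebra A) H. \<forall>p. \<pi> (ck_class A (\<lambda>n. p)) = \<phi> p"
proof -
  let ?A = "cuntz_krieger_algebra A"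
  interpret \<phi>: star_poly_rep H \<phi> by fact
  have le: "op_norm H (\<phi> p) \<le> ck_norm A p" for p
    using vanish by (rule \<phi>.op_norm_le_ck_norm)
  define \<pi> where "\<pi> = (\<lambda>a\<in>carrier ?A. THE S. op_lim (\<lambda>n. \<phi> (rep a n)) S)"
  have lim: "op_lim (\<lambda>n. \<phi> (X n)) (\<pi> (ck_class A X))" if X: "X \<in> ck_Cauchy A" for X
  proof -
    let ?R = "rep (ck_class A X)"
    note R = rep_ck_class[OF X]
    obtain S where S: "op_lim (\<lambda>n. \<phi> (X n)) S"
    proof -
      have "\<exists>S. op_lim (\<lambda>n. \<phi> (X n)) S"
      proof (rule op_complete)
        fix e :: real assume "e > 0"
        then obtain K where K: "\<forall>m\<ge>K. \<forall>n\<ge>K. ck_norm A (X m - X n) < e"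
          using ck_CauchyD[OF X] by blast
        show "\<exists>K. \<forall>m\<ge>K. \<forall>n\<ge>K. op_norm H (opsub (\<phi> (X m)) (\<phi> (X n))) < e"
          unfolding \<phi>.diff[symmetric] using K le by (meson le_less_trans)
      qed simp
      then show thesis using that by blast
    qed
    have "op_lim (\<lambda>n. \<phi> (?R n)) S"
    proof (rule op_limI)
      show "(\<lambda>n. ck_norm A (X n - ?R n) + op_norm H (opsub (\<phi> (X n)) S)) \<longlonglongrightarrow> 0"
        using tendsto_add[OF ck_relD(3)[OF R], of "\<lambda>n. op_norm H (opsub (\<phi> (X n)) S)" 0] S
        by (simp add: op_lim_def)
      fix n
      have "op_norm H (opsub (\<phi> (?R n)) S)
          \<le> op_norm H (opsub (\<phi> (?R n)) (\<phi> (X n))) + op_norm H (opsub (\<phi> (X n)) S)"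
        using S by (intro op_norm_opsub_triangle) (auto simp: op_lim_def)
      also have "op_norm H (opsub (\<phi> (?R n)) (\<phi> (X n))) \<le> ck_norm A (X n - ?R n)"
        using le[of "?R n - X n"] by (simp add: \<phi>.diff ck_norm_minus_commute)
      finally show "op_norm H (opsub (\<phi> (?R n)) S)
          \<le> ck_norm A (X n - ?R n) + op_norm H (opsub (\<phi> (X n)) S)" by simp
    qed (use S in \<open>auto simp: op_lim_def\<close>)
    then have "\<pi> (ck_class A X) = S"
      using X op_lim_unique by (auto simp: \<pi>_def intro!: the_equality)
    with S show ?thesis by simp
  qed
  have eqI: "\<pi> (ck_class A X) = S" if "X \<in> ck_Cauchy A" "op_lim (\<lambda>n. \<phi> (X n)) S" for X S
    using op_lim_unique lim that by blast
  have const: "\<pi> (ck_class A (\<lambda>n. p)) = \<phi> p" for p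
    by (intro eqI op_lim_const) auto
  have closed: "\<pi> a \<in> bounded_ops H" if "a \<in> carrier ?A" for a
    using that lim by (auto elim!: ck_carrierE simp: op_lim_def)
  have "\<pi> \<in> ring_hom ?A \<BB>"
  proof (rule ring_hom_memI)
    fix a b assume "a \<in> carrier ?A" "b \<in> carrier ?A"
    then obtain X Y where XY: "X \<in> ck_Cauchy A" "Y \<in> ck_Cauchy A" "a = ck_class A X" "b = ck_class A Y"
      by (metis ck_carrierE)
    then show "\<pi> (a \<otimes>\<^bsub>?A\<^esub> b) = \<pi> a \<otimes>\<^bsub>\<BB>\<^esub> \<pi> b" "\<pi> (a \<oplus>\<^bsub>?A\<^esub> b) = \<pi> a \<oplus>\<^bsub>\<BB>\<^esub> \<pi> b"
      by (auto simp: ck_class_mult ck_class_add \<phi>.mult \<phi>.add ck_Cauchy_mult ck_Cauchy_add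
          intro!: eqI op_lim_mult op_lim_add lim)
  qed (auto simp: closed operator_algebra_simps(1) ck_one const \<phi>.one)
  moreover have "\<pi> (cscale ?A c a) = cscale \<BB> c (\<pi> a)" "\<pi> (star ?A a) = star \<BB> (\<pi> a)"
    if "a \<in> carrier ?A" for c a
  proof -
    obtain X where X: "X \<in> ck_Cauchy A" "a = ck_class A X" using \<open>a \<in> carrier ?A\<close> by (rule ck_carrierE)
    then show "\<pi> (cscale ?A c a) = cscale \<BB> c (\<pi> a)" "\<pi> (star ?A a) = star \<BB> (\<pi> a)"
      by (auto simp: ck_class_scale ck_class_star \<phi>.scale \<phi>.star ck_Cauchy_scale ck_Cauchy_star
          intro!: eqI op_lim_scale op_lim_star lim)
  qed
  ultimately have "\<pi> \<in> representations ?A H"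
    by (auto simp: representations_def star_hom_def \<pi>_def)
  with const show ?thesis by blast
qed

text \<open>The universal property of the Cuntz--Krieger algebra.\<close>

theorem ex1_representation:
  fixes A :: "nat ^ 'n::finite ^ 'n"
  assumes T: "\<And>i. T i \<in> bounded_ops H"
    and partial_isometry: "\<And>i. T i \<otimes>\<^bsub>\<BB>\<^esub> star \<BB> (T i) \<otimes>\<^bsub>\<BB>\<^esub> T i = T i"
    and source: "\<And>i. star \<BB> (T i) \<otimes>\<^bsub>\<BB>\<^esub> T i
      = (\<Oplus>\<^bsub>\<BB>\<^esub>j\<in>UNIV. cscale \<BB> (of_nat (A $ i $ j)) (T j \<otimes>\<^bsub>\<BB>\<^esub> star \<BB> (T j)))"
    and range: "(\<Oplus>\<^bsub>\<BB>\<^esub>i\<in>UNIV. T i \<otimes>\<^bsub>\<BB>\<^esub> star \<BB> (T i)) = \<one>\<^bsub>\<BB>\<^esub>"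
  shows "\<exists>!\<pi>. \<pi> \<in> representations (cuntz_krieger_algebra A) H \<and> (\<forall>i. \<pi> (ck_gen A i) = T i)"
proof -
  interpret ev: star_poly_rep H "poly_op T" using T by (rule star_poly_rep_poly_op)
  have "\<exists>\<pi>\<in>representations (cuntz_krieger_algebra A) H. \<forall>p. \<pi> (ck_class A (\<lambda>n. p)) = poly_op T p"
    using partial_isometry source range
    by (intro representation_exists ev.star_poly_rep_axioms ev.relators_vanish)
      (simp_all add: poly_op_gen[OF T])
  then obtain \<pi> where "\<pi> \<in> representations (cuntz_krieger_algebra A) H" "\<And>i. \<pi> (ck_gen A i) = T i"
    by (auto simp: ck_gen_def poly_op_gen[OF T])
  then show ?thesis
    by (intro ex1I[of _ \<pi>]) (auto intro: representation_unique)
qed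

end


section \<open>Square integrable functions and their classes\<close>

lemma sq_integrable_measurable: "f \<in> sq_integrable M \<Longrightarrow> f \<in> borel_measurable M"
  by (simp add: sq_integrable_def)

lemma sq_integrable_iff:
  "f \<in> sq_integrable M \<longleftrightarrow>
    f \<in> borel_measurable M \<and> (\<integral>\<^sup>+x. ennreal ((cmod (f x))\<^sup>2) \<partial>M) < \<infinity>"
  by (auto simp: sq_integrable_def integrable_iff_bounded)

lemma sq_integrable_dominated:
  assumes "f \<in> sq_integrable M" "g \<in> borel_measurable M"
    and le: "(\<integral>\<^sup>+x. ennreal ((cmod (g x))\<^sup>2) \<partial>M) \<le> (\<integral>\<^sup>+x. ennreal ((cmod (f x))\<^sup>2) \<partial>M)"
  shows "g \<in> sq_integrable M"
  using assms(1,2) le_less_trans[OF le] by (simp add: sq_integrable_iff)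

lemma sq_integrable_add [simp]:
  assumes f: "f \<in> sq_integrable M" and g: "g \<in> sq_integrable M"
  shows "(\<lambda>x. f x + g x) \<in> sq_integrable M"
proof -
  note [measurable] = sq_integrable_measurable[OF f] sq_integrable_measurable[OF g]
  have "integrable M (\<lambda>x. 2 * (cmod (f x))\<^sup>2 + 2 * (cmod (g x))\<^sup>2)"
    using f g by (auto simp: sq_integrable_def)
  then have "integrable M (\<lambda>x. (cmod (f x + g x))\<^sup>2)"
  proof (rule Bochner_Integration.integrable_bound[OF _ _ AE_I2])
    show "(\<lambda>x. (cmod (f x + g x))\<^sup>2) \<in> borel_measurable M" by measurable
    fix x
    have "(cmod (f x + g x))\<^sup>2 \<le> (cmod (f x) + cmod (g x))\<^sup>2"
      by (intro power_mono norm_triangle_ineq) auto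
    also have "\<dots> \<le> 2 * (cmod (f x))\<^sup>2 + 2 * (cmod (g x))\<^sup>2"
      using zero_le_power2[of "cmod (f x) - cmod (g x)"] by (simp add: power2_sum power2_diff)
    finally show "norm ((cmod (f x + g x))\<^sup>2) \<le> norm (2 * (cmod (f x))\<^sup>2 + 2 * (cmod (g x))\<^sup>2)"
      by simp
  qed
  then show ?thesis by (simp add: sq_integrable_def)
qed

lemma sq_integrable_scale [simp]:
  assumes f: "f \<in> sq_integrable M"
  shows "(\<lambda>x. c * f x) \<in> sq_integrable M"
proof -
  note [measurable] = sq_integrable_measurable[OF f]
  have "integrable M (\<lambda>x. (cmod c)\<^sup>2 * (cmod (f x))\<^sup>2)"
    using f by (auto simp: sq_integrable_def)
  then show ?thesis by (simp add: sq_integrable_def norm_mult power_mult_distrib)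
qed

lemma sq_integrable_diff [simp]:
  assumes "f \<in> sq_integrable M" "g \<in> sq_integrable M"
  shows "(\<lambda>x. f x - g x) \<in> sq_integrable M"
  using sq_integrable_add[OF assms(1) sq_integrable_scale[OF assms(2), of "-1"]] by simp

lemma sq_integrable_zero [simp]: "(\<lambda>x. 0) \<in> sq_integrable M"
  by (simp add: sq_integrable_def)

lemma integrable_inner [simp]:
  assumes f: "f \<in> sq_integrable M" and g: "g \<in> sq_integrable M"
  shows "integrable M (\<lambda>x. f x * cnj (g x))"
proof -
  note [measurable] = sq_integrable_measurable[OF f] sq_integrable_measurable[OF g]
  have "integrable M (\<lambda>x. (cmod (f x))\<^sup>2 + (cmod (g x))\<^sup>2)"
    using f g by (auto simp: sq_integrable_def)
  then show ?thesis
  proof (rule Bochner_Integration.integrable_bound[OF _ _ AE_I2])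
    have "cnj \<in> borel_measurable borel"
      by (intro borel_measurable_continuous_onI continuous_intros)
    from measurable_compose[OF sq_integrable_measurable[OF g] this]
    show "(\<lambda>x. f x * cnj (g x)) \<in> borel_measurable M" by measurable
    fix x
    have "0 \<le> (cmod (f x) - cmod (g x))\<^sup>2 + (cmod (f x))\<^sup>2 + (cmod (g x))\<^sup>2" by simp
    then show "norm (f x * cnj (g x)) \<le> norm ((cmod (f x))\<^sup>2 + (cmod (g x))\<^sup>2)"
      by (simp add: power2_diff norm_mult)
  qed
qed

lemma nn_integral_sq:
  assumes f: "f \<in> sq_integrable M"
  shows "(\<integral>\<^sup>+x. ennreal ((cmod (f x))\<^sup>2) \<partial>M) = ennreal (\<integral>x. (cmod (f x))\<^sup>2 \<partial>M)"
  using f by (intro nn_integral_eq_integral) (auto simp: sq_integrable_def)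


lemma equiv_ae_rel: "equiv (sq_integrable M) (ae_rel M)"
proof (rule equivI)
  show "ae_rel M \<subseteq> sq_integrable M \<times> sq_integrable M" by (auto simp: ae_rel_def)
  show "refl_on (sq_integrable M) (ae_rel M)" by (auto simp: refl_on_def ae_rel_def)
  show "sym (ae_rel M)" by (auto simp: sym_def ae_rel_def)
  show "trans (ae_rel M)"
  proof (rule transI)
    fix f g h assume "(f, g) \<in> ae_rel M" "(g, h) \<in> ae_rel M"
    then show "(f, h) \<in> ae_rel M" by (auto simp: ae_rel_def)
  qed
qed

lemma L2_class_eq_iff:
  assumes "f \<in> sq_integrable M" "g \<in> sq_integrable M"
  shows "L2_class M f = L2_class M g \<longleftrightarrow> (AE x in M. f x = g x)"
  using eq_equiv_class_iff[OF equiv_ae_rel assms] assms by (simp add: ae_rel_def)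

lemma L2_classI [simp]: "f \<in> sq_integrable M \<Longrightarrow> L2_class M f \<in> carrier (L2 M)"
  by (auto simp: L2_def intro: quotientI)

lemma L2_carrierE:
  assumes "u \<in> carrier (L2 M)"
  obtains f where "f \<in> sq_integrable M" "u = L2_class M f"
  using assms by (auto simp: L2_def elim: quotientE)

lemma rep_L2_class:
  assumes f: "f \<in> sq_integrable M"
  shows "rep (L2_class M f) \<in> sq_integrable M" "AE x in M. rep (L2_class M f) x = f x"
proof -
  have "f \<in> L2_class M f" using equiv_class_self[OF equiv_ae_rel f] .
  then have "rep (L2_class M f) \<in> L2_class M f"
    unfolding rep_def by (rule someI[of "\<lambda>g. g \<in> L2_class M f"])
  then show "rep (L2_class M f) \<in> sq_integrable M" "AE x in M. rep (L2_class M f) x = f x"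
    by (auto simp: ae_rel_def)
qed

lemma L2_class_rep:
  assumes "u \<in> carrier (L2 M)"
  shows "rep u \<in> sq_integrable M" "L2_class M (rep u) = u"
proof -
  obtain f where f: "f \<in> sq_integrable M" "u = L2_class M f" using assms by (rule L2_carrierE)
  then show 1: "rep u \<in> sq_integrable M" using rep_L2_class(1) by blast
  show "L2_class M (rep u) = u"
    unfolding f(2) using rep_L2_class[OF f(1)] f(1) by (subst L2_class_eq_iff) auto
qed

lemma L2_zero: "vzero (L2 M) = L2_class M (\<lambda>x. 0)"
  by (simp add: L2_def)

lemma L2_add:
  assumes f: "f \<in> sq_integrable M" and g: "g \<in> sq_integrable M"
  shows "vadd (L2 M) (L2_class M f) (L2_class M g) = L2_class M (\<lambda>x. f x + g x)"
proof -
  have "AE x in M. rep (L2_class M f) x + rep (L2_class M g) x = f x + g x"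
    using rep_L2_class(2)[OF f] rep_L2_class(2)[OF g] by eventually_elim simp
  then show ?thesis
    using f g by (simp add: L2_def L2_class_eq_iff rep_L2_class(1))
qed

lemma L2_scale:
  assumes f: "f \<in> sq_integrable M"
  shows "vscale (L2 M) c (L2_class M f) = L2_class M (\<lambda>x. c * f x)"
proof -
  have "AE x in M. c * rep (L2_class M f) x = c * f x"
    using rep_L2_class(2)[OF f] by eventually_elim simp
  then show ?thesis
    using f by (simp add: L2_def L2_class_eq_iff rep_L2_class(1) del: mult_cancel_left)
qed

lemma L2_inner:
  assumes f: "f \<in> sq_integrable M" and g: "g \<in> sq_integrable M"
  shows "vinner (L2 M) (L2_class M f) (L2_class M g) = (\<integral>x. f x * cnj (g x) \<partial>M)"
proof -
  note [measurable] = sq_integrable_measurable[OF f] sq_integrable_measurable[OF g]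
    sq_integrable_measurable[OF rep_L2_class(1)[OF f]] sq_integrable_measurable[OF rep_L2_class(1)[OF g]]
  have "AE x in M. rep (L2_class M f) x * cnj (rep (L2_class M g) x) = f x * cnj (g x)"
    using rep_L2_class(2)[OF f] rep_L2_class(2)[OF g] by eventually_elim simp
  then have "(\<integral>x. rep (L2_class M f) x * cnj (rep (L2_class M g) x) \<partial>M) = (\<integral>x. f x * cnj (g x) \<partial>M)"
    using f g by (intro integral_cong_AE borel_measurable_integrable integrable_inner rep_L2_class(1))
  then show ?thesis by (simp add: L2_def)
qed

lemma L2_norm:
  assumes f: "f \<in> sq_integrable M"
  shows "vnorm (L2 M) (L2_class M f) = sqrt (\<integral>x. (cmod (f x))\<^sup>2 \<partial>M)"
proof -
  have "vinner (L2 M) (L2_class M f) (L2_class M f) = (\<integral>x. of_real ((cmod (f x))\<^sup>2) \<partial>M)"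
    unfolding L2_inner[OF f f] complex_norm_square ..
  also have "\<dots> = of_real (\<integral>x. (cmod (f x))\<^sup>2 \<partial>M)"
    by (rule integral_complex_of_real)
  finally show ?thesis by (simp add: vnorm_def del: of_real_power)
qed


section \<open>Completeness of the space of square integrable functions\<close>

text \<open>The terms of the convergent series are bounded, so \<open>\<bar>g (j+1) - g j\<bar>\<close> is at most a constant times
  \<open>2\<^sup>-\<^sup>j\<close>.\<close>

lemma convergent_if_summable_weighted_sq:
  fixes g :: "nat \<Rightarrow> complex"
  assumes fin: "(suminf (\<lambda>j. ennreal (4 ^ j * (cmod (g (Suc j) - g j))\<^sup>2))) \<noteq> \<infinity>"
  shows "convergent g"
proof -
  define F where "F j = ennreal (4 ^ j * (cmod (g (Suc j) - g j))\<^sup>2)" for j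
  define C where "C = enn2real (suminf F)"
  have C: "suminf F = ennreal C"
    using fin unfolding F_def[symmetric] C_def by (simp add: ennreal_enn2real_if)
  have bd: "cmod (g (Suc j) - g j) \<le> sqrt C * (1/2) ^ j" for j
  proof -
    have "sum F {j} \<le> suminf F"
      by (rule sum_le_suminf[OF summableI]) auto
    then have "ennreal (4 ^ j * (cmod (g (Suc j) - g j))\<^sup>2) \<le> ennreal C"
      by (simp add: C F_def[of j])
    then have "4 ^ j * (cmod (g (Suc j) - g j))\<^sup>2 \<le> C"
      by (subst (asm) ennreal_le_iff) (auto simp: C_def)
    moreover have "(4 :: real) ^ j = (2 ^ j)\<^sup>2"
      by (simp add: power2_eq_square flip: power_mult_distrib)
    ultimately have "(2 ^ j * cmod (g (Suc j) - g j))\<^sup>2 \<le> C"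
      by (simp add: power_mult_distrib)
    then have "2 ^ j * cmod (g (Suc j) - g j) \<le> sqrt C"
      by (rule real_le_rsqrt)
    then show ?thesis by (simp add: field_simps power_divide)
  qed
  have "summable (\<lambda>j. g (Suc j) - g j)"
  proof (rule summable_comparison_test'[of "\<lambda>j. sqrt C * (1/2) ^ j"])
    show "summable (\<lambda>j. sqrt C * (1/2) ^ j)"
      by (intro summable_mult summable_geometric) simp
  qed (rule bd)
  then have "(\<lambda>n. \<Sum>j<n. g (Suc j) - g j) \<longlonglongrightarrow> (suminf (\<lambda>j. g (Suc j) - g j))"
    by (rule summable_LIMSEQ)
  then have "(\<lambda>n. g n - g 0) \<longlonglongrightarrow> (suminf (\<lambda>j. g (Suc j) - g j))"
    by (simp add: sum_lessThan_telescope)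
  then have "(\<lambda>n. g n - g 0 + g 0) \<longlonglongrightarrow> (suminf (\<lambda>j. g (Suc j) - g j)) + g 0"
    by (intro tendsto_intros)
  then show ?thesis by (auto simp: convergent_def)
qed

text \<open>Along a subsequence \<open>k\<close> with \<open>\<integral>\<bar>f (k (j+1)) - f (k j)\<bar>\<^sup>2 \<le> 16\<^sup>-\<^sup>j\<close>, the weighted sum
  \<open>\<Sum>j. 4\<^sup>j \<bar>f (k (j+1)) - f (k j)\<bar>\<^sup>2\<close> has finite integral, so it is finite almost everywhere and the
  subsequence converges there. Fatou's lemma turns this into convergence in mean square.\<close>

lemma Riesz_Fischer:
  fixes f :: "nat \<Rightarrow> 'a \<Rightarrow> complex"
  assumes f: "\<And>n. f n \<in> sq_integrable M"
    and Cauchy: "\<And>e. e > 0 \<Longrightarrow> \<exists>K. \<forall>m\<ge>K. \<forall>n\<ge>K.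
      (\<integral>\<^sup>+x. ennreal ((cmod (f m x - f n x))\<^sup>2) \<partial>M) \<le> ennreal e"
  shows "\<exists>g\<in>sq_integrable M. \<forall>e>0. \<exists>K. \<forall>n\<ge>K.
      (\<integral>\<^sup>+x. ennreal ((cmod (f n x - g x))\<^sup>2) \<partial>M) \<le> ennreal e"
proof -
  note [measurable] = sq_integrable_measurable[OF f]
  let ?d = "\<lambda>m n. \<integral>\<^sup>+x. ennreal ((cmod (f m x - f n x))\<^sup>2) \<partial>M"
  obtain k' where k': "\<And>j m n. \<lbrakk>m \<ge> k' j; n \<ge> k' j\<rbrakk> \<Longrightarrow> ?d m n \<le> ennreal ((1/16) ^ j)"
  proof -
    have "\<forall>j. \<exists>K. \<forall>m\<ge>K. \<forall>n\<ge>K. ?d m n \<le> ennreal ((1/16) ^ j)"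
      by (intro allI Cauchy) simp
    then show thesis using that by metis
  qed
  \<comment> \<open>\<open>k j\<close> and \<open>k (j + 1)\<close> are both at least \<open>k' j\<close>, and \<open>k\<close> tends to infinity.\<close>
  define k where "k j = j + (\<Sum>i\<le>j. k' i)" for j
  have k: "k j \<ge> k' j" "k (Suc j) \<ge> k' j" "k j \<ge> j" for j
    using member_le_sum[of j "{..j}" k'] by (auto simp: k_def)
  define g where "g x = lim (\<lambda>j. f (k j) x)" for x
  have [measurable]: "g \<in> borel_measurable M"
    unfolding g_def by measurable
  have "(\<integral>\<^sup>+x. (suminf (\<lambda>j. ennreal (4 ^ j * (cmod (f (k (Suc j)) x - f (k j) x))\<^sup>2))) \<partial>M)
      = (suminf (\<lambda>j. \<integral>\<^sup>+x. ennreal (4 ^ j * (cmod (f (k (Suc j)) x - f (k j) x))\<^sup>2) \<partial>M))"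
    by (rule nn_integral_suminf) measurable
  also have "\<dots> \<le> (suminf (\<lambda>j. ennreal ((1/4) ^ j)))"
  proof (rule suminf_le[OF _ summableI summableI])
    fix j
    have "(\<integral>\<^sup>+x. ennreal (4 ^ j * (cmod (f (k (Suc j)) x - f (k j) x))\<^sup>2) \<partial>M)
        = ennreal (4 ^ j) * ?d (k (Suc j)) (k j)"
      by (subst nn_integral_cmult[symmetric]) (auto simp: ennreal_mult)
    also have "\<dots> \<le> ennreal (4 ^ j) * ennreal ((1/16) ^ j)"
      using k by (intro mult_left_mono k') auto
    also have "\<dots> = ennreal ((1/4) ^ j)"
      by (simp add: ennreal_mult[symmetric] power_mult_distrib[symmetric])
    finally show "(\<integral>\<^sup>+x. ennreal (4 ^ j * (cmod (f (k (Suc j)) x - f (k j) x))\<^sup>2) \<partial>M)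
        \<le> ennreal ((1/4) ^ j)" .
  qed
  also have "\<dots> < \<infinity>"
  proof -
    have "(suminf (\<lambda>j. ennreal ((1/4) ^ j))) \<noteq> \<infinity>"
      unfolding infinity_ennreal_def by (intro ennreal_suminf_neq_top summable_geometric) auto
    then show ?thesis by (simp add: less_top[symmetric])
  qed
  finally have "AE x in M. (suminf (\<lambda>j. ennreal (4 ^ j * (cmod (f (k (Suc j)) x - f (k j) x))\<^sup>2))) \<noteq> \<infinity>"
    by (intro nn_integral_noteq_infinite) auto
  then have lim: "AE x in M. (\<lambda>j. f (k j) x) \<longlonglongrightarrow> g x"
  proof eventually_elim
    case (elim x)
    then have "convergent (\<lambda>j. f (k j) x)" by (rule convergent_if_summable_weighted_sq)
    then show ?case by (simp add: g_def convergent_LIMSEQ_iff)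
  qed
  have le: "(\<integral>\<^sup>+x. ennreal ((cmod (f n x - g x))\<^sup>2) \<partial>M) \<le> ennreal e"
    if K: "\<forall>m\<ge>K. \<forall>n\<ge>K. ?d m n \<le> ennreal e" and n: "n \<ge> K" for e K n
  proof -
    have "(\<integral>\<^sup>+x. ennreal ((cmod (f n x - g x))\<^sup>2) \<partial>M)
        = (\<integral>\<^sup>+x. liminf (\<lambda>j. ennreal ((cmod (f n x - f (k j) x))\<^sup>2)) \<partial>M)"
    proof (rule nn_integral_cong_AE, use lim in eventually_elim)
      case (elim x)
      have "(\<lambda>j. ennreal ((cmod (f n x - f (k j) x))\<^sup>2)) \<longlonglongrightarrow> ennreal ((cmod (f n x - g x))\<^sup>2)"
        using elim by (intro tendsto_ennrealI tendsto_intros)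
      then show ?case by (rule lim_imp_Liminf[OF sequentially_bot, symmetric])
    qed
    also have "\<dots> \<le> liminf (\<lambda>j. ?d n (k j))"
      by (rule nn_integral_liminf) measurable
    also have "\<dots> \<le> liminf (\<lambda>j. ennreal e)"
    proof (rule Liminf_mono, rule eventually_sequentiallyI[of K])
      fix j assume "K \<le> j"
      then have "K \<le> k j" using k(3)[of j] by simp
      then show "?d n (k j) \<le> ennreal e" using K n by blast
    qed
    also have "\<dots> = ennreal e" by (simp add: Liminf_const)
    finally show ?thesis .
  qed
  obtain K where K: "\<forall>m\<ge>K. \<forall>n\<ge>K. ?d m n \<le> ennreal 1" using Cauchy[of 1] by auto
  have "(\<lambda>x. f K x - g x) \<in> sq_integrable M"
    unfolding sq_integrable_iff using le_less_trans[OF le[OF K order_refl] ennreal_less_top] by simp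
  then have "(\<lambda>x. f K x - (f K x - g x)) \<in> sq_integrable M"
    by (rule sq_integrable_diff[OF f])
  moreover have "(\<lambda>x. f K x - (f K x - g x)) = g" by auto
  ultimately have "g \<in> sq_integrable M" by (simp only:)
  moreover have "\<exists>K. \<forall>n\<ge>K. (\<integral>\<^sup>+x. ennreal ((cmod (f n x - g x))\<^sup>2) \<partial>M) \<le> ennreal e" if "e > 0" for e
    using Cauchy[OF that] le by blast
  ultimately show ?thesis by blast
qed

lemma L2_vsub_norm:
  assumes f: "f \<in> sq_integrable M" and g: "g \<in> sq_integrable M"
  shows "vnorm (L2 M) (vadd (L2 M) (L2_class M f) (vscale (L2 M) (-1) (L2_class M g)))
    = sqrt (\<integral>x. (cmod (f x - g x))\<^sup>2 \<partial>M)"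
proof -
  have "vadd (L2 M) (L2_class M f) (vscale (L2 M) (-1) (L2_class M g)) = L2_class M (\<lambda>x. f x + (-1) * g x)"
    using f g by (simp only: L2_scale L2_add sq_integrable_scale)
  then show ?thesis using f g by (simp add: L2_norm)
qed

theorem hilbert_carrier_L2: "hilbert_carrier (L2 M)"
proof
  show "vzero (L2 M) \<in> carrier (L2 M)" by (simp add: L2_zero)
  fix u v w c assume u: "u \<in> carrier (L2 M)"
  then obtain f where f: "f \<in> sq_integrable M" "u = L2_class M f" by (rule L2_carrierE)
  note [measurable] = sq_integrable_measurable[OF f(1)]
  show "vscale (L2 M) c u \<in> carrier (L2 M)" using f by (simp add: L2_scale)
  show "vinner (L2 M) (vzero (L2 M)) u = 0" using f by (simp add: L2_zero L2_inner)
  show "0 \<le> Re (vinner (L2 M) u u)"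
    using f L2_norm[OF f(1)] by (simp add: L2_inner complex_norm_square[symmetric] flip: of_real_power)
  assume v: "v \<in> carrier (L2 M)"
  then obtain g where g: "g \<in> sq_integrable M" "v = L2_class M g" by (rule L2_carrierE)
  note [measurable] = sq_integrable_measurable[OF g(1)]
  show "vadd (L2 M) u v \<in> carrier (L2 M)" using f g by (simp add: L2_add)
  show "vinner (L2 M) (vscale (L2 M) c u) v = c * vinner (L2 M) u v"
    using f g by (simp add: L2_scale L2_inner mult.assoc)
  show "vinner (L2 M) v u = cnj (vinner (L2 M) u v)"
  proof -
    have "cnj (vinner (L2 M) u v) = (\<integral>x. cnj (f x * cnj (g x)) \<partial>M)"
      unfolding f(2) g(2) L2_inner[OF f(1) g(1)] by (rule Bochner_Integration.integral_cnj[symmetric])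
    also have "\<dots> = vinner (L2 M) v u"
      using f g by (simp add: L2_inner mult.commute)
    finally show ?thesis ..
  qed
  { assume "w \<in> carrier (L2 M)"
    then obtain h where h: "h \<in> sq_integrable M" "w = L2_class M h" by (rule L2_carrierE)
    then show "vinner (L2 M) (vadd (L2 M) u v) w = vinner (L2 M) u w + vinner (L2 M) v w"
      using f g by (simp add: L2_add L2_inner distrib_right) }
  { assume eq: "\<And>z. z \<in> carrier (L2 M) \<Longrightarrow> vinner (L2 M) u z = vinner (L2 M) v z"
    let ?h = "\<lambda>x. f x - g x"
    have h: "?h \<in> sq_integrable M" using f g by simp
    have "(\<integral>x. f x * cnj (?h x) \<partial>M) - (\<integral>x. g x * cnj (?h x) \<partial>M) = 0"
      using eq[of "L2_class M ?h"] h f g by (simp add: L2_inner)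
    then have "(\<integral>x. f x * cnj (?h x) - g x * cnj (?h x) \<partial>M) = 0"
      by (simp only: Bochner_Integration.integral_diff[OF integrable_inner[OF f(1) h]
            integrable_inner[OF g(1) h]])
    moreover have "f x * cnj (?h x) - g x * cnj (?h x) = of_real ((cmod (?h x))\<^sup>2)" for x
      unfolding complex_norm_square by (simp add: algebra_simps)
    ultimately have "(\<integral>x. (cmod (?h x))\<^sup>2 \<partial>M) = 0"
      by (simp del: of_real_power)
    then have "AE x in M. (cmod (?h x))\<^sup>2 = 0"
      using h by (subst (asm) integral_nonneg_eq_0_iff_AE) (auto simp: sq_integrable_def)
    then show "u = v" using f g by (simp add: L2_class_eq_iff) }
next
  fix X :: "nat \<Rightarrow> ('a \<Rightarrow> complex) set"
  assume X: "\<And>n. X n \<in> carrier (L2 M)"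
    and Cauchy: "\<And>e. e > 0 \<Longrightarrow> \<exists>K. \<forall>m\<ge>K. \<forall>n\<ge>K.
      vnorm (L2 M) (vadd (L2 M) (X m) (vscale (L2 M) (-1) (X n))) < e"
  define f where "f n = rep (X n)" for n
  have f: "f n \<in> sq_integrable M" "X n = L2_class M (f n)" for n
    using L2_class_rep[OF X[of n]] by (auto simp: f_def)
  have norm: "(\<integral>\<^sup>+x. ennreal ((cmod (p x - q x))\<^sup>2) \<partial>M)
      = ennreal ((vnorm (L2 M) (vadd (L2 M) (L2_class M p) (vscale (L2 M) (-1) (L2_class M q))))\<^sup>2)"
    if "p \<in> sq_integrable M" "q \<in> sq_integrable M" for p q
    using that by (simp add: nn_integral_sq L2_vsub_norm)
  have nonneg: "0 \<le> vnorm (L2 M) (vadd (L2 M) (L2_class M p) (vscale (L2 M) (-1) (L2_class M q)))"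
    if "p \<in> sq_integrable M" "q \<in> sq_integrable M" for p q
    using that by (simp add: L2_vsub_norm)
  have "\<exists>g\<in>sq_integrable M. \<forall>e>0. \<exists>K. \<forall>n\<ge>K.
      (\<integral>\<^sup>+x. ennreal ((cmod (f n x - g x))\<^sup>2) \<partial>M) \<le> ennreal e"
  proof (rule Riesz_Fischer[OF f(1)])
    fix e :: real assume e: "e > 0"
    obtain K where K: "\<forall>m\<ge>K. \<forall>n\<ge>K. vnorm (L2 M) (vadd (L2 M) (X m) (vscale (L2 M) (-1) (X n))) < sqrt e"
      using Cauchy[of "sqrt e"] e by auto
    have "(\<integral>\<^sup>+x. ennreal ((cmod (f m x - f n x))\<^sup>2) \<partial>M) \<le> ennreal e" if "m \<ge> K" "n \<ge> K" for m n
    proof -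
      have "vnorm (L2 M) (vadd (L2 M) (L2_class M (f m)) (vscale (L2 M) (-1) (L2_class M (f n)))) < sqrt e"
        using K that by (simp flip: f(2))
      from power_mono[OF less_imp_le[OF this] nonneg[OF f(1) f(1)], of 2]
      show ?thesis using e by (simp add: norm f(1) ennreal_leI)
    qed
    then show "\<exists>K. \<forall>m\<ge>K. \<forall>n\<ge>K. (\<integral>\<^sup>+x. ennreal ((cmod (f m x - f n x))\<^sup>2) \<partial>M) \<le> ennreal e"
      by blast
  qed
  then obtain g where g: "g \<in> sq_integrable M" and lim: "\<And>e. e > 0 \<Longrightarrow> \<exists>K. \<forall>n\<ge>K.
      (\<integral>\<^sup>+x. ennreal ((cmod (f n x - g x))\<^sup>2) \<partial>M) \<le> ennreal e"
    by blast
  have "(\<lambda>n. vnorm (L2 M) (vadd (L2 M) (X n) (vscale (L2 M) (-1) (L2_class M g)))) \<longlonglongrightarrow> 0"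
  proof (rule LIMSEQ_I)
    fix r :: real assume r: "r > 0"
    obtain K where K: "\<forall>n\<ge>K. (\<integral>\<^sup>+x. ennreal ((cmod (f n x - g x))\<^sup>2) \<partial>M) \<le> ennreal ((r / 2)\<^sup>2)"
      using lim[of "(r / 2)\<^sup>2"] r by auto
    have "vnorm (L2 M) (vadd (L2 M) (X n) (vscale (L2 M) (-1) (L2_class M g))) \<le> r / 2" if "n \<ge> K" for n
    proof (rule power2_le_imp_le)
      have "ennreal ((vnorm (L2 M) (vadd (L2 M) (X n) (vscale (L2 M) (-1) (L2_class M g))))\<^sup>2)
          \<le> ennreal ((r / 2)\<^sup>2)"
        unfolding f(2) norm[OF f(1) g, symmetric] using K that by blast
      then show "(vnorm (L2 M) (vadd (L2 M) (X n) (vscale (L2 M) (-1) (L2_class M g))))\<^sup>2 \<le> (r / 2)\<^sup>2"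
        by simp
    qed (use r in simp)
    then show "\<exists>K. \<forall>n\<ge>K. norm (vnorm (L2 M) (vadd (L2 M) (X n) (vscale (L2 M) (-1) (L2_class M g))) - 0) < r"
      using r nonneg[OF f(1) g, folded f(2)] by (intro exI[of _ K]) fastforce
  qed
  then show "\<exists>x\<in>carrier (L2 M). (\<lambda>n. vnorm (L2 M) (vadd (L2 M) (X n) (vscale (L2 M) (-1) x))) \<longlonglongrightarrow> 0"
    using g by (intro bexI[of _ "L2_class M g"]) auto
qed


section \<open>Change of variables along the branches\<close>

lemma powr_neg_half: "0 < p \<Longrightarrow> p powr - (1/2) = 1 / sqrt p" for p :: real
  by (simp only: powr_minus powr_half_sqrt[OF less_imp_le] inverse_eq_divide)

text \<open>A semibranching function system with a coding map.\<close>

locale coded_branches = semibranching_function_system M D s \<Phi>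
  for M :: "'a measure" and D :: "'n::finite \<Rightarrow> 'a set" and s :: "'n \<Rightarrow> 'a \<Rightarrow> 'a"
    and \<Phi> :: "'n \<Rightarrow> 'a \<Rightarrow> real" +
  fixes \<sigma> :: "'a \<Rightarrow> 'a"
  assumes coding: "coding_map M D s \<sigma>"
begin

abbreviation R :: "'n \<Rightarrow> 'a set" where "R i \<equiv> s i ` D i"

text \<open>The Radon--Nikodym derivative extended by \<open>0\<close> to a measurable function on the whole space.\<close>

definition \<phi> :: "'n \<Rightarrow> 'a \<Rightarrow> real" where "\<phi> i y = indicator (D i) y * \<Phi> i y"

lemma coding_measurable [measurable]: "\<sigma> \<in> measurable M M"
  using coding by (simp add: coding_map_def)

lemma coding_branch [simp]: "x \<in> D i \<Longrightarrow> \<sigma> (s i x) = x"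
  using coding by (simp add: coding_map_def)

lemma domain_measurable [measurable]: "D i \<in> sets M" by (rule domain_sets)

lemma range_measurable [measurable]: "R i \<in> sets M" by (rule image_sets[OF domain_sets]) simp

lemma range_coding: "x \<in> R i \<Longrightarrow> \<sigma> x \<in> D i \<and> s i (\<sigma> x) = x"
  by auto

lemma \<phi>_measurable [measurable]: "\<phi> i \<in> borel_measurable M"
proof -
  have "(\<lambda>y. indicator (D i) y *\<^sub>R \<Phi> i y) \<in> borel_measurable M"
    using measurable_deriv[of i] by (subst (asm) borel_measurable_restrict_space_iff) auto
  then show ?thesis by (simp add: \<phi>_def[abs_def])
qed

lemma \<phi>_pos: "AE y in M. y \<in> D i \<longrightarrow> \<phi> i y > 0"
  using deriv_pos[of i] by eventually_elim (auto simp: \<phi>_def)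

lemma \<phi>_nonneg: "AE y in M. 0 \<le> \<phi> i y"
  using deriv_pos[of i] by eventually_elim (auto simp: \<phi>_def indicator_def)

lemma emeasure_branch:
  assumes "B \<in> sets M" "B \<subseteq> D i"
  shows "emeasure M (s i ` B) = (\<integral>\<^sup>+y. ennreal (\<phi> i y) * indicator B y \<partial>M)"
  unfolding deriv[OF assms] using assms(2)
  by (intro nn_integral_cong) (auto simp: \<phi>_def indicator_def)

text \<open>The push-forward of \<open>\<mu>\<close> restricted to the range \<open>R i\<close> under the coding map is \<open>\<phi> i \<mu>\<close>. All
  substitutions below, in either direction, rest on this: on \<open>R i\<close> the coding map is the inverse of
  \<open>s i\<close>.\<close>

lemma distr_coding:
  "distr (density M (indicator (R i))) M \<sigma> = density M (\<lambda>y. ennreal (\<phi> i y))"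
proof (rule measure_eqI)
  fix B assume "B \<in> sets (distr (density M (indicator (R i))) M \<sigma>)"
  then have B [measurable]: "B \<in> sets M" by simp
  have "emeasure (distr (density M (indicator (R i))) M \<sigma>) B
      = emeasure (density M (indicator (R i))) (\<sigma> -` B \<inter> space M)"
    by (subst emeasure_distr) auto
  also have "\<dots> = (\<integral>\<^sup>+x. indicator (R i) x * indicator (\<sigma> -` B \<inter> space M) x \<partial>M)"
    by (subst emeasure_density) auto
  also have "\<dots> = (\<integral>\<^sup>+x. indicator (s i ` (B \<inter> D i)) x \<partial>M)"
    using sets.sets_into_space[OF range_measurable[of i]]
    by (intro nn_integral_cong) (auto simp: indicator_def)
  also have "\<dots> = emeasure M (s i ` (B \<inter> D i))"
    by (intro nn_integral_indicator image_sets[of _ i]) auto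
  also have "\<dots> = (\<integral>\<^sup>+y. ennreal (\<phi> i y) * indicator (B \<inter> D i) y \<partial>M)"
    by (intro emeasure_branch) auto
  also have "\<dots> = (\<integral>\<^sup>+y. ennreal (\<phi> i y) * indicator B y \<partial>M)"
    by (intro nn_integral_cong) (auto simp: \<phi>_def indicator_def)
  also have "\<dots> = emeasure (density M (\<lambda>y. ennreal (\<phi> i y))) B"
    by (subst emeasure_density) auto
  finally show "emeasure (distr (density M (indicator (R i))) M \<sigma>) B
      = emeasure (density M (\<lambda>y. ennreal (\<phi> i y))) B" .
qed simp

lemma nn_integral_coding:
  assumes [measurable]: "h \<in> borel_measurable M"
  shows "(\<integral>\<^sup>+x. indicator (R i) x * h (\<sigma> x) \<partial>M) = (\<integral>\<^sup>+y. ennreal (\<phi> i y) * h y \<partial>M)"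
proof -
  have "(\<integral>\<^sup>+x. indicator (R i) x * h (\<sigma> x) \<partial>M) = (\<integral>\<^sup>+x. h (\<sigma> x) \<partial>density M (indicator (R i)))"
    by (subst nn_integral_density) auto
  also have "\<dots> = (\<integral>\<^sup>+y. h y \<partial>distr (density M (indicator (R i))) M \<sigma>)"
    by (subst nn_integral_distr) auto
  also have "\<dots> = (\<integral>\<^sup>+y. ennreal (\<phi> i y) * h y \<partial>M)"
    unfolding distr_coding by (subst nn_integral_density) auto
  finally show ?thesis .
qed

lemma integral_coding:
  fixes h :: "'a \<Rightarrow> complex"
  assumes [measurable]: "h \<in> borel_measurable M"
  shows "(\<integral>x. indicator (R i) x *\<^sub>R h (\<sigma> x) \<partial>M) = (\<integral>y. \<phi> i y *\<^sub>R h y \<partial>M)"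
proof -
  have "(\<integral>x. indicator (R i) x *\<^sub>R h (\<sigma> x) \<partial>M) = (\<integral>x. h (\<sigma> x) \<partial>density M (\<lambda>x. ennreal (indicator (R i) x)))"
    by (subst integral_density) auto
  also have "\<dots> = (\<integral>x. h (\<sigma> x) \<partial>density M (indicator (R i)))"
    by (simp add: ennreal_indicator)
  also have "\<dots> = (\<integral>y. h y \<partial>distr (density M (indicator (R i))) M \<sigma>)"
    by (subst integral_distr) auto
  also have "\<dots> = (\<integral>y. \<phi> i y *\<^sub>R h y \<partial>M)"
    unfolding distr_coding by (subst integral_density) (auto simp: \<phi>_nonneg)
  finally show ?thesis .
qed

text \<open>\<open>s i\<close> maps null sets to null sets.\<close>

lemma AE_coding:
  assumes P: "AE y in M. y \<in> D i \<longrightarrow> P y"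
  shows "AE x in M. x \<in> R i \<longrightarrow> P (\<sigma> x)"
proof -
  obtain N where N: "{y \<in> space M. \<not> (y \<in> D i \<longrightarrow> P y)} \<subseteq> N" "N \<in> null_sets M"
    using P by (rule AE_E) (auto simp: null_sets_def)
  have NM [measurable]: "N \<inter> D i \<in> sets M" using N by auto
  have "emeasure M (s i ` (N \<inter> D i)) = (\<integral>\<^sup>+y. ennreal (\<phi> i y) * indicator (N \<inter> D i) y \<partial>M)"
    using NM by (intro emeasure_branch) auto
  also have "\<dots> = 0"
    using AE_not_in[OF N(2)] by (subst nn_integral_0_iff_AE) (measurable, auto elim!: eventually_mono)
  finally have "s i ` (N \<inter> D i) \<in> null_sets M"
    using image_sets[OF NM] by (auto simp: null_sets_def)
  moreover have "{x \<in> space M. \<not> (x \<in> R i \<longrightarrow> P (\<sigma> x))} \<subseteq> s i ` (N \<inter> D i)"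
    using N(1) sets.sets_into_space[OF domain_measurable[of i]] by auto
  ultimately show ?thesis by (rule AE_I')
qed

lemma branch_preimage:
  assumes "N \<in> sets M"
  shows "{y \<in> D i. s i y \<in> N} \<in> sets M"
proof -
  have "s i -` N \<inter> space (restrict_space M (D i)) \<in> sets (restrict_space M (D i))"
    using measurable_branch assms by (rule measurable_sets)
  moreover have "s i -` N \<inter> space (restrict_space M (D i)) = {y \<in> D i. s i y \<in> N}"
    using sets.sets_into_space[OF domain_measurable[of i]] by (auto simp: space_restrict_space)
  ultimately show ?thesis
    by (auto simp: sets_restrict_space_iff)
qed

text \<open>Preimages of null sets under \<open>s i\<close> are null sets. Here positivity of the derivative is needed.\<close>

lemma AE_branch:
  assumes P: "AE x in M. P x"
  shows "AE y in M. y \<in> D i \<longrightarrow> P (s i y)"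
proof -
  obtain N where N: "{x \<in> space M. \<not> P x} \<subseteq> N" "N \<in> null_sets M"
    using P by (rule AE_E) (auto simp: null_sets_def)
  define B where "B = {y \<in> D i. s i y \<in> N}"
  have B [measurable]: "B \<in> sets M" "B \<subseteq> D i"
    using branch_preimage N(2) by (auto simp: B_def)
  have "emeasure M (s i ` B) \<le> emeasure M N"
    using N(2) by (intro emeasure_mono) (auto simp: B_def)
  then have "(\<integral>\<^sup>+y. ennreal (\<phi> i y) * indicator B y \<partial>M) = 0"
    using N(2) emeasure_branch[OF B] by auto
  then have "AE y in M. ennreal (\<phi> i y) * indicator B y = 0"
    by (subst (asm) nn_integral_0_iff_AE) auto
  then show ?thesis
    using \<phi>_pos[of i]
  proof (eventually_elim, intro impI)
    fix y assume "ennreal (\<phi> i y) * indicator B y = 0" "y \<in> D i \<longrightarrow> 0 < \<phi> i y" and y: "y \<in> D i"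
    then have "y \<notin> B" by auto
    then have "s i y \<notin> N" using y by (auto simp: B_def)
    moreover have "s i y \<in> space M"
      using y sets.sets_into_space[OF range_measurable[of i]] by auto
    ultimately show "P (s i y)" using N(1) by auto
  qed
qed

lemma branch_compose_measurable:
  fixes h :: "'a \<Rightarrow> complex"
  assumes "h \<in> borel_measurable M"
  shows "(\<lambda>y. indicator (D i) y * h (s i y)) \<in> borel_measurable M"
proof -
  have "(\<lambda>y. h (s i y)) \<in> borel_measurable (restrict_space M (D i))"
    using measurable_branch assms by (rule measurable_compose)
  then have "(\<lambda>y. indicator (D i) y *\<^sub>R h (s i y)) \<in> borel_measurable M"
    by (subst (asm) borel_measurable_restrict_space_iff) auto
  moreover have "indicator (D i) y *\<^sub>R h (s i y) = indicator (D i) y * h (s i y)" for y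
    by (simp add: indicator_def)
  ultimately show ?thesis by simp
qed

section \<open>The branch operators on functions\<close>

text \<open>\<open>iso i\<close> is \<open>T\<^sub>i\<close> on functions rather than classes. It is isometric on functions supported in
  \<open>D i\<close>.\<close>

definition iso :: "'n \<Rightarrow> ('a \<Rightarrow> complex) \<Rightarrow> 'a \<Rightarrow> complex"
  where "iso i \<psi> x = indicator (R i) x * of_real (\<Phi> i (\<sigma> x) powr (-1/2)) * \<psi> (\<sigma> x)"

text \<open>\<open>coiso i\<close> is the adjoint of \<open>iso i\<close>, found by substituting \<open>x = s i y\<close> in the inner product.\<close>

definition coiso :: "'n \<Rightarrow> ('a \<Rightarrow> complex) \<Rightarrow> 'a \<Rightarrow> complex"
  where "coiso i \<eta> y = of_real (sqrt (\<phi> i y)) * (indicator (D i) y * \<eta> (s i y))"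

lemma iso_eq: "iso i \<psi> x = indicator (R i) x * (of_real (\<phi> i (\<sigma> x) powr (-1/2)) * \<psi> (\<sigma> x))"
  by (auto simp: iso_def \<phi>_def indicator_def)

lemma iso_measurable [measurable]:
  assumes [measurable]: "\<psi> \<in> borel_measurable M"
  shows "iso i \<psi> \<in> borel_measurable M"
  unfolding iso_eq[abs_def] by measurable

lemma coiso_measurable:
  assumes "\<eta> \<in> borel_measurable M"
  shows "coiso i \<eta> \<in> borel_measurable M"
proof -
  note [measurable] = branch_compose_measurable[OF assms]
  show ?thesis unfolding coiso_def[abs_def] by measurable
qed

lemma nn_integral_iso:
  assumes [measurable]: "\<psi> \<in> borel_measurable M"
  shows "(\<integral>\<^sup>+x. ennreal ((cmod (iso i \<psi> x))\<^sup>2) \<partial>M) \<le> (\<integral>\<^sup>+y. ennreal ((cmod (\<psi> y))\<^sup>2) \<partial>M)"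
proof -
  have "(\<integral>\<^sup>+x. ennreal ((cmod (iso i \<psi> x))\<^sup>2) \<partial>M)
      = (\<integral>\<^sup>+x. indicator (R i) x * ennreal ((\<phi> i (\<sigma> x) powr (-1/2))\<^sup>2 * (cmod (\<psi> (\<sigma> x)))\<^sup>2) \<partial>M)"
    by (intro nn_integral_cong) (simp add: iso_eq indicator_def norm_mult power_mult_distrib)
  also have "\<dots> = (\<integral>\<^sup>+y. ennreal (\<phi> i y) * ennreal ((\<phi> i y powr (-1/2))\<^sup>2 * (cmod (\<psi> y))\<^sup>2) \<partial>M)"
    by (rule nn_integral_coding) measurable
  also have "\<dots> \<le> (\<integral>\<^sup>+y. ennreal ((cmod (\<psi> y))\<^sup>2) \<partial>M)"
  proof (rule nn_integral_mono_AE, use \<phi>_nonneg[of i] in eventually_elim)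
    fix y assume nn: "0 \<le> \<phi> i y"
    show "ennreal (\<phi> i y) * ennreal ((\<phi> i y powr (-1/2))\<^sup>2 * (cmod (\<psi> y))\<^sup>2) \<le> ennreal ((cmod (\<psi> y))\<^sup>2)"
    proof (cases "\<phi> i y = 0")
      case False
      then have "0 < \<phi> i y" using nn by simp
      then show ?thesis
        by (simp add: ennreal_mult[symmetric] powr_neg_half power_divide)
    qed simp
  qed
  finally show ?thesis .
qed

lemma nn_integral_coiso:
  assumes [measurable]: "\<eta> \<in> borel_measurable M"
  shows "(\<integral>\<^sup>+y. ennreal ((cmod (coiso i \<eta> y))\<^sup>2) \<partial>M) \<le> (\<integral>\<^sup>+x. ennreal ((cmod (\<eta> x))\<^sup>2) \<partial>M)"
proof -
  note [measurable] = branch_compose_measurable[OF assms]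
  have "(\<integral>\<^sup>+y. ennreal ((cmod (coiso i \<eta> y))\<^sup>2) \<partial>M)
      = (\<integral>\<^sup>+y. ennreal (\<phi> i y) * ennreal ((cmod (indicator (D i) y * \<eta> (s i y)))\<^sup>2) \<partial>M)"
    using \<phi>_nonneg[of i]
    by (intro nn_integral_cong_AE, eventually_elim)
      (simp add: coiso_def norm_mult power_mult_distrib ennreal_mult)
  also have "\<dots> = (\<integral>\<^sup>+x. indicator (R i) x * ennreal ((cmod (indicator (D i) (\<sigma> x) * \<eta> (s i (\<sigma> x))))\<^sup>2) \<partial>M)"
    by (rule nn_integral_coding[symmetric]) measurable
  also have "\<dots> \<le> (\<integral>\<^sup>+x. ennreal ((cmod (\<eta> x))\<^sup>2) \<partial>M)"
    by (intro nn_integral_mono) (auto simp: indicator_def)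
  finally show ?thesis .
qed

lemma iso_sq_integrable [simp]: "\<psi> \<in> sq_integrable M \<Longrightarrow> iso i \<psi> \<in> sq_integrable M"
  by (rule sq_integrable_dominated[OF _ iso_measurable nn_integral_iso])
    (simp_all add: sq_integrable_measurable)

lemma coiso_sq_integrable [simp]: "\<eta> \<in> sq_integrable M \<Longrightarrow> coiso i \<eta> \<in> sq_integrable M"
  by (rule sq_integrable_dominated[OF _ coiso_measurable nn_integral_coiso])
    (simp_all add: sq_integrable_measurable)

lemma indicator_sq_integrable [simp]:
  assumes f: "f \<in> sq_integrable M" and B [measurable]: "B \<in> sets M"
  shows "(\<lambda>x. indicator B x * f x) \<in> sq_integrable M"
proof -
  note [measurable] = sq_integrable_measurable[OF f]
  show ?thesis
    by (rule sq_integrable_dominated[OF f], measurable, intro nn_integral_mono)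
      (auto simp: indicator_def)
qed

lemma integral_iso_coiso:
  assumes \<psi>: "\<psi> \<in> sq_integrable M" and \<eta>: "\<eta> \<in> sq_integrable M"
  shows "(\<integral>x. iso i \<psi> x * cnj (\<eta> x) \<partial>M) = (\<integral>y. \<psi> y * cnj (coiso i \<eta> y) \<partial>M)"
proof -
  note [measurable] = sq_integrable_measurable[OF \<psi>] sq_integrable_measurable[OF \<eta>]
    branch_compose_measurable[OF sq_integrable_measurable[OF \<eta>], of i]
  have cnj [measurable]: "cnj \<in> borel_measurable borel"
    by (intro borel_measurable_continuous_onI continuous_intros)
  define h where "h y = of_real (\<phi> i y powr (-1/2)) * \<psi> y * cnj (indicator (D i) y * \<eta> (s i y))" for y
  have [measurable]: "h \<in> borel_measurable M"
    unfolding h_def[abs_def]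
    using measurable_compose[OF branch_compose_measurable[OF sq_integrable_measurable[OF \<eta>], of i] cnj]
    by measurable
  have "(\<integral>x. iso i \<psi> x * cnj (\<eta> x) \<partial>M) = (\<integral>x. indicator (R i) x *\<^sub>R h (\<sigma> x) \<partial>M)"
    by (intro Bochner_Integration.integral_cong) (auto simp: iso_eq h_def indicator_def)
  also have "\<dots> = (\<integral>y. \<phi> i y *\<^sub>R h y \<partial>M)"
    by (rule integral_coding) measurable
  also have "\<dots> = (\<integral>y. \<psi> y * cnj (coiso i \<eta> y) \<partial>M)"
  proof (rule integral_cong_AE)
    show "AE y in M. \<phi> i y *\<^sub>R h y = \<psi> y * cnj (coiso i \<eta> y)"
      using \<phi>_pos[of i]
    proof eventually_elim
      case (elim y)
      show ?case
      proof (cases "y \<in> D i")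
        case True
        then have "\<phi> i y > 0" using elim by simp
        then have "\<phi> i y * (\<phi> i y powr (-1/2)) = sqrt (\<phi> i y)"
          by (simp add: powr_neg_half real_div_sqrt)
        then show ?thesis
          using True by (simp add: h_def coiso_def scaleR_conv_of_real mult_ac
              flip: of_real_mult)
      qed (simp add: h_def coiso_def)
    qed
    show "(\<lambda>y. \<psi> y * cnj (coiso i \<eta> y)) \<in> borel_measurable M"
      using \<psi> \<eta> by (intro borel_measurable_integrable integrable_inner) auto
  qed measurable
  finally show ?thesis .
qed

lemma iso_cong_AE:
  assumes "AE x in M. f x = g x"
  shows "AE x in M. iso i f x = iso i g x"
proof -
  have "AE x in M. x \<in> R i \<longrightarrow> f (\<sigma> x) = g (\<sigma> x)"
    using assms by (intro AE_coding) auto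
  then show ?thesis by eventually_elim (auto simp: iso_def indicator_def)
qed

lemma coiso_cong_AE:
  assumes "AE x in M. f x = g x"
  shows "AE y in M. coiso i f y = coiso i g y"
  using AE_branch[OF assms, of i] by eventually_elim (auto simp: coiso_def indicator_def)

lemma iso_coiso: "AE x in M. iso i (coiso i \<eta>) x = indicator (R i) x * \<eta> x"
  using AE_coding[OF \<phi>_pos[of i]]
proof eventually_elim
  case (elim x)
  show ?case
  proof (cases "x \<in> R i")
    case True
    then have pos: "\<phi> i (\<sigma> x) > 0" and x: "\<sigma> x \<in> D i" "s i (\<sigma> x) = x" using elim range_coding by auto
    then have "\<phi> i (\<sigma> x) powr (-1/2) * sqrt (\<phi> i (\<sigma> x)) = 1" by (simp add: powr_neg_half)
    then show ?thesis using True x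
      by (simp add: iso_eq coiso_def mult.assoc[symmetric] flip: of_real_mult)
  qed (simp add: iso_def)
qed

lemma coiso_iso: "AE y in M. coiso i (iso i \<psi>) y = indicator (D i) y * \<psi> y"
  using \<phi>_pos[of i]
proof eventually_elim
  case (elim y)
  show ?case
  proof (cases "y \<in> D i")
    case True
    then have pos: "\<phi> i y > 0" using elim by simp
    then have "sqrt (\<phi> i y) * \<phi> i y powr (-1/2) = 1" by (simp add: powr_neg_half)
    then show ?thesis using True
      by (simp add: iso_eq coiso_def mult.assoc[symmetric] flip: of_real_mult)
  qed (simp add: coiso_def)
qed

lemma iso_indicator: "iso i (\<lambda>y. indicator (D i) y * \<psi> y) = iso i \<psi>"
  by (auto simp: iso_def indicator_def fun_eq_iff)

lemma sum_indicator_ranges: "AE x in M. (\<Sum>i\<in>UNIV. indicator (R i) x) = (1 :: complex)"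
proof -
  have "AE x in M. x \<notin> space M - (\<Union>i. R i)"
    using ranges_cover by (intro AE_not_in) (auto simp: null_sets_def)
  moreover have "AE x in M. \<forall>i j. i \<noteq> j \<longrightarrow> x \<notin> R i \<inter> R j"
  proof -
    have "AE x in M. \<forall>i\<in>UNIV. \<forall>j\<in>UNIV. i \<noteq> j \<longrightarrow> x \<notin> R i \<inter> R j"
    proof (intro AE_finite_allI finite)
      fix i j :: 'n
      show "AE x in M. i \<noteq> j \<longrightarrow> x \<notin> R i \<inter> R j"
      proof (cases "i = j")
        case False
        then have "AE x in M. x \<notin> R i \<inter> R j"
          using ranges_disjoint[OF False] by (intro AE_not_in) (auto simp: null_sets_def)
        then show ?thesis by auto
      qed simp
    qed
    then show ?thesis by simp
  qed
  ultimately show ?thesis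
    using AE_space
  proof eventually_elim
    case (elim x)
    then obtain i where i: "x \<in> R i" by auto
    then have "indicator (R j) x = (if j = i then 1 else 0 :: complex)" for j
      using elim by (auto simp: indicator_def)
    then show ?case by simp
  qed
qed

section \<open>The branch operators on classes\<close>

interpretation H: hilbert_carrier "L2 M" by (rule hilbert_carrier_L2)

abbreviation T :: "'n \<Rightarrow> ('a \<Rightarrow> complex) set \<Rightarrow> ('a \<Rightarrow> complex) set"
  where "T \<equiv> branch_op M D s \<Phi> \<sigma>"

text \<open>The adjoint of \<open>T i\<close>, see \<open>star_T\<close>.\<close>

definition T' :: "'n \<Rightarrow> ('a \<Rightarrow> complex) set \<Rightarrow> ('a \<Rightarrow> complex) set"
  where "T' i = (\<lambda>u\<in>carrier (L2 M). L2_class M (coiso i (rep u)))"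

lemma T_class:
  assumes f: "f \<in> sq_integrable M"
  shows "T i (L2_class M f) = L2_class M (iso i f)"
proof -
  have "T i (L2_class M f) = L2_class M (iso i (rep (L2_class M f)))"
    using f by (simp add: branch_op_def iso_def[abs_def])
  also have "\<dots> = L2_class M (iso i f)"
    using rep_L2_class(1)[OF f] f iso_cong_AE[OF rep_L2_class(2)[OF f]]
    by (simp add: L2_class_eq_iff)
  finally show ?thesis .
qed

lemma T'_class:
  assumes f: "f \<in> sq_integrable M"
  shows "T' i (L2_class M f) = L2_class M (coiso i f)"
proof -
  have "T' i (L2_class M f) = L2_class M (coiso i (rep (L2_class M f)))"
    using f by (simp add: T'_def)
  also have "\<dots> = L2_class M (coiso i f)"
    using rep_L2_class(1)[OF f] f coiso_cong_AE[OF rep_L2_class(2)[OF f]]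
    by (simp add: L2_class_eq_iff)
  finally show ?thesis .
qed

lemma L2_norm_le:
  assumes f: "f \<in> sq_integrable M" and g: "g \<in> sq_integrable M"
    and le: "(\<integral>\<^sup>+x. ennreal ((cmod (f x))\<^sup>2) \<partial>M) \<le> (\<integral>\<^sup>+x. ennreal ((cmod (g x))\<^sup>2) \<partial>M)"
  shows "vnorm (L2 M) (L2_class M f) \<le> 1 * vnorm (L2 M) (L2_class M g)"
  using le f g by (simp add: L2_norm nn_integral_sq)

lemma T_bounded: "T i \<in> bounded_ops (L2 M)"
proof (rule H.bounded_opsI)
  show "T i \<in> extensional (carrier (L2 M))" by (simp add: branch_op_def)
  fix u v c assume u: "u \<in> carrier (L2 M)"
  then obtain f where f: "f \<in> sq_integrable M" "u = L2_class M f" by (rule L2_carrierE)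
  show "T i u \<in> carrier (L2 M)" using f by (simp add: T_class)
  show "vnorm (L2 M) (T i u) \<le> 1 * vnorm (L2 M) u"
    unfolding f(2) T_class[OF f(1)] using f(1)
    by (intro L2_norm_le nn_integral_iso) (auto simp: sq_integrable_measurable)
  have "iso i (\<lambda>x. c * f x) = (\<lambda>x. c * iso i f x)" by (auto simp: iso_def)
  then show "T i (vscale (L2 M) c u) = vscale (L2 M) c (T i u)"
    using f by (simp add: T_class L2_scale)
  assume "v \<in> carrier (L2 M)"
  then obtain g where g: "g \<in> sq_integrable M" "v = L2_class M g" by (rule L2_carrierE)
  have "iso i (\<lambda>x. f x + g x) = (\<lambda>x. iso i f x + iso i g x)" by (auto simp: iso_def distrib_left)
  then show "T i (vadd (L2 M) u v) = vadd (L2 M) (T i u) (T i v)"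
    using f g by (simp add: T_class L2_add)
qed

lemma T'_bounded: "T' i \<in> bounded_ops (L2 M)"
proof (rule H.bounded_opsI)
  show "T' i \<in> extensional (carrier (L2 M))" by (simp add: T'_def)
  fix u v c assume u: "u \<in> carrier (L2 M)"
  then obtain f where f: "f \<in> sq_integrable M" "u = L2_class M f" by (rule L2_carrierE)
  show "T' i u \<in> carrier (L2 M)" using f by (simp add: T'_class)
  show "vnorm (L2 M) (T' i u) \<le> 1 * vnorm (L2 M) u"
    unfolding f(2) T'_class[OF f(1)] using f(1)
    by (intro L2_norm_le nn_integral_coiso) (auto simp: sq_integrable_measurable)
  have "coiso i (\<lambda>x. c * f x) = (\<lambda>x. c * coiso i f x)" by (auto simp: coiso_def)
  then show "T' i (vscale (L2 M) c u) = vscale (L2 M) c (T' i u)"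
    using f by (simp add: T'_class L2_scale)
  assume "v \<in> carrier (L2 M)"
  then obtain g where g: "g \<in> sq_integrable M" "v = L2_class M g" by (rule L2_carrierE)
  have "coiso i (\<lambda>x. f x + g x) = (\<lambda>x. coiso i f x + coiso i g x)" by (auto simp: coiso_def distrib_left)
  then show "T' i (vadd (L2 M) u v) = vadd (L2 M) (T' i u) (T' i v)"
    using f g by (simp add: T'_class L2_add)
qed

lemma star_T: "star (operator_algebra (L2 M)) (T i) = T' i"
proof (rule H.adjoint_unique[OF T'_bounded T_bounded])
  fix u v assume "u \<in> carrier (L2 M)" "v \<in> carrier (L2 M)"
  then obtain f g where "f \<in> sq_integrable M" "u = L2_class M f" "g \<in> sq_integrable M" "v = L2_class M g"
    by (metis L2_carrierE)
  then show "vinner (L2 M) (T i u) v = vinner (L2 M) u (T' i v)"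
    by (simp add: T_class T'_class L2_inner integral_iso_coiso)
qed

lemma T_T'_class:
  assumes f: "f \<in> sq_integrable M"
  shows "T i (T' i (L2_class M f)) = L2_class M (\<lambda>x. indicator (R i) x * f x)"
  using f iso_coiso[of i f] by (simp add: T_class T'_class L2_class_eq_iff)

lemma T'_T_class:
  assumes f: "f \<in> sq_integrable M"
  shows "T' i (T i (L2_class M f)) = L2_class M (\<lambda>x. indicator (D i) x * f x)"
  using f coiso_iso[of i f] by (simp add: T_class T'_class L2_class_eq_iff)

lemma T_partial_isometry:
  "T i \<otimes>\<^bsub>operator_algebra (L2 M)\<^esub> star (operator_algebra (L2 M)) (T i) \<otimes>\<^bsub>operator_algebra (L2 M)\<^esub> T i = T i"
proof (rule H.op_eqI)
  fix u v assume u: "u \<in> carrier (L2 M)"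
  then obtain f where f: "f \<in> sq_integrable M" "u = L2_class M f" by (rule L2_carrierE)
  have "T i (T' i (T i u)) = T i (L2_class M (\<lambda>x. indicator (D i) x * f x))"
    unfolding f(2) T'_T_class[OF f(1)] ..
  also have "\<dots> = T i u"
    using f by (simp add: T_class iso_indicator)
  finally have "T i (T' i (T i u)) = T i u" .
  with u show "vinner (L2 M) ((T i \<otimes>\<^bsub>operator_algebra (L2 M)\<^esub> star (operator_algebra (L2 M)) (T i)
      \<otimes>\<^bsub>operator_algebra (L2 M)\<^esub> T i) u) v = vinner (L2 M) (T i u) v"
    using u T_bounded[of i] by (simp add: star_T)
qed (use T_bounded T'_bounded in \<open>simp_all add: star_T\<close>)

text \<open>\<open>T i T i*\<close> is multiplication by the indicator of \<open>R i\<close>, so a linear combination of these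
  projections is known as soon as the combination of the indicators is. Both Cuntz--Krieger relations
  are instances: for \<open>B\<close> the whole space and for \<open>B = D i\<close>.\<close>

lemma sum_range_projections:
  assumes f: "f \<in> sq_integrable M" and g: "g \<in> sq_integrable M"
    and B: "AE x in M. indicator B x = (\<Sum>j\<in>UNIV. c j * indicator (R j) x)"
    and Bm: "B \<in> sets M"
  shows "(\<Sum>j\<in>UNIV. c j * vinner (L2 M) (T j (T' j (L2_class M f))) (L2_class M g))
    = (\<integral>x. indicator B x * f x * cnj (g x) \<partial>M)"
proof -
  have "(\<Sum>j\<in>UNIV. c j * vinner (L2 M) (T j (T' j (L2_class M f))) (L2_class M g))
      = (\<Sum>j\<in>UNIV. \<integral>x. c j * (indicator (R j) x * f x * cnj (g x)) \<partial>M)"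
    using f g by (simp add: T_T'_class L2_inner)
  also have "\<dots> = (\<integral>x. (\<Sum>j\<in>UNIV. c j * (indicator (R j) x * f x * cnj (g x))) \<partial>M)"
    using integrable_inner[OF indicator_sq_integrable[OF f range_measurable] g]
    by (intro Bochner_Integration.integral_sum[symmetric]) auto
  also have "\<dots> = (\<integral>x. indicator B x * f x * cnj (g x) \<partial>M)"
  proof (rule integral_cong_AE)
    show "(\<lambda>x. \<Sum>j\<in>UNIV. c j * (indicator (R j) x * f x * cnj (g x))) \<in> borel_measurable M"
      using integrable_inner[OF indicator_sq_integrable[OF f range_measurable] g]
      by (intro borel_measurable_integrable Bochner_Integration.integrable_sum) auto
    show "(\<lambda>x. indicator B x * f x * cnj (g x)) \<in> borel_measurable M"
      using integrable_inner[OF indicator_sq_integrable[OF f Bm] g] by (intro borel_measurable_integrable)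
    show "AE x in M. (\<Sum>j\<in>UNIV. c j * (indicator (R j) x * f x * cnj (g x)))
        = indicator B x * f x * cnj (g x)"
      using B
    proof eventually_elim
      case (elim x)
      show ?case unfolding elim sum_distrib_right by (simp only: mult.assoc)
    qed
  qed
  finally show ?thesis .
qed

lemma sum_T_T':
  "(\<Oplus>\<^bsub>operator_algebra (L2 M)\<^esub>i\<in>UNIV. T i \<otimes>\<^bsub>operator_algebra (L2 M)\<^esub> star (operator_algebra (L2 M)) (T i))
    = \<one>\<^bsub>operator_algebra (L2 M)\<^esub>"
  (is "?S = _")
proof (rule H.op_eqI)
  have cl: "T i \<otimes>\<^bsub>operator_algebra (L2 M)\<^esub> T' i \<in> bounded_ops (L2 M)" for i
    using T_bounded T'_bounded by simp
  have "?S \<in> carrier (operator_algebra (L2 M))"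
    using cl by (intro H.ops.finsum_closed) (auto simp: star_T H.operator_algebra_simps(1))
  then show "?S \<in> bounded_ops (L2 M)" by (simp add: H.operator_algebra_simps(1))
  fix u v assume uv: "u \<in> carrier (L2 M)" "v \<in> carrier (L2 M)"
  then obtain f g where fg: "f \<in> sq_integrable M" "u = L2_class M f" "g \<in> sq_integrable M" "v = L2_class M g"
    by (metis L2_carrierE)
  have "vinner (L2 M) (?S u) v = (\<Sum>i\<in>UNIV. vinner (L2 M) ((T i \<otimes>\<^bsub>operator_algebra (L2 M)\<^esub> T' i) u) v)"
    unfolding star_T using cl uv by (intro H.finsum_op_apply) auto
  also have "\<dots> = (\<Sum>i\<in>UNIV. 1 * vinner (L2 M) (T i (T' i u)) v)"
    using uv by simp
  also have "\<dots> = (\<integral>x. indicator (space M) x * f x * cnj (g x) \<partial>M)"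
    unfolding fg
  proof (rule sum_range_projections[OF fg(1,3)])
    show "AE x in M. indicator (space M) x = (\<Sum>j\<in>UNIV. 1 * indicator (R j) x :: complex)"
      using sum_indicator_ranges AE_space by eventually_elim simp
  qed simp
  also have "\<dots> = vinner (L2 M) (\<one>\<^bsub>operator_algebra (L2 M)\<^esub> u) v"
    using fg uv by (auto simp: L2_inner intro!: Bochner_Integration.integral_cong)
  finally show "vinner (L2 M) (?S u) v = vinner (L2 M) (\<one>\<^bsub>operator_algebra (L2 M)\<^esub> u) v" .
qed simp

lemma T'_T_eq_sum:
  fixes A :: "nat ^ 'n ^ 'n"
  assumes A: "AE x in M. (indicator (D i) x :: nat) = (\<Sum>j\<in>UNIV. A $ i $ j * indicator (R j) x)"
  shows "star (operator_algebra (L2 M)) (T i) \<otimes>\<^bsub>operator_algebra (L2 M)\<^esub> T i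
    = (\<Oplus>\<^bsub>operator_algebra (L2 M)\<^esub>j\<in>UNIV. cscale (operator_algebra (L2 M)) (of_nat (A $ i $ j))
        (T j \<otimes>\<^bsub>operator_algebra (L2 M)\<^esub> star (operator_algebra (L2 M)) (T j)))"
  (is "_ = ?S")
proof (rule H.op_eqI)
  have cl: "cscale (operator_algebra (L2 M)) c (T j \<otimes>\<^bsub>operator_algebra (L2 M)\<^esub> T' j)
      \<in> bounded_ops (L2 M)" for c j
    using T_bounded T'_bounded by simp
  have "?S \<in> carrier (operator_algebra (L2 M))"
    using cl by (intro H.ops.finsum_closed) (auto simp: star_T H.operator_algebra_simps(1))
  then show "?S \<in> bounded_ops (L2 M)" by (simp add: H.operator_algebra_simps(1))
  show "star (operator_algebra (L2 M)) (T i) \<otimes>\<^bsub>operator_algebra (L2 M)\<^esub> T i \<in> bounded_ops (L2 M)"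
    using T_bounded T'_bounded by (simp add: star_T)
  fix u v assume uv: "u \<in> carrier (L2 M)" "v \<in> carrier (L2 M)"
  then obtain f g where fg: "f \<in> sq_integrable M" "u = L2_class M f" "g \<in> sq_integrable M" "v = L2_class M g"
    by (metis L2_carrierE)
  have "vinner (L2 M) (?S u) v = (\<Sum>j\<in>UNIV. vinner (L2 M) (cscale (operator_algebra (L2 M)) (of_nat (A $ i $ j))
      (T j \<otimes>\<^bsub>operator_algebra (L2 M)\<^esub> T' j) u) v)"
    unfolding star_T using cl uv by (intro H.finsum_op_apply) auto
  also have "\<dots> = (\<Sum>j\<in>UNIV. of_nat (A $ i $ j) * vinner (L2 M) (T j (T' j u)) v)"
    using uv T_bounded T'_bounded by simp
  also have "\<dots> = (\<integral>x. indicator (D i) x * f x * cnj (g x) \<partial>M)"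
    unfolding fg
  proof (rule sum_range_projections[OF fg(1,3)])
    show "AE x in M. indicator (D i) x = (\<Sum>j\<in>UNIV. of_nat (A $ i $ j) * indicator (R j) x :: complex)"
      using A
    proof eventually_elim
      case (elim x)
      have "(indicator (D i) x :: complex) = of_nat (indicator (D i) x)" by (simp add: indicator_def)
      also have "\<dots> = (\<Sum>j\<in>UNIV. of_nat (A $ i $ j) * indicator (R j) x)"
        unfolding elim of_nat_sum by (intro sum.cong) (auto simp: indicator_def)
      finally show ?case .
    qed
  qed simp
  also have "\<dots> = vinner (L2 M) ((star (operator_algebra (L2 M)) (T i) \<otimes>\<^bsub>operator_algebra (L2 M)\<^esub> T i) u) v"
    using fg uv by (simp add: star_T T'_T_class L2_inner)
  finally show "vinner (L2 M) ((star (operator_algebra (L2 M)) (T i) \<otimes>\<^bsub>operator_algebra (L2 M)\<^esub> T i) u) v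
      = vinner (L2 M) (?S u) v" ..
qed

end

theorem proposition2p5:
  fixes A :: "nat ^ 'n::finite ^ 'n"
    and M :: "'a measure"
    and D :: "'n \<Rightarrow> 'a set"
    and s :: "'n \<Rightarrow> 'a \<Rightarrow> 'a"
    and \<Phi> :: "'n \<Rightarrow> 'a \<Rightarrow> real"
    and \<sigma> :: "'a \<Rightarrow> 'a"
  assumes "\<forall>i j. A $ i $ j \<in> {0, 1}"
    and "\<forall>i. A $ i $ i = 1"
    and "semibranching_function_system M D s \<Phi>"
    and "coding_map M D s \<sigma>"
    and "\<forall>i. AE x in M. (indicator (D i) x :: nat) =
           (\<Sum>j\<in>UNIV. A $ i $ j * indicator (s j ` D j) x)"
  shows "let \<BB> = operator_algebra (L2 M); T = branch_op M D s \<Phi> \<sigma>; T' = (\<lambda>i. star \<BB> (T i)) in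
      (\<forall>i. T i \<in> carrier \<BB> \<and> T' i \<in> carrier \<BB>) \<and>
      (\<forall>i. \<forall>\<xi>\<in>carrier (L2 M). \<forall>\<eta>\<in>carrier (L2 M).
         vinner (L2 M) (T i \<xi>) \<eta> = vinner (L2 M) \<xi> (T' i \<eta>)) \<and>
      (\<Oplus>\<^bsub>\<BB>\<^esub>i\<in>UNIV. T i \<otimes>\<^bsub>\<BB>\<^esub> T' i) = \<one>\<^bsub>\<BB>\<^esub> \<and>
      (\<forall>i. T' i \<otimes>\<^bsub>\<BB>\<^esub> T i =
         (\<Oplus>\<^bsub>\<BB>\<^esub>j\<in>UNIV. cscale \<BB> (of_nat (A $ i $ j)) (T j \<otimes>\<^bsub>\<BB>\<^esub> T' j))) \<and>
      (\<exists>!\<pi>. \<pi> \<in> representations (cuntz_krieger_algebra A) (L2 M) \<and>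
         (\<forall>i. \<pi> (ck_gen A i) = T i))"
proof -
  interpret coded_branches M D s \<Phi> \<sigma>
    using assms(3,4) by (simp add: coded_branches_def coded_branches_axioms_def)
  interpret H: hilbert_carrier "L2 M" by (rule hilbert_carrier_L2)
  have source: "star H.\<BB> (T i) \<otimes>\<^bsub>H.\<BB>\<^esub> T i
      = (\<Oplus>\<^bsub>H.\<BB>\<^esub>j\<in>UNIV. cscale H.\<BB> (of_nat (A $ i $ j)) (T j \<otimes>\<^bsub>H.\<BB>\<^esub> star H.\<BB> (T j)))" for i
    using assms(5) by (intro T'_T_eq_sum) blast
  have "\<exists>!\<pi>. \<pi> \<in> representations (cuntz_krieger_algebra A) (L2 M) \<and> (\<forall>i. \<pi> (ck_gen A i) = T i)"
    by (rule H.ex1_representation[OF T_bounded T_partial_isometry source sum_T_T'])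
  then show ?thesis
    unfolding Let_def using T_bounded T'_bounded source sum_T_T'
    by (intro conjI) (auto simp: H.operator_algebra_simps(1) star_T
        H.inner_star_right[OF T_bounded, unfolded star_T])
qed

end
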